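(* Among all simplices (tetrahedra) contained in the closed unit ball $B_2^3\subset\mathbb{R}^3$, the regular tetrahedron inscribed in the unit sphere has the maximum mean width, and it is the unique maximizer up to isometry.
   Context: For a convex body $K\subset\mathbb{R}^3$, $h_K(u)=\max_{x\in K}u\cdot x$ and the mean width is $w(K)=2\int_{\mathbb{S}^2}h_K(u)\,d\mu(u)$, where $\mu$ is the uniform probability measure on the unit sphere $\mathbb{S}^2$. *)

theory Defs
  imports "HOL-Analysis.Analysis"
begin

definition support_fun :: "(real^3) set \<Rightarrow> real^3 \<Rightarrow> real" where
  "support_fun K u = (SUP x\<in>K. u \<bullet> x)"

text \<open>Uniform probability measure on the unit sphere S^2, realised as the
  normalised cone measure: the image of the uniform (normalised Lebesgue)
  distribution on the unit ball under radial projection x \<mapsto> x/|x|.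
  (The point 0 is a null set.)\<close>
definition sphere_measure :: "(real^3) measure" where
  "sphere_measure = distr (uniform_measure lborel (ball 0 1)) borel (\<lambda>x. x /\<^sub>R norm x)"

definition mean_width :: "(real^3) set \<Rightarrow> real" where
  "mean_width K = 2 * integral\<^sup>L sphere_measure (support_fun K)"

definition reg_tetra :: "(real^3) set" where
  "reg_tetra = convex hull
     { (1 / sqrt 3) *\<^sub>R vector [1, 1, 1],
       (1 / sqrt 3) *\<^sub>R vector [1, -1, -1],
       (1 / sqrt 3) *\<^sub>R vector [-1, 1, -1],
       (1 / sqrt 3) *\<^sub>R vector [-1, -1, 1] }"

end

theory Submission
  imports Defs
begin

text \<open>By convexity of the mean width in the vertices, a simplex in the ball can be replaced by one whose
  vertices lie on the sphere and are positively dependent (so that the origin is interior), without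
  decreasing the mean width, and strictly increasing it unless nothing changes. For such a simplex,
  integration over the normal cones of the vertices gives a multiple of the sum of the terms
  \<open>s * \<beta>\<close> over the twelve pairs (edge, adjacent face), where \<open>s\<close> is half the length of the edge and
  \<open>\<beta>\<close> is the signed spherical distance between the midpoint of the edge and the
  circumcentre of the face. Each pair determines a right spherical triangle with legs
  \<open>arcsin s\<close> and \<open>\<beta>\<close>; the sums of its two other angles over the twelve pairs are both \<open>4\<pi>\<close>, by
  the angle sum of the four faces and around the four vertices. With suitable Lagrange multipliers for
  these two constraints, the sum of the contributions of the two pairs sharing an edge is
  extremal exactly for an edge of the regular tetrahedron.\<close>

section \<open>The inequality for an edge\<close>

text \<open>By the spherical theorem of Pythagoras \<open>c = k * cos b\<close> is the cosine of the
  circumradius of the face. In this variable the \<open>b\<close>-derivative of the Lagrangian has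
  the sign of \<open>(c - 1/3) * (c - crit_cos)\<close>. The root \<open>1/3\<close> is imposed by
  the regular tetrahedron, the other root is the one free parameter of the multipliers, and
  stationarity along the curve \<open>c = 1/3\<close> forces it to be
  \<open>arctan (sqrt 2) / sqrt 2\<close>.

  The two pairs sharing an edge must be estimated together: the Lagrangian is odd in the signed
  distance, which is negative when the circumcentre lies beyond the edge, and there it can fall
  below \<open>edge_min\<close>. What is available is that the two distances have a positive sum
  because the origin is interior. This sum is the exterior dihedral angle, so the width formula is
  the classical sum of edge length times exterior angle.

  A further obstacle is that moving the vertices may flatten the simplex, while the formula needs
  nonzero volume. The inequality survives by a limit. Equality needs no limit, because it forces the
  vertices not to have moved.\<close>

definition crit_cos :: real where "crit_cos = arctan (sqrt 2) / sqrt 2"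

text \<open>Here \<open>s\<close> and \<open>k\<close> are the sine and cosine of half the arc subtended by the edge. The multipliers
  \<open>1/3 + crit_cos\<close> and \<open>1 + crit_cos/3\<close> make the gradient vanish at the regular tetrahedron,
  \<open>s\<^sup>2 = 2/3\<close> and \<open>tan b = sqrt 2\<close>; \<open>edge_min\<close> is the value there.\<close>

definition edge_fun :: "real \<Rightarrow> real \<Rightarrow> real \<Rightarrow> real" where
  "edge_fun s k b = - (1/3 + crit_cos) * arctan (k * sin b / s)
     + (1 + crit_cos / 3) * arctan (tan b / s) - s * b"

definition edge_min :: real where
  "edge_min = 5 * pi / 18 - crit_cos * (pi / 18 + 2 / sqrt 3)"

section \<open>Numerical enclosures of the constants\<close>

lemma arctan_lower_cubic:
  fixes x :: real assumes "0 \<le> x" shows "x - x^3/3 \<le> arctan x"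
proof -
  have "(\<lambda>x. arctan x - (x - x^3/3)) 0 \<le> (\<lambda>x. arctan x - (x - x^3/3)) x"
  proof (rule DERIV_nonneg_imp_nondecreasing[OF assms])
    fix y :: real
    have p: "1 + y^2 > 0" by (smt (verit) zero_le_power2)
    have "((\<lambda>x. arctan x - (x - x^3/3)) has_real_derivative (inverse (1 + y^2) - (1 - y^2))) (at y)"
      by (auto intro!: derivative_eq_intros)
    moreover have "inverse (1 + y^2) - (1 - y^2) = y^4 / (1+y^2)"
      using p by (simp add: field_simps power2_eq_square power4_eq_xxxx)
    ultimately show "\<exists>z. ((\<lambda>x. arctan x - (x - x^3/3)) has_real_derivative z) (at y) \<and> 0 \<le> z"
      using p by auto
  qed
  then show ?thesis by simp
qed

lemma sqrt2_bounds: "1.41421 < sqrt 2" "sqrt 2 < 1.41422"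
  by (rule real_less_rsqrt, simp add: power2_eq_square)
     (rule real_less_lsqrt, auto simp: power2_eq_square)

text \<open>Argument reduction by \<open>pi/4\<close>: the remaining argument is about
  \<open>0.17\<close>, where the cubic lower bound and the linear upper bound of
  \<open>arctan\<close> are already close enough together.\<close>

lemma arctan_sqrt2: "arctan (sqrt 2) = pi/4 + arctan (3 - 2 * sqrt 2)"
proof -
  have b: "\<bar>3 - 2 * sqrt 2\<bar> < 1" using sqrt2_bounds by auto
  have "arctan 1 + arctan (3 - 2 * sqrt 2) = arctan ((1 + (3 - 2 * sqrt 2)) / (1 - 1 * (3 - 2 * sqrt 2)))"
    by (rule arctan_add) (use b in auto)
  also have "(1 + (3 - 2 * sqrt 2)) / (1 - 1 * (3 - 2 * sqrt 2)) = sqrt 2"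
    using sqrt2_bounds by (simp add: field_simps)
  finally show ?thesis by (simp add: arctan_one)
qed

lemma crit_cos_bounds: "0.675 < crit_cos" "crit_cos < 0.677"
proof -
  define x where "x = 3 - 2 * sqrt 2"
  have x: "0.17156 < x" "x < 0.17158" using sqrt2_bounds by (auto simp: x_def)
  have x3: "x^3 \<le> 0.17158^3" using x by (intro power_mono) auto
  have "x - x^3/3 \<le> arctan x" "arctan x \<le> x"
    using x by (auto intro: arctan_lower_cubic arctan_le_self)
  with x x3 arctan_sqrt2 pi_approx have "0.9552 < arctan (sqrt 2)" "arctan (sqrt 2) < 0.957"
    by (auto simp: x_def power3_eq_cube)
  then show "0.675 < crit_cos" "crit_cos < 0.677"
    using sqrt2_bounds by (auto simp: crit_cos_def field_simps)
qed

lemma sqrt3_bounds: "1.73205 < sqrt 3" "sqrt 3 < 1.73206"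
  by (rule real_less_rsqrt, simp add: power2_eq_square)
     (rule real_less_lsqrt, auto simp: power2_eq_square)

text \<open>Used in two ways: \<open>edge_min\<close> is negative, so that the value
  \<open>0\<close> at \<open>b = 0\<close> is no competitor, and \<open>2 * edge_min\<close> is
  below \<open>-0.048\<close>, which leaves room for the crude slope estimate in
  \<open>edge_fun_diff\<close>.\<close>

lemma edge_min_bound: "edge_min < - 0.0240"
proof -
  have "2 / sqrt 3 > 1.15469" using sqrt3_bounds by (auto simp: field_simps)
  then have "pi / 18 + 2 / sqrt 3 > 1.3292" using pi_approx by auto
  then have "crit_cos * (pi / 18 + 2 / sqrt 3) \<ge> 0.675 * 1.3292"
    using crit_cos_bounds by (intro mult_mono) auto
  then show ?thesis using pi_approx by (auto simp: edge_min_def)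
qed

section \<open>Variation of the edge function in the distance \<open>b\<close>\<close>

lemma edge_fun_deriv:
  assumes sk: "0 < s" "0 < k" "s^2 + k^2 = 1" and b: "0 \<le> b" "b < pi/2"
  shows "(edge_fun s k has_real_derivative
     s * (k * cos b - 1/3) * (k * cos b - crit_cos) / (1 - (k * cos b)^2)) (at b)"
proof -
  let ?A = "1/3 + crit_cos" and ?B = "1 + crit_cos/3" and ?P = "1 - (k * cos b)^2"
  have cb: "cos b > 0" using b by (intro cos_gt_zero_pi) auto
  have sc: "(sin b)^2 = 1 - (cos b)^2" by (simp add: sin_squared_eq)
  have k2: "k^2 = 1 - s^2" using sk by simp
  \<comment> \<open>Because of \<open>P1\<close> and \<open>P2\<close> both arctangents get the same
    denominator, the squared sine of the circumradius. The first multiplier is the sum of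
    \<open>1/3\<close> and \<open>crit_cos\<close>, the second is \<open>1\<close> plus their
    product, so the numerator left over is the quadratic with these two roots.\<close>
  have P1: "s^2 + (k * sin b)^2 = ?P"
    by (simp add: power_mult_distrib sc k2 algebra_simps)
  have P2: "(s * cos b)^2 + (sin b)^2 = ?P"
    by (simp add: power_mult_distrib sc k2 algebra_simps)
  have Ppos: "?P > 0" unfolding P1[symmetric] using sk by (simp add: add_pos_nonneg)
  have d1: "((\<lambda>b. arctan (k * sin b / s)) has_real_derivative (s * k * cos b / ?P)) (at b)"
  proof -
    have "((\<lambda>b. arctan (k * sin b / s)) has_real_derivative
       (k * cos b / s * inverse (1 + (k * sin b / s)^2))) (at b)"
      using sk by (auto intro!: derivative_eq_intros simp: power2_eq_square divide_simps)
    moreover have "1 + (k * sin b / s)^2 = ?P / s^2"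
      unfolding P1[symmetric] using sk by (simp add: power_divide add_divide_distrib)
    moreover have "k * cos b / s * inverse (?P / s^2) = s * k * cos b / ?P"
      using sk Ppos by (simp add: power2_eq_square)
    ultimately show ?thesis by simp
  qed
  have d2: "((\<lambda>b. arctan (tan b / s)) has_real_derivative (s / ?P)) (at b)"
  proof -
    have "((\<lambda>b. arctan (tan b / s)) has_real_derivative
       (inverse ((cos b)^2) / s * inverse (1 + (tan b / s)^2))) (at b)"
      using sk cb by (auto intro!: derivative_eq_intros simp: power2_eq_square divide_simps)
    moreover have "1 + (tan b / s)^2 = ?P / (s * cos b)^2"
      unfolding P2[symmetric] using sk cb
      by (simp add: power_divide add_divide_distrib tan_def power_mult_distrib)
    moreover have "inverse ((cos b)^2) / s * inverse (?P / (s * cos b)^2) = s / ?P"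
      using sk Ppos cb by (simp add: power2_eq_square divide_simps)
    ultimately show ?thesis by simp
  qed
  have "(edge_fun s k has_real_derivative (- ?A * (s * k * cos b / ?P) + ?B * (s / ?P) - s)) (at b)"
    unfolding edge_fun_def[abs_def]
    by (intro DERIV_diff DERIV_add DERIV_cmult d1 d2 DERIV_cmult_Id)
  moreover have "- ?A * (s * k * cos b / ?P) + ?B * (s / ?P) - s
      = s * (k * cos b - 1/3) * (k * cos b - crit_cos) / ?P"
  proof -
    have "- ?A * (s * c / p) + ?B * (s / p) - s = s * (c - 1/3) * (c - crit_cos) / p"
      if "p = 1 - c^2" "p \<noteq> 0" for c p :: real
    proof -
      have "- ?A * (s * c / p) + ?B * (s / p) - s = (- ?A * (s * c) + ?B * s - s * p) / p"
        using that(2) by (simp add: add_divide_distrib diff_divide_distrib)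
      also have "- ?A * (s * c) + ?B * s - s * p = s * (c - 1/3) * (c - crit_cos)"
        unfolding that(1) by (simp add: field_simps power2_eq_square)
      finally show ?thesis .
    qed
    from this[of ?P "k * cos b"] show ?thesis using Ppos by (simp add: mult.assoc)
  qed
  ultimately show ?thesis by simp
qed

lemma edge_fun_0 [simp]: "edge_fun s k 0 = 0"
  by (simp add: edge_fun_def)

lemma edge_fun_minus [simp]: "edge_fun s k (- b) = - edge_fun s k b"
  by (simp add: edge_fun_def arctan_minus)

lemma edge_deriv_sign:
  assumes sk: "0 < s" "0 < k" "s^2 + k^2 = 1" and b: "0 \<le> b" "b < pi/2"
  shows "1 - (k * cos b)^2 > 0"
proof -
  have "k < 1" using sk by (smt (verit) one_power2 power_mono zero_less_power)
  moreover have "cos b > 0" using b by (intro cos_gt_zero_pi) auto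
  ultimately have "k * cos b < 1" "0 < k * cos b"
    using sk cos_le_one[of b] by (smt (verit) mult_le_cancel_left2, simp)
  then have "(k * cos b)^2 < 1" by (simp add: abs_square_less_1)
  then show ?thesis by simp
qed

text \<open>Since \<open>k * cos x\<close> decreases in \<open>x\<close>, the condition at one end
  of the interval keeps it on the same side of both roots throughout. In
  \<open>edge_fun_antimono\<close> the conditions at both ends keep it between the roots.\<close>

lemma edge_fun_mono:
  assumes sk: "0 < s" "0 < k" "s^2 + k^2 = 1" and b: "0 \<le> a" "a \<le> b" "b < pi/2"
    and sgn: "k * cos a \<le> 1/3 \<or> k * cos b \<ge> crit_cos"
  shows "edge_fun s k a \<le> edge_fun s k b"
proof (rule DERIV_nonneg_imp_nondecreasing[OF b(2)])
  fix x assume x: "a \<le> x" "x \<le> b"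
  have cc: "k * cos b \<le> k * cos x" "k * cos x \<le> k * cos a"
    using x b sk pi_gt_zero by (auto intro!: mult_left_mono cos_monotone_0_pi_le)
  have "0 \<le> (k * cos x - 1/3) * (k * cos x - crit_cos)"
    using sgn
  proof
    assume "k * cos a \<le> 1/3"
    then show ?thesis using cc crit_cos_bounds by (intro mult_nonpos_nonpos) auto
  next
    assume "k * cos b \<ge> crit_cos"
    then show ?thesis using cc crit_cos_bounds by (intro mult_nonneg_nonneg) auto
  qed
  then have "0 \<le> s * ((k * cos x - 1/3) * (k * cos x - crit_cos)) / (1 - (k * cos x)^2)"
    using edge_deriv_sign[OF sk, of x] x b sk by (simp add: mult_nonneg_nonneg)
  then show "\<exists>y. (edge_fun s k has_real_derivative y) (at x) \<and> 0 \<le> y"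
    using edge_fun_deriv[OF sk order_trans[OF b(1) x(1)] le_less_trans[OF x(2) b(3)]]
    unfolding mult.assoc by blast
qed

lemma edge_fun_antimono:
  assumes sk: "0 < s" "0 < k" "s^2 + k^2 = 1" and b: "0 \<le> a" "a \<le> b" "b < pi/2"
    and sgn: "k * cos a \<le> crit_cos" "k * cos b \<ge> 1/3"
  shows "edge_fun s k a \<ge> edge_fun s k b"
proof (rule DERIV_nonpos_imp_nonincreasing[OF b(2)])
  fix x assume x: "a \<le> x" "x \<le> b"
  have cc: "k * cos b \<le> k * cos x" "k * cos x \<le> k * cos a"
    using x b sk pi_gt_zero by (auto intro!: mult_left_mono cos_monotone_0_pi_le)
  have "0 \<ge> (k * cos x - 1/3) * (k * cos x - crit_cos)"
    using cc sgn by (intro mult_nonneg_nonpos) auto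
  then have "0 \<ge> s * ((k * cos x - 1/3) * (k * cos x - crit_cos)) / (1 - (k * cos x)^2)"
    using edge_deriv_sign[OF sk, of x] x b sk by (simp add: mult_nonneg_nonpos divide_nonpos_pos)
  then show "\<exists>y. (edge_fun s k has_real_derivative y) (at x) \<and> 0 \<ge> y"
    using edge_fun_deriv[OF sk order_trans[OF b(1) x(1)] le_less_trans[OF x(2) b(3)]]
    unfolding mult.assoc by blast
qed

text \<open>The constant \<open>0.0405\<close> is slightly larger than the maximum over
  \<open>c\<close> of \<open>- (c - 1/3) * (c - crit_cos) / (1 - c^2)\<close>, the steepest descent
  per unit of \<open>s\<close>.\<close>

lemma edge_fun_steepness:
  assumes sk: "0 < s" "0 < k" "s^2 + k^2 = 1" and b: "0 \<le> a" "a \<le> b" "b < pi/2"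
  shows "edge_fun s k b - edge_fun s k a \<ge> - 0.0405 * s * (b - a)"
proof -
  have "(\<lambda>x. edge_fun s k x + 0.0405 * s * x) a \<le> (\<lambda>x. edge_fun s k x + 0.0405 * s * x) b"
  proof (rule DERIV_nonneg_imp_nondecreasing[OF b(2)])
    fix x assume x: "a \<le> x" "x \<le> b"
    define c where "c = k * cos x"
    have P: "1 - c^2 > 0" using edge_deriv_sign[OF sk, of x] x b by (simp add: c_def)
    have "0 \<le> (c - 1/3) * (c - crit_cos) + 0.0405 * (1 - c^2)"
    proof -
      \<comment> \<open>For fixed \<open>c\<close> the expression is affine in the second root, so
        the two ends of the enclosure of \<open>crit_cos\<close> suffice. There the square is
        completed with leading coefficient \<open>1 - 0.0405 = 0.9595\<close>.\<close>
      have e: "(c - 1/3) * (c - r) + 0.0405 * (1 - c^2) \<ge> 0" if "r = 0.675 \<or> r = 0.677" for r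
      proof -
        have "(c - 1/3) * (c - r) + 0.0405 * (1 - c^2)
           = 0.9595 * (c - (1/3 + r) / 1.919)^2 + (r/3 + 0.0405 - (1/3+r)^2 / 3.838)"
          by (simp add: power2_eq_square field_simps)
        moreover have "r/3 + 0.0405 - (1/3+r)^2 / 3.838 \<ge> 0" 
          using that by (elim disjE; hypsubst) (simp_all add: power2_eq_square)
        moreover have "0 \<le> 0.9595 * (c - (1/3 + r) / 1.919)^2" by simp
        ultimately show ?thesis by linarith
      qed
      have "(c - 1/3) * (c - crit_cos) \<ge> min ((c - 1/3) * (c - 0.675)) ((c - 1/3) * (c - 0.677))"
      proof (cases "c \<ge> 1/3")
        case True
        then have "(c - 1/3) * (c - crit_cos) \<ge> (c - 1/3) * (c - 0.677)"
          using crit_cos_bounds by (intro mult_left_mono) auto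
        then show ?thesis by simp
      next
        case False
        then have "(c - 1/3) * (c - crit_cos) \<ge> (c - 1/3) * (c - 0.675)"
          using crit_cos_bounds by (intro mult_left_mono_neg) auto
        then show ?thesis by simp
      qed
      then show ?thesis using e[of "0.675"] e[of "0.677"] by linarith
    qed
    then have "0 \<le> s * ((c - 1/3) * (c - crit_cos) + 0.0405 * (1 - c^2)) / (1 - c^2)"
      using P sk by (intro divide_nonneg_pos mult_nonneg_nonneg) auto
    also have "\<dots> = s * (c - 1/3) * (c - crit_cos) / (1 - c^2) + 0.0405 * s"
      using P by (simp add: field_simps)
    finally have "0 \<le> s * (c - 1/3) * (c - crit_cos) / (1 - c^2) + 0.0405 * s" .
    moreover have "((\<lambda>x. edge_fun s k x + 0.0405 * s * x) has_real_derivative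
        s * (c - 1/3) * (c - crit_cos) / (1 - c^2) + 0.0405 * s) (at x)"
      using edge_fun_deriv[OF sk, of x] x b unfolding c_def
      by (intro derivative_eq_intros) auto
    ultimately show "\<exists>y. ((\<lambda>x. edge_fun s k x + 0.0405 * s * x) has_real_derivative y) (at x) \<and> 0 \<le> y"
      by blast
  qed
  moreover have "- m * s * (b - a) \<le> y - x" if "x + m * s * a \<le> y + m * s * b" for m x y :: real
    using that by (simp add: algebra_simps)
  ultimately show ?thesis by blast
qed

section \<open>The edge function along the curve of its minima\<close>

lemma sec2_arctan_strict_mono:
  fixes x y :: real assumes "0 < x" "x < y"
  shows "(1 + x^2) * arctan x / x < (1 + y^2) * arctan y / y"
proof (rule DERIV_pos_imp_increasing[OF assms(2)])
  fix z assume z: "x \<le> z" "z \<le> y"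
  then have zp: "z > 0" using assms by simp
  have p: "1 + z^2 > 0" by (smt (verit) zero_le_power2)
  have "((\<lambda>x. (1 + x^2) * arctan x / x) has_real_derivative
     (((2 * z) * arctan z + (1 + z^2) * inverse (1 + z^2)) * z - (1 + z^2) * arctan z) / (z * z)) (at z)"
    using zp by (auto intro!: derivative_eq_intros)
  moreover have "(((2 * z) * arctan z + (1 + z^2) * inverse (1 + z^2)) * z - (1 + z^2) * arctan z)
      = z^2 * arctan z + (z - arctan z)"
  proof -
    have "(1 + z^2) * inverse (1 + z^2) = 1" using p by simp
    then show ?thesis by (simp only:) (simp add: algebra_simps power2_eq_square)
  qed
  moreover have "z^2 * arctan z + (z - arctan z) > 0"
    using zp arctan_le_self[of z] by (intro add_pos_nonneg mult_pos_pos) (auto simp: zero_less_arctan_iff)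
  ultimately show "\<exists>w. ((\<lambda>x. (1 + x^2) * arctan x / x) has_real_derivative w) (at z) \<and> 0 < w"
    using zp by (intro exI conjI) (assumption, simp)
qed

text \<open>The values of \<open>edge_fun\<close> along the curve \<open>k * cos b = 1/3\<close> of its minima in \<open>b\<close>,
  parametrised by \<open>u = tan b / s\<close>.\<close>

definition valley_fun :: "real \<Rightarrow> real" where
  "valley_fun u = - (1/3 + crit_cos) * arctan (u / 3) + (1 + crit_cos / 3) * arctan u
     - sqrt 8 / sqrt (9 + u^2) * arctan (sqrt 8 * u / sqrt (9 + u^2))"

text \<open>On the curve \<open>t\<close> equals \<open>tan b\<close>, and
  \<open>(1 + t^2) * arctan t / t\<close> is \<open>2 * b / sin (2 * b)\<close>, an increasing
  quantity. The sign of the derivative is therefore decided by comparing \<open>t\<close> with the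
  single point where this quotient equals \<open>3 * crit_cos\<close>; the definition of
  \<open>crit_cos\<close> places that point at \<open>t = sqrt 2\<close>.\<close>

lemma valley_fun_deriv:
  assumes u: "0 < u"
  defines "t \<equiv> sqrt 8 * u / sqrt (9 + u^2)"
  shows "(valley_fun has_real_derivative
     8 * u^2 / (9 * (9 + u^2) * (1 + u^2)) * ((1 + t^2) * arctan t / t - 3 * crit_cos)) (at u)"
proof -
  let ?D = "9 + u^2"
  have D: "?D > 0" "1 + u^2 > 0" by (smt (verit) zero_le_power2)+
  have s8: "sqrt 8 * sqrt 8 = 8" by simp
  have sD: "sqrt ?D * sqrt ?D = ?D" using D by simp
  have t: "t > 0" using u D by (simp add: t_def)
  have t2: "t^2 = 8 * u^2 / ?D" using D by (simp add: t_def power_divide power_mult_distrib)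
  have t21: "1 + t^2 = 9 * (1 + u^2) / ?D" using D by (simp add: t2 field_simps)
  have dsq: "((\<lambda>u. sqrt (9 + u^2)) has_real_derivative (u / sqrt ?D)) (at u)"
    using D by (auto intro!: derivative_eq_intros simp: field_simps)
  have ds: "((\<lambda>u. sqrt 8 / sqrt (9 + u^2)) has_real_derivative (- sqrt 8 * u / (?D * sqrt ?D))) (at u)"
    using D by (auto intro!: derivative_eq_intros dsq simp: sD field_simps)
  have dt: "((\<lambda>u. sqrt 8 * u / sqrt (9 + u^2)) has_real_derivative (9 * sqrt 8 / (?D * sqrt ?D))) (at u)"
  proof -
    have "((\<lambda>u. sqrt 8 * u / sqrt (9 + u^2)) has_real_derivative
        (sqrt 8 * sqrt ?D - sqrt 8 * u * (u / sqrt ?D)) / (sqrt ?D * sqrt ?D)) (at u)"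
      using D by (intro DERIV_divide DERIV_cmult_Id dsq) auto
    moreover have "sqrt 8 * sqrt ?D - sqrt 8 * u * (u / sqrt ?D) = sqrt 8 * (sqrt ?D * sqrt ?D - u^2) / sqrt ?D"
      using D by (simp add: field_simps power2_eq_square)
    ultimately show ?thesis unfolding sD by (simp add: mult.commute)
  qed
  have da: "((\<lambda>u. arctan (sqrt 8 * u / sqrt (9 + u^2))) has_real_derivative
      (sqrt 8 / (sqrt ?D * (1 + u^2)))) (at u)"
  proof -
    have "((\<lambda>u. arctan (sqrt 8 * u / sqrt (9 + u^2))) has_real_derivative
        (inverse (1 + t^2) * (9 * sqrt 8 / (?D * sqrt ?D)))) (at u)"
      unfolding t_def by (rule DERIV_chain2[OF DERIV_arctan dt])
    moreover have "inverse (9 * e / d) * (9 * x / (d * r)) = x / (r * e)"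
      if "d \<noteq> 0" "e \<noteq> 0" for d e r x :: real using that by simp
    from this[of ?D "1 + u^2" "sqrt 8" "sqrt ?D"]
    have "inverse (1 + t^2) * (9 * sqrt 8 / (?D * sqrt ?D)) = sqrt 8 / (sqrt ?D * (1 + u^2))"
      using D unfolding t21 by (metis less_irrefl)
    ultimately show ?thesis by (simp only:)
  qed
  have d1: "((\<lambda>u. arctan (u / 3)) has_real_derivative (3 / ?D)) (at u)"
  proof -
    have "1 + (u/3)^2 = ?D / 9" by (simp add: power_divide field_simps)
    then show ?thesis by (auto intro!: derivative_eq_intros simp: field_simps)
  qed
  have d2: "(arctan has_real_derivative (1 / (1 + u^2))) (at u)"
    by (auto intro!: derivative_eq_intros simp: field_simps)
  have "(valley_fun has_real_derivative
      - (1/3 + crit_cos) * (3 / ?D) + (1 + crit_cos/3) * (1 / (1 + u^2))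
      - (- sqrt 8 * u / (?D * sqrt ?D) * arctan t + sqrt 8 / (sqrt ?D * (1 + u^2)) * (sqrt 8 / sqrt ?D))) (at u)"
    unfolding valley_fun_def[abs_def] t_def
    by (rule derivative_eq_intros d1 d2 ds da refl | simp)+
  moreover have "sqrt 8 / (sqrt ?D * (1 + u^2)) * (sqrt 8 / sqrt ?D) = 8 / (?D * (1 + u^2))"
  proof -
    have "sqrt 8 / (sqrt ?D * (1 + u^2)) * (sqrt 8 / sqrt ?D) = (sqrt 8 * sqrt 8) / ((sqrt ?D * sqrt ?D) * (1 + u^2))"
      by simp
    then show ?thesis unfolding s8 sD .
  qed
  moreover have "- sqrt 8 * u / (?D * sqrt ?D) = - (8 * u^2 / (?D^2 * t))"
  proof -
    have "- sqrt 8 * u / (?D * sqrt ?D) = - (t / ?D)" by (simp add: t_def)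
    also have "t / ?D = t^2 / (t * ?D)" using t by (simp add: power2_eq_square)
    also have "\<dots> = 8 * u^2 / (?D^2 * t)" unfolding t2 by (simp add: power2_eq_square mult.commute mult.left_commute)
    finally show ?thesis .
  qed
  moreover have "8 * u^2 / (9 * ?D * (1 + u^2)) * ((1 + t^2) * arctan t / t - 3 * crit_cos)
      = 8 * u^2 / (?D^2 * t) * arctan t - 8 * u^2 * crit_cos / (3 * ?D * (1 + u^2))"
  proof -
    have "8 * v / (9 * d * e) * (9 * e / d * a / t - 3 * c) = 8 * v / (d^2 * t) * a - 8 * v * c / (3 * d * e)"
      if "d \<noteq> 0" "e \<noteq> 0" for d e v a c :: real
      using that t by (simp add: field_simps power2_eq_square)
    from this[of ?D "1 + u^2"] show ?thesis unfolding t21 using D by (metis less_irrefl)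
  qed
  moreover have "- (1/3 + crit_cos) * (3 / ?D) + (1 + crit_cos/3) * (1 / (1 + u^2)) - 8 / (?D * (1 + u^2))
     = - (8 * u^2 * crit_cos / (3 * ?D * (1 + u^2)))"
  proof -
    have "- (1/3 + c) * (3 / d) + (1 + c/3) * (1 / e) - 8 / (d * e)
        = - (8 * (d - 9) * c / (3 * d * e))"
      if "d \<noteq> 0" "e \<noteq> 0" "e = d - 8" for d e c :: real
      unfolding that(3) using that(1,2)[unfolded that(3)] by (simp add: divide_simps) (simp add: algebra_simps)
    from this[of ?D "1 + u^2" crit_cos]
    have "- (1/3 + crit_cos) * (3 / ?D) + (1 + crit_cos/3) * (1 / (1 + u^2)) - 8 / (?D * (1 + u^2))
        = - (8 * (?D - 9) * crit_cos / (3 * ?D * (1 + u^2)))"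
      by (rule; use D in linarith)
    then show ?thesis by (simp only: add_diff_cancel_left')
  qed
  ultimately show ?thesis by (simp only:) (erule DERIV_cong, linarith)
qed

text \<open>The regular tetrahedron has \<open>tan b = sqrt 2\<close> and \<open>s^2 = 2/3\<close>,
  hence \<open>u = tan b / s = sqrt 3\<close>.\<close>

lemma valley_fun_sqrt3: "valley_fun (sqrt 3) = edge_min"
proof -
  have a: "sqrt 8 * sqrt 3 / sqrt (9 + (sqrt 3)^2) = sqrt 2"
    by (simp flip: real_sqrt_mult real_sqrt_divide)
  have a6: "arctan (sqrt 3 / 3) = pi/6"
  proof (rule arctan_unique)
    show "tan (pi/6) = sqrt 3 / 3" by (simp add: tan_30 field_simps)
  qed (auto intro: order_less_le_trans[of _ 0])
  have a3: "arctan (sqrt 3) = pi/3"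
    by (rule arctan_unique) (auto simp: tan_60 intro: order_less_le_trans[of _ 0])
  have a8: "sqrt 8 / sqrt (9 + (sqrt 3)^2) = sqrt 2 / sqrt 3"
    using a by (simp add: field_simps)
  have a2: "arctan (sqrt 2) = crit_cos * sqrt 2" by (simp add: crit_cos_def)
  show ?thesis
    unfolding valley_fun_def edge_min_def a a2 a3 a6 a8 by (simp add: field_simps)
qed

text \<open>Since \<open>t\<close> increases with \<open>u\<close>, the derivative is negative
  before \<open>sqrt 3\<close> and positive after it, which makes \<open>sqrt 3\<close> the unique
  minimum.\<close>

lemma valley_fun_ge:
  assumes "0 < u" shows "edge_min \<le> valley_fun u" and "valley_fun u = edge_min \<Longrightarrow> u = sqrt 3"
proof -
  let ?t = "\<lambda>u. sqrt 8 * u / sqrt (9 + u^2)"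
  have t3: "?t (sqrt 3) = sqrt 2"
    by (simp flip: real_sqrt_mult real_sqrt_divide)
  have c: "(1 + (sqrt 2)^2) * arctan (sqrt 2) / sqrt 2 = 3 * crit_cos"
    by (simp add: crit_cos_def)
  have tm: "?t x < ?t y" if "0 < x" "x < y" for x y :: real
  proof -
    have "(?t x)^2 < (?t y)^2"
    proof -
      have pp: "9 + x^2 > 0" "9 + y^2 > 0" by (smt (verit) zero_le_power2)+
      have "x^2 < y^2" using that by (simp add: power_strict_mono)
      then show ?thesis using pp by (simp add: power_divide power_mult_distrib field_simps)
    qed
    then show ?thesis using that by (auto intro: power_less_imp_less_base)
  qed
  have tp: "?t x > 0" if "x > 0" for x using that by (auto intro!: divide_pos_pos add_pos_nonneg)
  have fac: "8 * x^2 / (9 * (9 + x^2) * (1 + x^2)) > 0" if "x > 0" for x :: real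
    using that by (intro divide_pos_pos mult_pos_pos add_pos_nonneg) auto
  have less: "valley_fun (sqrt 3) < valley_fun u" if "u \<noteq> sqrt 3"
  proof (cases "u < sqrt 3")
    case True
    have "- valley_fun u < - valley_fun (sqrt 3)"
    proof (rule DERIV_pos_imp_increasing_open[OF True])
      fix z assume z: "u < z" "z < sqrt 3"
      then have "(1 + (?t z)^2) * arctan (?t z) / ?t z < 3 * crit_cos"
        unfolding c[symmetric] using assms tp tm[of z "sqrt 3"] t3
        by (intro sec2_arctan_strict_mono) auto
      then show "\<exists>w. ((\<lambda>x. - valley_fun x) has_real_derivative w) (at z) \<and> 0 < w"
        using fac[of z] z assms
        by (intro exI[of _ "- (8 * z^2 / (9 * (9 + z^2) * (1 + z^2)) * ((1 + (?t z)^2) * arctan (?t z) / ?t z - 3 * crit_cos))"]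
            conjI DERIV_minus valley_fun_deriv) (auto simp only: neg_0_less_iff_less intro!: mult_pos_neg)
    next
      show "continuous_on {u..sqrt 3} (\<lambda>x. - valley_fun x)"
        using valley_fun_deriv assms
        by (intro continuous_intros DERIV_atLeastAtMost_imp_continuous_on) (meson less_le_trans)
    qed
    then show ?thesis by simp
  next
    case False
    then have lt: "sqrt 3 < u" using that by simp
    show ?thesis
    proof (rule DERIV_pos_imp_increasing_open[OF lt])
      fix z assume z: "sqrt 3 < z" "z < u"
      have z0: "0 < z" using z(1) by (rule less_trans[rotated]) simp
      have "3 * crit_cos < (1 + (?t z)^2) * arctan (?t z) / ?t z"
        unfolding c[symmetric] using assms tm[of "sqrt 3" z] t3 z
        by (intro sec2_arctan_strict_mono) auto
      then show "\<exists>w. (valley_fun has_real_derivative w) (at z) \<and> 0 < w"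
        using fac[of z] z0
        by (intro exI[of _ "8 * z^2 / (9 * (9 + z^2) * (1 + z^2)) * ((1 + (?t z)^2) * arctan (?t z) / ?t z - 3 * crit_cos)"]
            conjI valley_fun_deriv) (auto simp only: diff_gt_0_iff_gt intro!: mult_pos_pos)
    next
      show "continuous_on {sqrt 3..u} valley_fun"
        using valley_fun_deriv assms
        by (intro DERIV_atLeastAtMost_imp_continuous_on)
          (meson less_le_trans real_sqrt_gt_zero zero_less_numeral)
    qed
  qed
  show "edge_min \<le> valley_fun u" using less valley_fun_sqrt3 by (cases "u = sqrt 3") auto
  show "u = sqrt 3" if "valley_fun u = edge_min" using less that valley_fun_sqrt3 by fastforce
qed

lemma edge_fun_valley:
  assumes sk: "0 < s" "0 < k" "s^2 + k^2 = 1" and k: "1/3 < k"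
  defines "b \<equiv> arccos (1 / (3 * k))"
  shows "0 < b" "b < pi/2" "k * cos b = 1/3" "edge_min \<le> edge_fun s k b"
    "edge_fun s k b = edge_min \<Longrightarrow> k^2 = 1/3"
proof -
  have k3: "0 < 1 / (3 * k)" "1 / (3 * k) < 1" using k by (auto simp: field_simps)
  have "arccos 1 < arccos (1 / (3 * k))" "arccos (1 / (3 * k)) < arccos 0"
    by (rule arccos_less_arccos; use k3 in linarith)+
  then show b: "0 < b" "b < pi/2" by (simp_all only: b_def arccos_1 arccos_0)
  have cb: "cos b = 1 / (3 * k)" using k3 unfolding b_def by (intro cos_arccos) linarith+
  then show kb: "k * cos b = 1/3" using k by simp
  define u where "u = tan b / s"
  have tb: "tan b > 0" using b by (simp add: tan_gt_zero)
  then have u: "u > 0" using sk by (simp add: u_def)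
  have t2: "(tan b)^2 = 9 * k^2 - 1"
  proof -
    have "1 + (tan b)^2 = inverse (cos b)^2" using tan_sec[of b] cb k by simp
    then show ?thesis using cb k by (simp add: power_mult_distrib)
  qed
  \<comment> \<open>Elimination of \<open>k\<close> from \<open>tan b = s * u\<close>,
    \<open>(tan b)^2 = 9 * k^2 - 1\<close> and \<open>k^2 = 1 - s^2\<close>. This relation expresses
    the curve through the single parameter \<open>u\<close>.\<close>
  have s8: "s^2 * (9 + u^2) = 8"
    using sk t2 by (simp add: u_def power_divide algebra_simps)
  have p: "9 + u^2 > 0" by (smt (verit) zero_le_power2)
  have s: "s = sqrt 8 / sqrt (9 + u^2)"
  proof -
    have "s^2 = 8 / (9 + u^2)" using s8 p by (simp add: field_simps)
    then show ?thesis using sk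
      by (metis real_sqrt_divide real_sqrt_unique less_imp_le)
  qed
  have su: "sqrt 8 * u / sqrt (9 + u^2) = tan b"
  proof -
    have "sqrt 8 * u / sqrt (9 + u^2) = s * u" using s by (metis times_divide_eq_left)
    then show ?thesis using sk by (simp add: u_def)
  qed
  have at: "arctan (tan b) = b" using b by (intro arctan_tan) auto
  have ks: "k * sin b / s = u / 3"
  proof -
    have "sin b = tan b * cos b" using cb k by (simp add: tan_def)
    then have "k * sin b = tan b / 3" using kb by (simp add: mult_ac)
    then have "k * sin b / s = (tan b / 3) / s" by (rule arg_cong)
    then show ?thesis unfolding u_def by simp
  qed
  have eq: "edge_fun s k b = valley_fun u"
    unfolding edge_fun_def valley_fun_def su at ks s[symmetric] by (simp add: u_def)
  then show "edge_min \<le> edge_fun s k b" using valley_fun_ge(1)[OF u] by simp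
  show "k^2 = 1/3" if "edge_fun s k b = edge_min"
  proof -
    have "u = sqrt 3" using valley_fun_ge(2)[OF u] that eq by simp
    then show ?thesis using s8 sk by simp
  qed
qed

text \<open>As \<open>b\<close> grows, \<open>k * cos b\<close> falls from \<open>k\<close> towards
  \<open>0\<close>, and the function rises until \<open>crit_cos\<close>, falls until
  \<open>1/3\<close> and rises again, where stages above \<open>k\<close> are missing. So its
  competitors for the minimum are the value \<open>0\<close> at \<open>b = 0\<close>, which exceeds
  \<open>edge_min\<close>, and the point of the valley, which exists only for
  \<open>k > 1/3\<close>.\<close>

lemma edge_fun_ge:
  assumes sk: "0 < s" "0 < k" "s^2 + k^2 = 1" and b: "0 \<le> b" "b < pi/2"
  shows "edge_min \<le> edge_fun s k b" "edge_fun s k b = edge_min \<Longrightarrow> k^2 = 1/3"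
proof -
  have "edge_min \<le> edge_fun s k b \<and> (edge_fun s k b = edge_min \<longrightarrow> k^2 = 1/3)"
  proof (cases "k * cos b \<ge> crit_cos \<or> k \<le> 1/3")
    case True
    then have "edge_fun s k 0 \<le> edge_fun s k b"
      using sk b by (intro edge_fun_mono) auto
    then show ?thesis using edge_min_bound by simp
  next
    case False
    then have k: "1/3 < k" by simp
    note v = edge_fun_valley[OF sk k]
    have "edge_fun s k (arccos (1/(3*k))) \<le> edge_fun s k b"
    proof (cases "b \<le> arccos (1/(3*k))")
      case True
      then show ?thesis using False v b sk by (intro edge_fun_antimono) auto
    next
      case False
      then show ?thesis using v b sk by (intro edge_fun_mono) auto
    qed
    then show ?thesis using v by auto
  qed
  then show "edge_min \<le> edge_fun s k b" "edge_fun s k b = edge_min \<Longrightarrow> k^2 = 1/3" by auto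
qed

text \<open>Needed when one of the two distances is negative. For \<open>k \<le> crit_cos\<close>
  there is no initial rise: either the function already increases from \<open>a\<close> on, or its
  value at \<open>a\<close> is at most \<open>0\<close>. For larger \<open>k\<close> the edge is
  short, and the total descent is at most \<open>0.0405 * 0.738 * pi / 2\<close>, which is less than
  \<open>0.048\<close>.\<close>

lemma edge_fun_diff:
  assumes sk: "0 < s" "0 < k" "s^2 + k^2 = 1" and b: "0 \<le> a" "a \<le> b" "b < pi/2"
  shows "2 * edge_min < edge_fun s k b - edge_fun s k a"
proof (cases "k \<le> crit_cos")
  case True
  show ?thesis
  proof (cases "k * cos a \<le> 1/3")
    case True
    then show ?thesis using edge_fun_mono[OF sk b] edge_min_bound by simp
  next
    case False
    then have "edge_fun s k 0 \<ge> edge_fun s k a"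
      using sk b True by (intro edge_fun_antimono) auto
    then show ?thesis using edge_fun_ge[OF sk, of b] b edge_min_bound by simp
  qed
next
  case False
  \<comment> \<open>The bound is \<open>sqrt (1 - 0.675^2)\<close> rounded up, with
    \<open>0.675\<close> the lower bound of \<open>crit_cos\<close>.\<close>
  have "s \<le> 0.738"
  proof (rule power2_le_imp_le)
    have "k^2 \<ge> 0.675^2" using False crit_cos_bounds by (intro power_mono) auto
    then show "s^2 \<le> 0.738^2" using sk by (simp add: power2_eq_square)
  qed simp
  then have sb: "s * (b - a) \<le> 0.738 * (pi/2)" using b sk by (intro mult_mono) auto
  have st: "edge_fun s k b - edge_fun s k a \<ge> - 0.0405 * s * (b - a)"
    by (rule edge_fun_steepness[OF sk b])
  then have "0.0405 * s * (b - a) \<le> 0.0405 * (0.738 * (pi/2))" using sb by simp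
  then show ?thesis using st using edge_min_bound pi_approx by (simp add: field_simps)
qed

text \<open>By symmetry let \<open>b2\<close> be the smaller distance. If it is nonnegative, both
  terms are bounded separately. Otherwise oddness turns the sum into a difference of values at
  nonnegative arguments, where the bound is strict and equality cannot occur.\<close>

lemma edge_inequality:
  assumes sk: "0 < s" "0 < k" "s^2 + k^2 = 1"
    and b: "\<bar>b1\<bar> < pi/2" "\<bar>b2\<bar> < pi/2" "0 \<le> b1 + b2"
  shows "2 * edge_min \<le> edge_fun s k b1 + edge_fun s k b2"
    and "edge_fun s k b1 + edge_fun s k b2 = 2 * edge_min \<Longrightarrow> k^2 = 1/3"
proof -
  have *: "2 * edge_min \<le> edge_fun s k b1 + edge_fun s k b2 \<and>
    (edge_fun s k b1 + edge_fun s k b2 = 2 * edge_min \<longrightarrow> k^2 = 1/3)"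
    if b: "\<bar>b1\<bar> < pi/2" "\<bar>b2\<bar> < pi/2" "0 \<le> b1 + b2" and le: "b2 \<le> b1" for b1 b2
  proof (cases "0 \<le> b2")
    case True
    then show ?thesis using edge_fun_ge[OF sk, of b1] edge_fun_ge[OF sk, of b2] b le by auto
  next
    case False
    then show ?thesis using edge_fun_diff[OF sk, of "- b2" b1] b by auto
  qed
  show "2 * edge_min \<le> edge_fun s k b1 + edge_fun s k b2"
    using *[of b1 b2] *[of b2 b1] b by linarith
  show "edge_fun s k b1 + edge_fun s k b2 = 2 * edge_min \<Longrightarrow> k^2 = 1/3"
    using *[of b1 b2] *[of b2 b1] b by linarith
qed

section \<open>Angle sums of an inscribed simplex\<close>

text \<open>Polar form of the complex product \<open>(1 + i x) (1 + i y)\<close>, whose argument is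
  the sum of the arctangents.\<close>

lemma arctan_add_polar:
  fixes x y :: real assumes "0 < x + y"
  defines "t \<equiv> arctan x + arctan y"
  shows "0 < t" "t < pi"
    and "\<exists>c>0. 1 - x * y = c * cos t \<and> x + y = c * sin t"
proof -
  have "arctan (- y) < arctan x" using assms by (simp only: arctan_less_iff)
  then show "0 < t" by (simp add: t_def arctan_minus)
  show "t < pi" unfolding t_def using arctan_ubound[of x] arctan_ubound[of y] by linarith
  let ?c = "sqrt (1 + x^2) * sqrt (1 + y^2)"
  have c: "sqrt (1 + x^2) > 0" "sqrt (1 + y^2) > 0" by (auto intro: add_pos_nonneg)
  have "?c * cos t = 1 - x * y" "?c * sin t = x + y"
    using c unfolding t_def cos_add sin_add cos_arctan sin_arctan
    by (simp_all add: field_simps)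
  then show "\<exists>c>0. 1 - x * y = c * cos t \<and> x + y = c * sin t"
    using c by (intro exI[of _ ?c]) (auto simp del: real_sqrt_gt_0_iff)
qed

lemma sum_arctan_eq_pi_half:
  fixes x y z :: real assumes "x * y + y * z + z * x = 1" "0 < x + y"
  shows "arctan x + arctan y + arctan z = pi / 2"
proof -
  define t where "t = arctan x + arctan y"
  note p = arctan_add_polar[OF assms(2), folded t_def]
  obtain c where c: "c > 0" "1 - x * y = c * cos t" "x + y = c * sin t" using p(3) by auto
  have "z = (1 - x * y) / (x + y)" using assms by (simp add: field_simps)
  also have "\<dots> = cos t / sin t" using c by simp
  also have "\<dots> = tan (pi/2 - t)" by (simp add: tan_def sin_diff cos_diff)
  finally have "arctan z = pi/2 - t" using p by (simp add: arctan_tan)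
  then show ?thesis by (simp add: t_def)
qed

text \<open>In complex notation the last two hypotheses say that
  \<open>u e^(ia) * v e^(ib) = k w e^(-ic)\<close>. So \<open>a + b + c\<close> is a multiple of
  \<open>2 * pi\<close>, and it lies strictly between \<open>0\<close> and
  \<open>3 * pi\<close>.\<close>

lemma sum_angles_eq_2pi:
  fixes a b c :: real
  assumes a: "0 < a" "a < pi" and b: "0 < b" "b < pi" and c: "0 < c" "c < pi"
    and pos: "0 < u" "0 < v" "0 < w" "0 < k"
    and re: "(u * cos a) * (v * cos b) - (u * sin a) * (v * sin b) = k * (w * cos c)"
    and im: "(u * cos a) * (v * sin b) + (u * sin a) * (v * cos b) = - k * (w * sin c)"
  shows "a + b + c = 2 * pi"
proof -
  have re': "cos (a + b) = k * w / (u * v) * cos c" using re pos by (simp add: cos_add field_simps)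
  have im': "sin (a + b) = - (k * w / (u * v)) * sin c" using im pos by (simp add: sin_add field_simps)
  have "cos (a + b + c) = k * w / (u * v) * ((cos c)^2 + (sin c)^2)"
    unfolding cos_add[of "a + b"] re' im' by (simp only: power2_eq_square algebra_simps)
  then have C: "cos (a + b + c) > 0" using pos by simp
  have S: "sin (a + b + c) = 0" unfolding sin_add[of "a + b"] re' im' by simp
  define d where "d = a + b + c - 2 * pi"
  have d: "sin d = 0" "cos d > 0" using C S by (simp_all add: d_def sin_diff cos_diff)
  have "d = 0"
  proof (rule ccontr)
    assume "d \<noteq> 0"
    consider "- 2 * pi < d" "d < - pi" | "d = - pi" | "- pi < d" "d < 0" | "0 < d" "d < pi"
      using a b c \<open>d \<noteq> 0\<close> unfolding d_def by linarith
    then show False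
    proof cases
      case 1
      then have "sin (d + 2 * pi) > 0" by (intro sin_gt_zero) auto
      then show ?thesis using d by simp
    next
      case 2 then show ?thesis using d by simp
    next
      case 3
      then have "sin (- d) > 0" by (intro sin_gt_zero) auto
      then show ?thesis using d by simp
    next
      case 4
      then have "sin d > 0" by (intro sin_gt_zero) auto
      then show ?thesis using d by simp
    qed
  qed
  then show ?thesis by (simp add: d_def)
qed

section \<open>Spherical and Euclidean angles of a face\<close>

abbreviation vol3 :: "real^3 \<Rightarrow> real^3 \<Rightarrow> real^3 \<Rightarrow> real" where
  "vol3 p q r \<equiv> p \<bullet> cross3 q r"

definition apex_inner :: "real^3 \<Rightarrow> real^3 \<Rightarrow> real^3 \<Rightarrow> real" where
  "apex_inner p q r = (p - r) \<bullet> (q - r)"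

lemma vol3_rotate: "vol3 q r p = vol3 p q r"
  by (simp add: cross3_simps)

lemma vol3_swap: "vol3 q p r = - vol3 p q r"
  by (simp add: cross3_simps)

lemma apex_inner_unit:
  assumes "norm r = 1"
  shows "apex_inner p q r = 1 + p \<bullet> q - p \<bullet> r - q \<bullet> r"
proof -
  have "r \<bullet> r = 1" using assms by (simp add: dot_square_norm)
  then show ?thesis by (simp add: apex_inner_def inner_diff_left inner_diff_right inner_commute)
qed

lemma cross3_inner_cross3: "cross3 a b \<bullet> cross3 c d = (a \<bullet> c) * (b \<bullet> d) - (a \<bullet> d) * (b \<bullet> c)"
  by (simp add: cross3_simps)

lemma vol3_square_unit:
  assumes "norm p = 1" "norm q = 1" "norm r = 1"
  shows "(vol3 p q r)^2 = 1 + 2 * (p \<bullet> q) * (p \<bullet> r) * (q \<bullet> r) - (p \<bullet> q)^2 - (p \<bullet> r)^2 - (q \<bullet> r)^2"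
proof -
  have u: "p \<bullet> p = 1" "q \<bullet> q = 1" "r \<bullet> r = 1" using assms by (simp_all add: dot_square_norm)
  have "(vol3 p q r)^2 = (p \<bullet> p) * (q \<bullet> q) * (r \<bullet> r) + 2 * (p \<bullet> q) * (p \<bullet> r) * (q \<bullet> r)
     - (r \<bullet> r) * (p \<bullet> q)^2 - (q \<bullet> q) * (p \<bullet> r)^2 - (p \<bullet> p) * (q \<bullet> r)^2"
    unfolding power2_eq_square by (simp add: cross3_simps)
  then show ?thesis by (simp add: u)
qed

lemma cross3_unit_planar:
  assumes "norm p = 1"
  shows "cross3 p q \<bullet> cross3 p r = q \<bullet> r - (p \<bullet> q) * (p \<bullet> r)"
  using assms by (simp add: cross3_inner_cross3 dot_square_norm inner_commute)

lemma inner_unit_lt_1: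
  assumes "norm p = 1" "norm q = 1" "p \<noteq> q" shows "p \<bullet> q < (1::real)"
proof -
  have "(p - q) \<bullet> (p - q) > 0" using assms(3) by simp
  moreover have "p \<bullet> p = 1" "q \<bullet> q = 1" using assms by (simp_all add: dot_square_norm)
  ultimately show ?thesis by (simp add: inner_diff_left inner_diff_right inner_commute)
qed

lemma vol3_distinct:
  assumes "vol3 p q r \<noteq> 0" shows "p \<noteq> q" "q \<noteq> r" "p \<noteq> r"
  using assms by (auto simp: dot_cross_self)

text \<open>On the unit sphere this is half the chord, which is the sine of half the arc.\<close>

definition half_len :: "real^3 \<Rightarrow> real^3 \<Rightarrow> real" where
  "half_len p q = sqrt ((1 - p \<bullet> q) / 2)"

text \<open>For an oriented face with vertices \<open>p, q, r\<close> on the unit sphere, \<open>psi_angle p q r\<close>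
  is the (signed) spherical angle at \<open>p\<close> between the edge to \<open>q\<close> and the arc to the spherical
  circumcentre, and \<open>half_arc p q r\<close> is the (signed) spherical distance of this
  circumcentre to the midpoint of the edge.\<close>

definition psi_angle :: "real^3 \<Rightarrow> real^3 \<Rightarrow> real^3 \<Rightarrow> real" where
  "psi_angle p q r = arctan (apex_inner p q r / vol3 p q r)"

definition half_arc :: "real^3 \<Rightarrow> real^3 \<Rightarrow> real^3 \<Rightarrow> real" where
  "half_arc p q r = arctan (half_len p q * apex_inner p q r / vol3 p q r)"

text \<open>Twice the area of the Euclidean triangle, so
  \<open>apex_inner p q r / face_area2 p q r\<close> is the cotangent of its angle at
  \<open>r\<close>.\<close>

definition face_area2 :: "real^3 \<Rightarrow> real^3 \<Rightarrow> real^3 \<Rightarrow> real" where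
  "face_area2 p q r = norm (cross3 (p - r) (q - r))"

lemma face_area2_rotate: "face_area2 q r p = face_area2 p q r"
proof -
  have "cross3 (q - p) (r - p) = cross3 (p - r) (q - r)" by (simp add: cross3_simps)
  then show ?thesis by (simp add: face_area2_def)
qed

text \<open>The vertices \<open>r\<close>, \<open>p\<close> and the circumcentre form an isosceles
  triangle, so \<open>psi_angle r p q\<close> is also the angle at \<open>p\<close> between the
  circumcentre and \<open>r\<close>. Hence \<open>t\<close> is the spherical angle of the face at
  \<open>p\<close>. The vectors \<open>cross3 p q\<close> and \<open>cross3 p r\<close> are the
  tangent directions of the two sides after a quarter turn about \<open>p\<close>.\<close>

lemma vertex_angle_polar:
  assumes "norm p = 1" "norm q = 1" "norm r = 1" and d: "vol3 p q r > 0"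
  defines "t \<equiv> psi_angle p q r + psi_angle r p q"
  shows "0 < t" "t < pi"
    "\<exists>c>0. cross3 p q \<bullet> cross3 p r = c * cos t \<and> vol3 p q r = c * sin t"
proof -
  let ?d = "vol3 p q r" and ?x = "apex_inner p q r" and ?y = "apex_inner r p q"
  have xy: "?x + ?y = 2 - 2 * (q \<bullet> r)"
    using assms by (simp add: apex_inner_unit inner_commute)
  have "q \<bullet> r < 1" using vol3_distinct[of p q r] d assms by (intro inner_unit_lt_1) auto
  then have m: "2 - 2 * (q \<bullet> r) > 0" by simp
  have t: "t = arctan (?x / ?d) + arctan (?y / ?d)"
    by (simp add: t_def psi_angle_def vol3_rotate)
  have "?x / ?d + ?y / ?d > 0"
    using m d by (simp add: xy flip: add_divide_distrib)
  note P = arctan_add_polar[OF this, folded t]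
  then show "0 < t" "t < pi" by auto
  obtain c where c: "c > 0" "1 - ?x / ?d * (?y / ?d) = c * cos t" "?x / ?d + ?y / ?d = c * sin t"
    using P by auto
  have "?d^2 * (1 - ?x / ?d * (?y / ?d)) = ?d^2 - ?x * ?y"
    using d by (simp add: field_simps power2_eq_square)
  also have "\<dots> = (2 - 2 * (q \<bullet> r)) * (q \<bullet> r - (p \<bullet> q) * (p \<bullet> r))"
    unfolding vol3_square_unit[OF assms(1-3)] apex_inner_unit[OF assms(3)] apex_inner_unit[OF assms(2)]
    by (simp add: inner_commute power2_eq_square algebra_simps)
  finally have re: "(2 - 2 * (q \<bullet> r)) * (cross3 p q \<bullet> cross3 p r) = ?d^2 * (c * cos t)"
    unfolding cross3_unit_planar[OF assms(1)] c by simp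
  have "?d^2 * (?x / ?d + ?y / ?d) = ?d * (2 - 2 * (q \<bullet> r))"
  proof -
    have "?d^2 * (?x / ?d + ?y / ?d) = ?d * (?x + ?y)"
      using d by (simp add: field_simps power2_eq_square)
    then show ?thesis unfolding xy .
  qed
  then have im: "(2 - 2 * (q \<bullet> r)) * ?d = ?d^2 * (c * sin t)"
    unfolding c by simp
  show "\<exists>c>0. cross3 p q \<bullet> cross3 p r = c * cos t \<and> vol3 p q r = c * sin t"
    using re im m c(1) d by (intro exI[of _ "?d^2 * c / (2 - 2 * (q \<bullet> r))"]) (simp add: field_simps)
qed

text \<open>Regard the plane orthogonal to \<open>p\<close> as the complex plane. For the tangent
  vectors \<open>a\<close>, \<open>b\<close>, \<open>c\<close> towards the three neighbours,
  \<open>conj a * b\<close> times \<open>conj b * c\<close> is \<open>|b|^2\<close> times the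
  conjugate of \<open>conj c * a\<close>. Its real and imaginary parts are the identities
  \<open>re\<close> and \<open>im\<close>, and they are what \<open>sum_angles_eq_2pi\<close>
  requires.\<close>

lemma vertex_angle_sum:
  assumes "norm p = 1" "norm q = 1" "norm r = 1" "norm l = 1"
    and d: "vol3 p q r > 0" "vol3 p r l > 0" "vol3 p l q > 0"
  shows "psi_angle p q r + psi_angle r p q + (psi_angle p r l + psi_angle l p r)
     + (psi_angle p l q + psi_angle q p l) = 2 * pi"
proof -
  define a b c where "a = cross3 p q" "b = cross3 p r" "c = cross3 p l"
  have pp: "p \<bullet> p = 1" using assms by (simp add: dot_square_norm)
  have key: "cross3 (cross3 p u) (cross3 p v) = vol3 p u v *\<^sub>R p" for u v
    by (simp add: cross3_simps forall_3)
  note A = vertex_angle_polar[OF assms(1,2,3) d(1)]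
  note B = vertex_angle_polar[OF assms(1,3,4) d(2)]
  note C = vertex_angle_polar[OF assms(1,4,2) d(3)]
  obtain u where u: "u > 0" "a \<bullet> b = u * cos (psi_angle p q r + psi_angle r p q)"
     "vol3 p q r = u * sin (psi_angle p q r + psi_angle r p q)" using A(3) by (auto simp: a_b_c_def)
  obtain v where v: "v > 0" "b \<bullet> c = v * cos (psi_angle p r l + psi_angle l p r)"
     "vol3 p r l = v * sin (psi_angle p r l + psi_angle l p r)" using B(3) by (auto simp: a_b_c_def)
  obtain w where w: "w > 0" "c \<bullet> a = w * cos (psi_angle p l q + psi_angle q p l)"
     "vol3 p l q = w * sin (psi_angle p l q + psi_angle q p l)" using C(3) by (auto simp: a_b_c_def)
  have b0: "b \<bullet> b > 0"
  proof -
    have "b \<noteq> 0" using d(1) key[of q r] by (auto simp: a_b_c_def)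
    then show ?thesis by simp
  qed
  have "(a \<bullet> b) * (b \<bullet> c) - vol3 p q r * vol3 p r l = (a \<bullet> b) * (b \<bullet> c) - cross3 a b \<bullet> cross3 b c"
    by (simp add: a_b_c_def key pp)
  also have "\<dots> = (b \<bullet> b) * (c \<bullet> a)"
    by (simp add: cross3_inner_cross3 inner_commute)
  finally have re: "(a \<bullet> b) * (b \<bullet> c) - vol3 p q r * vol3 p r l = (b \<bullet> b) * (c \<bullet> a)" .
  have "(a \<bullet> b) * vol3 p r l + vol3 p q r * (b \<bullet> c)
     = p \<bullet> ((a \<bullet> b) *\<^sub>R cross3 b c + (b \<bullet> c) *\<^sub>R cross3 a b)"
    by (simp add: a_b_c_def key pp inner_add_right)
  also have "(a \<bullet> b) *\<^sub>R cross3 b c + (b \<bullet> c) *\<^sub>R cross3 a b = vol3 a b c *\<^sub>R b - (b \<bullet> b) *\<^sub>R cross3 c a"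
    by (simp add: cross3_simps forall_3)
  also have "p \<bullet> \<dots> = - (b \<bullet> b) * vol3 p l q"
    by (simp add: a_b_c_def key pp inner_diff_right dot_cross_self)
  finally have im: "(a \<bullet> b) * vol3 p r l + vol3 p q r * (b \<bullet> c) = - (b \<bullet> b) * vol3 p l q" .
  show ?thesis
    by (rule sum_angles_eq_2pi[OF A(1,2) B(1,2) C(1,2) u(1) v(1) w(1) b0])
       (use re im in \<open>simp_all only: u v w\<close>)
qed

text \<open>Each arctangent is \<open>pi/2\<close> minus an angle of the Euclidean triangle
  \<open>p q r\<close>. By the inscribed angle theorem these angles are also half the angles
  subtended by the sides at the circumcentre, which is why they belong to the right spherical
  triangles.\<close>

lemma face_angle_sum:
  assumes "norm p = 1" "norm q = 1" "norm r = 1" and d: "vol3 p q r > 0"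
  shows "arctan (apex_inner p q r / face_area2 p q r) + arctan (apex_inner q r p / face_area2 q r p)
     + arctan (apex_inner r p q / face_area2 r p q) = pi / 2" "face_area2 p q r > 0"
proof -
  let ?S = "face_area2 p q r"
  have S2: "?S^2 = apex_inner p q r * apex_inner q r p + apex_inner q r p * apex_inner r p q
     + apex_inner r p q * apex_inner p q r"
    unfolding face_area2_def dot_square_norm[symmetric] apex_inner_def by (simp add: cross3_simps)
  have "cross3 (p - r) (q - r) \<noteq> 0"
  proof
    assume "cross3 (p - r) (q - r) = 0"
    then have "p \<bullet> cross3 (p - r) (q - r) = 0" by simp
    moreover have "p \<bullet> cross3 (p - r) (q - r) = vol3 p q r" by (simp add: cross3_simps)
    ultimately show False using d by simp
  qed
  then show S: "?S > 0" by (simp add: face_area2_def)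
  have "apex_inner p q r + apex_inner q r p = 2 - 2 * (p \<bullet> r)"
    using assms by (simp add: apex_inner_unit inner_commute)
  moreover have "p \<bullet> r < 1" using vol3_distinct[of p q r] d assms by (intro inner_unit_lt_1) auto
  ultimately have "0 < apex_inner p q r / ?S + apex_inner q r p / ?S"
    using S by (simp flip: add_divide_distrib)
  moreover have "apex_inner p q r / ?S * (apex_inner q r p / ?S) + apex_inner q r p / ?S * (apex_inner r p q / ?S)
     + apex_inner r p q / ?S * (apex_inner p q r / ?S) = 1"
  proof -
    have "apex_inner p q r / s * (apex_inner q r p / s) + apex_inner q r p / s * (apex_inner r p q / s)
        + apex_inner r p q / s * (apex_inner p q r / s) = (apex_inner p q r * apex_inner q r p
        + apex_inner q r p * apex_inner r p q + apex_inner r p q * apex_inner p q r) / s^2" for s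
      by (simp add: add_divide_distrib power2_eq_square)
    then show ?thesis unfolding S2[symmetric] using S by simp
  qed
  ultimately show "arctan (apex_inner p q r / face_area2 p q r) + arctan (apex_inner q r p / face_area2 q r p)
     + arctan (apex_inner r p q / face_area2 r p q) = pi / 2"
    unfolding face_area2_rotate[of q r p] face_area2_rotate[of p q r]
    by (intro sum_arctan_eq_pi_half)
qed

definition arc_term :: "real^3 \<Rightarrow> real^3 \<Rightarrow> real^3 \<Rightarrow> real" where
  "arc_term p q r = half_len p q * half_arc p q r"

lemma half_arc_bound: "\<bar>half_arc p q r\<bar> < pi / 2"
  unfolding half_arc_def using arctan_bounded[of "half_len p q * apex_inner p q r / vol3 p q r"] by auto

text \<open>Napier's rules for the right triangle with legs \<open>arcsin s\<close> and
  \<open>b\<close>: the angle at \<open>p\<close> has tangent \<open>tan b / s\<close>, and the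
  complement of the angle at the circumcentre has tangent \<open>k * sin b / s\<close>.\<close>

lemma edge_fun_half_arc:
  assumes u: "norm p = 1" "norm q = 1" "norm r = 1" and d: "vol3 p q r > 0"
  shows "edge_fun (half_len p q) (sqrt ((1 + p \<bullet> q) / 2)) (half_arc p q r)
    = - (1/3 + crit_cos) * arctan (apex_inner p q r / face_area2 p q r)
      + (1 + crit_cos / 3) * psi_angle p q r - arc_term p q r"
    and "0 < half_len p q" "0 < sqrt ((1 + p \<bullet> q) / 2)"
    and "(half_len p q)^2 + (sqrt ((1 + p \<bullet> q) / 2))^2 = 1"
proof -
  let ?n = "apex_inner p q r" and ?d = "vol3 p q r" and ?S = "face_area2 p q r"
  define s where "s = half_len p q"
  define k where "k = sqrt ((1 + p \<bullet> q) / 2)"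
  have lt: "p \<bullet> q < 1" using vol3_distinct[of p q r] d u by (intro inner_unit_lt_1) auto
  have "p \<noteq> - q" using d by (auto simp: dot_cross_self)
  then have "p \<bullet> (- q) < 1" using u by (intro inner_unit_lt_1) auto
  then have gt: "- 1 < p \<bullet> q" by simp
  show s: "0 < half_len p q" and k: "0 < sqrt ((1 + p \<bullet> q) / 2)"
    using lt gt by (auto simp: half_len_def)
  show "(half_len p q)^2 + (sqrt ((1 + p \<bullet> q) / 2))^2 = 1"
    using lt gt by (simp add: half_len_def field_simps)
  have s2: "s^2 = (1 - p \<bullet> q) / 2" "k^2 = (1 + p \<bullet> q) / 2"
    using lt gt by (auto simp: s_def k_def half_len_def)
  have S: "?S > 0" by (rule face_angle_sum(2)[OF u d])
  have S2: "?S^2 = (2 - 2 * (p \<bullet> r)) * (2 - 2 * (q \<bullet> r)) - ?n^2"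
  proof -
    have "?S^2 = ((p - r) \<bullet> (p - r)) * ((q - r) \<bullet> (q - r)) - ?n^2"
      unfolding face_area2_def dot_square_norm[symmetric] cross3_inner_cross3 apex_inner_def
      by (simp add: inner_commute power2_eq_square)
    moreover have "p \<bullet> p = 1" "q \<bullet> q = 1" "r \<bullet> r = 1" using u by (simp_all add: dot_square_norm)
    ultimately show ?thesis by (simp add: inner_diff_left inner_diff_right inner_commute)
  qed
  \<comment> \<open>With \<open>tan b = s * ?n / ?d\<close> this identifies \<open>k * ?S\<close> as
    the hypotenuse, which gives \<open>sin b\<close> in terms of the Euclidean area.\<close>
  have key: "(k * ?S)^2 = ?d^2 + (s * ?n)^2"
    unfolding power_mult_distrib S2 s2 vol3_square_unit[OF u] apex_inner_unit[OF u(3)]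
    by (simp add: power2_eq_square field_simps)
  define b where "b = half_arc p q r"
  have tb: "tan b = s * ?n / ?d" by (simp add: b_def half_arc_def s_def tan_arctan)
  have t1: "tan b / s = ?n / ?d" using s by (simp add: tb s_def)
  have "sin b = s * ?n / ?d / sqrt (1 + (s * ?n / ?d)^2)"
    by (simp add: b_def half_arc_def s_def sin_arctan)
  also have "1 + (s * ?n / ?d)^2 = (k * ?S / ?d)^2"
    unfolding power_divide key using d by (simp add: field_simps)
  also have "sqrt \<dots> = k * ?S / ?d" using k S d by (simp add: k_def)
  finally have sb: "sin b = s * ?n / (k * ?S)" using d by simp
  have t2: "k * sin b / s = ?n / ?S"
    unfolding sb using k s by (simp add: k_def s_def)
  show "edge_fun (half_len p q) (sqrt ((1 + p \<bullet> q) / 2)) (half_arc p q r)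
    = - (1/3 + crit_cos) * arctan (?n / ?S) + (1 + crit_cos / 3) * psi_angle p q r - arc_term p q r"
    unfolding s_def[symmetric] k_def[symmetric] b_def[symmetric] edge_fun_def t1 t2
    by (simp add: psi_angle_def arc_term_def s_def b_def)
qed

text \<open>The sum is the exterior dihedral angle at the edge \<open>p q\<close>. Pairing the
  dependency with \<open>cross3 p q\<close> compares the two volumes, pairing it with
  \<open>p + q\<close> compares the two numerators; together they show that the tangents have a
  positive sum.\<close>

lemma half_arc_add_pos:
  assumes u: "norm p = 1" "norm q = 1" "norm r = 1" "norm l = 1"
    and d: "vol3 p q r > 0" "vol3 q p l > 0"
    and c: "0 < a" "0 < b" "0 < c" "0 < e" "a *\<^sub>R p + b *\<^sub>R q + c *\<^sub>R r + e *\<^sub>R l = 0"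
  shows "0 < half_arc p q r + half_arc q p l"
proof -
  note s = edge_fun_half_arc(2,3)[OF u(1-3) d(1)]
  have gt: "0 < 1 + p \<bullet> q" using s by simp
  have "vol3 p q (a *\<^sub>R p + b *\<^sub>R q + c *\<^sub>R r + e *\<^sub>R l) = 0"
    unfolding c(5) by simp
  then have dep: "c * vol3 p q r = e * vol3 q p l"
    by (simp add: cross3_simps)
  have "(p + q) \<bullet> (a *\<^sub>R p + b *\<^sub>R q + c *\<^sub>R r + e *\<^sub>R l) = 0" unfolding c(5) by simp
  moreover have "p \<bullet> p = 1" "q \<bullet> q = 1" using u by (simp_all add: dot_square_norm)
  ultimately have rel: "(a + b) * (1 + p \<bullet> q) + c * (p \<bullet> r + q \<bullet> r) + e * (p \<bullet> l + q \<bullet> l) = 0"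
    by (simp add: inner_add_left inner_add_right inner_commute algebra_simps)
  have "c * apex_inner p q r + e * apex_inner q p l = (a + b + c + e) * (1 + p \<bullet> q)"
    using rel u by (simp add: apex_inner_unit inner_commute algebra_simps)
  also have "\<dots> > 0" using gt c by simp
  finally have "c * apex_inner p q r > - (e * apex_inner q p l)" by simp
  then have "c * apex_inner p q r / (c * vol3 p q r) > - (e * apex_inner q p l) / (e * vol3 q p l)"
    unfolding dep using c d by (intro divide_strict_right_mono) auto
  then have "apex_inner p q r / vol3 p q r > - (apex_inner q p l / vol3 q p l)"
    using c by simp
  then have "half_len p q * (apex_inner p q r / vol3 p q r) > half_len p q * (- (apex_inner q p l / vol3 q p l))"
    using s(1) by (rule mult_strict_left_mono)
  then have "half_len p q * apex_inner p q r / vol3 p q r > - (half_len q p * apex_inner q p l / vol3 q p l)"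
    by (simp add: half_len_def inner_commute)
  then have "half_arc p q r > - half_arc q p l"
    unfolding half_arc_def by (simp only: arctan_minus[symmetric] arctan_less_iff)
  then show ?thesis by simp
qed

section \<open>Summation of the edge inequality over the six edges\<close>

definition face_angle :: "real^3 \<Rightarrow> real^3 \<Rightarrow> real^3 \<Rightarrow> real" where
  "face_angle p q r = arctan (apex_inner p q r / face_area2 p q r)"

definition edge_val :: "real^3 \<Rightarrow> real^3 \<Rightarrow> real^3 \<Rightarrow> real^3 \<Rightarrow> real" where
  "edge_val p q r l = - (1/3 + crit_cos) * (face_angle p q r + face_angle q p l)
      + (1 + crit_cos / 3) * (psi_angle p q r + psi_angle q p l) - (arc_term p q r + arc_term q p l)"

lemma edge_pair:
  assumes u: "norm p = 1" "norm q = 1" "norm r = 1" "norm l = 1"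
    and d: "vol3 p q r > 0" "vol3 q p l > 0"
    and c: "0 < a" "0 < b" "0 < c" "0 < e" "a *\<^sub>R p + b *\<^sub>R q + c *\<^sub>R r + e *\<^sub>R l = 0"
  shows "2 * edge_min \<le> edge_val p q r l" "edge_val p q r l = 2 * edge_min \<Longrightarrow> p \<bullet> q = - 1 / 3"
proof -
  note e1 = edge_fun_half_arc[OF u(1-3) d(1)]
  note e2 = edge_fun_half_arc(1)[OF u(2,1,4) d(2)]
  have X: "edge_val p q r l = edge_fun (half_len p q) (sqrt ((1 + p \<bullet> q) / 2)) (half_arc p q r)
     + edge_fun (half_len p q) (sqrt ((1 + p \<bullet> q) / 2)) (half_arc q p l)"
    using e1(1) e2 by (simp add: edge_val_def face_angle_def half_len_def inner_commute algebra_simps)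
  have pos: "0 \<le> half_arc p q r + half_arc q p l"
    using half_arc_add_pos[OF u d c] by simp
  note I = edge_inequality[OF e1(2-4) half_arc_bound half_arc_bound pos]
  show "2 * edge_min \<le> edge_val p q r l" unfolding X by (rule I(1))
  assume "edge_val p q r l = 2 * edge_min"
  then have "(sqrt ((1 + p \<bullet> q) / 2))^2 = 1/3" unfolding X by (rule I(2))
  moreover have "0 \<le> (1 + p \<bullet> q) / 2" using e1(3) by simp
  ultimately show "p \<bullet> q = - 1 / 3" by simp
qed

definition arc_sum :: "real^3 \<Rightarrow> real^3 \<Rightarrow> real^3 \<Rightarrow> real^3 \<Rightarrow> real" where
  "arc_sum p q r l = arc_term p q r + arc_term q r p + arc_term r p q
     + arc_term q p l + arc_term p l q + arc_term l q p
     + arc_term r q l + arc_term q l r + arc_term l r q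
     + arc_term p r l + arc_term r l p + arc_term l p r"

text \<open>Twelve equal terms \<open>sqrt (2/3) * arctan (sqrt 2)\<close>.\<close>

definition arc_max :: real where "arc_max = 4 * sqrt 6 * arctan (sqrt 2)"

lemma vol3_dependent:
  assumes c: "0 < a" "0 < b" "0 < c" "0 < e" "a *\<^sub>R p + b *\<^sub>R q + c *\<^sub>R r + e *\<^sub>R l = 0"
    and d: "vol3 p q r > 0"
  shows "vol3 q p l > 0" "vol3 r q l > 0" "vol3 p r l > 0"
proof -
  have "e *\<^sub>R l = - (a *\<^sub>R p + b *\<^sub>R q + c *\<^sub>R r)"
    using c(5) by (metis add.commute eq_neg_iff_add_eq_0)
  then have l: "l = - ((a / e) *\<^sub>R p + (b / e) *\<^sub>R q + (c / e) *\<^sub>R r)"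
    using c(4) by (metis (no_types, lifting) divide_inverse_commute scaleR_add_right scaleR_minus_right
      scaleR_one scaleR_scaleR left_inverse less_irrefl)
  have "vol3 q p l = c / e * vol3 p q r" "vol3 r q l = a / e * vol3 p q r" "vol3 p r l = b / e * vol3 p q r"
    unfolding l by (simp_all add: cross3_simps)
  then show "vol3 q p l > 0" "vol3 r q l > 0" "vol3 p r l > 0" using c d by auto
qed

text \<open>In the sum of the six edge values all angles add up to constants, so what varies is
  \<open>- arc_sum\<close> alone. A lower bound for each edge thus becomes an upper bound for
  \<open>arc_sum\<close>, and equality forces equality at every edge.\<close>

lemma arc_sum_le:
  assumes u: "norm p = 1" "norm q = 1" "norm r = 1" "norm l = 1"
    and c: "0 < a" "0 < b" "0 < c" "0 < e" "a *\<^sub>R p + b *\<^sub>R q + c *\<^sub>R r + e *\<^sub>R l = 0"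
    and d: "vol3 p q r > 0"
  shows "arc_sum p q r l \<le> arc_max"
    and "arc_sum p q r l = arc_max \<Longrightarrow> p \<bullet> q = -1/3 \<and> p \<bullet> r = -1/3 \<and> p \<bullet> l = -1/3 \<and> q \<bullet> r = -1/3 \<and> q \<bullet> l = -1/3 \<and> r \<bullet> l = -1/3"
proof -
  note d' = vol3_dependent[OF c d]
  have rot: "vol3 q r p > 0" "vol3 r p q > 0" "vol3 p l q > 0" "vol3 l q p > 0" "vol3 q l r > 0"
    "vol3 l r q > 0" "vol3 r l p > 0" "vol3 l p r > 0"
    using d d' by (metis vol3_rotate)+
  have cs: "b *\<^sub>R q + c *\<^sub>R r + a *\<^sub>R p + e *\<^sub>R l = 0" "c *\<^sub>R r + a *\<^sub>R p + b *\<^sub>R q + e *\<^sub>R l = 0"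
    "a *\<^sub>R p + e *\<^sub>R l + b *\<^sub>R q + c *\<^sub>R r = 0" "b *\<^sub>R q + e *\<^sub>R l + c *\<^sub>R r + a *\<^sub>R p = 0"
    "c *\<^sub>R r + e *\<^sub>R l + a *\<^sub>R p + b *\<^sub>R q = 0"
    using c(5) by (simp_all add: algebra_simps)
  note E = edge_pair[OF u(1,2,3,4) d d'(1) c(1,2,3,4) c(5)]
    edge_pair[OF u(2,3,1,4) rot(1) d'(2) c(2,3,1,4) cs(1)]
    edge_pair[OF u(3,1,2,4) rot(2) d'(3) c(3,1,2,4) cs(2)]
    edge_pair[OF u(1,4,2,3) rot(3) rot(8) c(1,4,2,3) cs(3)]
    edge_pair[OF u(2,4,3,1) rot(5) rot(4) c(2,4,3,1) cs(4)]
    edge_pair[OF u(3,4,1,2) rot(7) rot(6) c(3,4,1,2) cs(5)]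
  note V = vertex_angle_sum[OF u(1,2,3,4) d d'(3) rot(3)]
    vertex_angle_sum[OF u(2,3,1,4) rot(1) d'(1) rot(5)]
    vertex_angle_sum[OF u(3,1,2,4) rot(2) d'(2) rot(7)]
    vertex_angle_sum[OF u(4,2,1,3) rot(4) rot(8) rot(6)]
  note F = face_angle_sum(1)[OF u(1,2,3) d] face_angle_sum(1)[OF u(2,1,4) d'(1)]
    face_angle_sum(1)[OF u(3,2,4) d'(2)] face_angle_sum(1)[OF u(1,3,4) d'(3)]
  \<comment> \<open>These angles are the complements of the angles at the circumcentres, whence
    \<open>12 * (pi / 2) - 4 * pi = 2 * pi\<close>.\<close>
  have F': "face_angle p q r + face_angle q r p + face_angle r p q + (face_angle q p l + face_angle p l q + face_angle l q p)
     + (face_angle r q l + face_angle q l r + face_angle l r q) + (face_angle p r l + face_angle r l p + face_angle l p r) = 2 * pi"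
    using F by (simp add: face_angle_def)
  have V': "psi_angle p q r + psi_angle q r p + psi_angle r p q + (psi_angle q p l + psi_angle p l q + psi_angle l q p)
     + (psi_angle r q l + psi_angle q l r + psi_angle l r q) + (psi_angle p r l + psi_angle r l p + psi_angle l p r) = 4 * pi"
    using V by linarith
  have tot: "edge_val p q r l + edge_val q r p l + edge_val r p q l + edge_val p l q r + edge_val q l r p + edge_val r l p q
     = - (1/3 + crit_cos) * (2 * pi) + (1 + crit_cos/3) * (4 * pi) - arc_sum p q r l"
  proof -
    define A B where "A = - (1/3 + crit_cos)" and "B = 1 + crit_cos/3"
    show ?thesis
      unfolding edge_val_def arc_sum_def A_def[symmetric] B_def[symmetric] F'[symmetric] V'[symmetric] distrib_left
      by linarith
  qed
  have M: "- (1/3 + crit_cos) * (2 * pi) + (1 + crit_cos/3) * (4 * pi) - 12 * edge_min = arc_max"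
  proof -
    have "arc_max = 24 * crit_cos / sqrt 3"
    proof -
      have "sqrt 6 = sqrt 2 * sqrt 3" by (simp flip: real_sqrt_mult)
      then show ?thesis by (simp add: arc_max_def crit_cos_def field_simps)
    qed
    then show ?thesis by (simp add: edge_min_def field_simps)
  qed
  show "arc_sum p q r l \<le> arc_max"
    using E(1,3,5,7,9,11) tot M by linarith
  assume "arc_sum p q r l = arc_max"
  then have "edge_val p q r l = 2 * edge_min" "edge_val q r p l = 2 * edge_min" "edge_val r p q l = 2 * edge_min"
     "edge_val p l q r = 2 * edge_min" "edge_val q l r p = 2 * edge_min" "edge_val r l p q = 2 * edge_min"
    using E(1,3,5,7,9,11) tot M by linarith+
  then show "p \<bullet> q = -1/3 \<and> p \<bullet> r = -1/3 \<and> p \<bullet> l = -1/3 \<and> q \<bullet> r = -1/3 \<and> q \<bullet> l = -1/3 \<and> r \<bullet> l = -1/3"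
    using E(2,4,6,8,10,12) by (simp add: inner_commute)
qed

lemma arc_sum_regular:
  assumes u: "norm p = 1" "norm q = 1" "norm r = 1" "norm l = 1"
    and g: "p \<bullet> q = -1/3" "p \<bullet> r = -1/3" "p \<bullet> l = -1/3" "q \<bullet> r = -1/3" "q \<bullet> l = -1/3" "r \<bullet> l = -1/3"
    and d: "vol3 p q r > 0" "vol3 q p l > 0" "vol3 r q l > 0" "vol3 p r l > 0"
  shows "arc_sum p q r l = arc_max"
proof -
  have *: "arc_term x y z = sqrt (2/3) * arctan (sqrt 2)"
    if "norm x = 1" "norm y = 1" "norm z = 1" "x \<bullet> y = -1/3" "x \<bullet> z = -1/3" "y \<bullet> z = -1/3" "vol3 x y z > 0" for x y z
  proof -
    have h: "half_len x y = sqrt (2/3)" using that by (simp add: half_len_def)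
    have "(vol3 x y z)^2 = 16/27"
      using vol3_square_unit[OF that(1-3)] that(4-6) by (simp add: power2_eq_square)
    then have v: "vol3 x y z = sqrt (16/27)" using that(7) by (metis real_sqrt_unique less_imp_le)
    have n: "apex_inner x y z = 4/3" using that by (simp add: apex_inner_unit)
    have "sqrt (2/3) * (4/3) / sqrt (16/27) = sqrt (2/3 * (16/9) / (16/27))"
      by (simp only: real_sqrt_mult real_sqrt_divide) (simp add: real_sqrt_divide)
    then show ?thesis by (simp add: arc_term_def half_arc_def h v n)
  qed
  have rot: "vol3 q r p > 0" "vol3 r p q > 0" "vol3 p l q > 0" "vol3 l q p > 0" "vol3 q l r > 0"
    "vol3 l r q > 0" "vol3 r l p > 0" "vol3 l p r > 0"
    using d by (metis vol3_rotate)+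
  have "arc_sum p q r l = 12 * (sqrt (2/3) * arctan (sqrt 2))"
    unfolding arc_sum_def using u g d rot by (simp add: * inner_commute)
  also have "\<dots> = arc_max"
  proof -
    have "sqrt (2/3) = sqrt (6 / 9)" by simp
    also have "\<dots> = sqrt 6 / 3" by (simp only: real_sqrt_divide) simp
    finally show ?thesis by (simp add: arc_max_def)
  qed
  finally show ?thesis .
qed

section \<open>Integration over simplicial cones\<close>

text \<open>The integrand is the derivative of \<open>min (norm (y + s *\<^sub>R v)) 1\<close> in
  \<open>s\<close>. This function is eventually \<open>1\<close>, so the integral is
  \<open>1\<close> minus its value at \<open>0\<close>.\<close>

lemma ray_integral:
  fixes y v :: "'a::euclidean_space"
  assumes nz: "\<And>s. y + s *\<^sub>R v \<noteq> 0" and v: "v \<noteq> 0"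
  shows "(\<integral>s. indicator {0<..} s * (indicator (ball 0 1) (y + s *\<^sub>R v) *
      ((y + s *\<^sub>R v) \<bullet> v / norm (y + s *\<^sub>R v))) \<partial>lborel) = max 0 (1 - norm y)"
proof -
  define n where "n = (\<lambda>s. norm (y + s *\<^sub>R v))"
  define f where "f = (\<lambda>s. indicator (ball 0 1) (y + s *\<^sub>R v) * ((y + s *\<^sub>R v) \<bullet> v / n s) :: real)"
  define g where "g = (\<lambda>s. min (n s) 1)"
  define M where "M = (1 + norm y) / norm v"
  have M: "0 \<le> M" by (simp add: M_def)
  have nM: "1 \<le> n s" if "M \<le> s" for s
  proof -
    have "norm (s *\<^sub>R v) \<le> n s + norm y"
      unfolding n_def by (metis add_diff_cancel_left' norm_triangle_ineq4)
    moreover have "norm (s *\<^sub>R v) \<ge> 1 + norm y"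
      using that v order_trans[OF M that] by (simp add: M_def field_simps)
    ultimately show ?thesis by simp
  qed
  have [measurable]: "(\<lambda>s. y + s *\<^sub>R v) \<in> borel_measurable borel"
    by (intro borel_measurable_continuous_onI continuous_intros)
  have "f = (\<lambda>s. if norm (y + s *\<^sub>R v) < 1 then (y + s *\<^sub>R v) \<bullet> v / n s else 0)"
    by (auto simp: f_def fun_eq_iff)
  then have [measurable]: "f \<in> borel_measurable borel"
    unfolding n_def by (rule ssubst) measurable
  have cn: "continuous_on UNIV n" unfolding n_def by (intro continuous_intros)
  have dn: "(n has_real_derivative ((y + s *\<^sub>R v) \<bullet> v / n s)) (at s)" for s
  proof -
    have "((\<lambda>s. y + s *\<^sub>R v) has_derivative (\<lambda>h. h *\<^sub>R v)) (at s)"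
      by (auto intro!: derivative_eq_intros)
    from has_derivative_compose[OF this has_derivative_norm[OF nz[of s]]]
    have "(n has_derivative (\<lambda>h. (h *\<^sub>R v) \<bullet> sgn (y + s *\<^sub>R v))) (at s)"
      by (simp add: n_def)
    moreover have "(h *\<^sub>R v) \<bullet> sgn (y + s *\<^sub>R v) = (y + s *\<^sub>R v) \<bullet> v / n s * h" for h
    proof -
      have "(h *\<^sub>R v) \<bullet> sgn w = w \<bullet> v / norm w * h" for w
        by (simp add: sgn_div_norm inner_commute divide_inverse)
      then show ?thesis unfolding n_def .
    qed
    ultimately show ?thesis by (simp only: has_field_derivative_def)
  qed
  \<comment> \<open>The line meets the unit sphere only at roots of a nonzero quadratic. There the
    minimum may fail to be differentiable, and finitely many such points are harmless for the
    fundamental theorem.\<close>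
  define S where "S = {s. n s = 1}"
  have "S \<subseteq> {s. poly [: y \<bullet> y - 1, 2 * (y \<bullet> v), v \<bullet> v :] s = 0}"
  proof
    fix s assume "s \<in> S"
    then have "(y + s *\<^sub>R v) \<bullet> (y + s *\<^sub>R v) = 1" by (simp add: S_def n_def dot_square_norm)
    then show "s \<in> {s. poly [: y \<bullet> y - 1, 2 * (y \<bullet> v), v \<bullet> v :] s = 0}"
      by (simp add: inner_add_left inner_add_right inner_commute algebra_simps)
  qed
  moreover have "finite {s. poly [: y \<bullet> y - 1, 2 * (y \<bullet> v), v \<bullet> v :] s = 0}"
    using v by (intro poly_roots_finite) auto
  ultimately have S: "finite S" by (rule finite_subset)
  have "(f has_integral (g M - g 0)) {0..M}"
  proof (rule fundamental_theorem_of_calculus_strong[OF S M])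
    show "continuous_on {0..M} g"
      unfolding g_def by (intro continuous_intros continuous_on_subset[OF cn]) auto
    fix s assume "s \<in> {0..M} - S"
    then have "n s \<noteq> 1" by (auto simp: S_def)
    then consider "n s < 1" | "n s > 1" by linarith
    then show "(g has_vector_derivative f s) (at s)"
    proof cases
      case 1
      have "(g has_real_derivative ((y + s *\<^sub>R v) \<bullet> v / n s)) (at s)"
      proof (rule has_field_derivative_transform_within_open[OF dn])
        show "open {s. n s < 1}" using cn by (intro open_Collect_less continuous_intros) auto
      qed (use 1 in \<open>auto simp: g_def\<close>)
      moreover have "f s = (y + s *\<^sub>R v) \<bullet> v / n s" using 1 by (simp add: f_def n_def)
      ultimately show ?thesis by (simp add: has_real_derivative_iff_has_vector_derivative)
    next
      case 2
      have "(g has_real_derivative 0) (at s)"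
      proof (rule has_field_derivative_transform_within_open[OF DERIV_const[of 1]])
        show "open {s. 1 < n s}" using cn by (intro open_Collect_less continuous_intros) auto
      qed (use 2 in \<open>auto simp: g_def\<close>)
      moreover have "f s = 0" using 2 by (simp add: f_def n_def)
      ultimately show ?thesis by (simp add: has_real_derivative_iff_has_vector_derivative)
    qed
  qed
  then have hi: "((\<lambda>s. if s \<in> {0..M} then f s else 0) has_integral (g M - g 0)) UNIV"
    by (simp only: has_integral_restrict_UNIV)
  have "integrable lborel (\<lambda>s. indicator {0..M} s * f s)"
  proof (rule Bochner_Integration.integrable_bound[where f = "\<lambda>s. norm v * indicator {0..M} s"])
    show "AE s in lborel. norm (indicator {0..M} s * f s) \<le> norm (norm v * indicator {0..M} s)"
    proof (rule AE_I2)
      fix s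
      have "\<bar>(y + s *\<^sub>R v) \<bullet> v\<bar> / n s \<le> norm v"
        using Cauchy_Schwarz_ineq2[of "y + s *\<^sub>R v" v] nz[of s] by (simp add: n_def field_simps)
      then show "norm (indicator {0..M} s * f s) \<le> norm (norm v * indicator {0..M} s)"
        by (auto simp: f_def indicator_def n_def abs_mult)
    qed
  qed (auto intro!: integrable_mult_right integrable_real_indicator simp: emeasure_lborel_Icc_eq)
  then have "((\<lambda>s. indicator {0..M} s * f s) has_integral (\<integral>s. indicator {0..M} s * f s \<partial>lborel)) UNIV"
    by (rule has_integral_integral_lborel)
  moreover have "(\<lambda>s. indicator {0..M} s * f s) = (\<lambda>s. if s \<in> {0..M} then f s else 0)"
    by (auto simp: indicator_def)
  ultimately have "(\<integral>s. indicator {0..M} s * f s \<partial>lborel) = g M - g 0"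
    using hi has_integral_unique by metis
  also have "\<dots> = max 0 (1 - norm y)" using nM[of M] by (auto simp: g_def n_def)
  finally have I: "(\<integral>s. indicator {0..M} s * f s \<partial>lborel) = max 0 (1 - norm y)" .
  have "(\<integral>s. indicator {0<..} s * f s \<partial>lborel) = (\<integral>s. indicator {0..M} s * f s \<partial>lborel)"
  proof (rule integral_cong_AE)
    show "AE s in lborel. indicator {0<..} s * f s = indicator {0..M} s * f s"
      using AE_lborel_singleton[of 0]
    proof eventually_elim
      case (elim s)
      show ?case using nM[of s] elim by (auto simp: indicator_def f_def n_def)
    qed
  qed auto
  then show ?thesis unfolding I by (simp add: f_def n_def)
qed

section \<open>Lebesgue measure in the coordinates of a simplicial cone\<close>

lemma lborel_vector3:
  "distr (lborel \<Otimes>\<^sub>M (lborel \<Otimes>\<^sub>M lborel)) borel (\<lambda>(s, a, b). vector [s, a, b] :: real^3) = lborel"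
proof (rule lborel_eqI[symmetric])
  have [measurable]: "(\<lambda>(s, a, b). vector [s, a, b] :: real^3) \<in> borel_measurable (lborel \<Otimes>\<^sub>M (lborel \<Otimes>\<^sub>M lborel))"
  proof -
    have "(\<lambda>x. (vector [fst x, fst (snd x), snd (snd x)] :: real^3)) = 
      (\<lambda>x. fst x *\<^sub>R axis 1 1 + fst (snd x) *\<^sub>R axis 2 1 + snd (snd x) *\<^sub>R axis 3 1)"
      by (auto simp: vec_eq_iff forall_3 axis_def)
    then show ?thesis by (simp add: case_prod_beta')
  qed
  fix l u :: "real^3"
  assume lu: "\<And>b. b \<in> Basis \<Longrightarrow> l \<bullet> b \<le> u \<bullet> b"
  then have lu': "l $ i \<le> u $ i" for i
    using lu[of "axis i 1"] by (simp add: inner_axis)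
  have "emeasure (distr (lborel \<Otimes>\<^sub>M (lborel \<Otimes>\<^sub>M lborel)) borel (\<lambda>(s, a, b). vector [s, a, b])) (box l u)
     = emeasure (lborel \<Otimes>\<^sub>M (lborel \<Otimes>\<^sub>M lborel)) (box (l$1) (u$1) \<times> (box (l$2) (u$2) \<times> box (l$3) (u$3)))"
    by (subst emeasure_distr) (auto intro!: arg_cong2[where f = emeasure] simp: space_pair_measure mem_box_cart forall_3)
  also have "\<dots> = ennreal ((u$1 - l$1) * ((u$2 - l$2) * (u$3 - l$3)))"
  proof -
    have N: "sigma_finite_measure (lborel \<Otimes>\<^sub>M lborel :: (real \<times> real) measure)"
      unfolding lborel_prod by (rule sigma_finite_lborel)
    have "emeasure (lborel \<Otimes>\<^sub>M (lborel \<Otimes>\<^sub>M lborel)) (box (l$1) (u$1) \<times> (box (l$2) (u$2) \<times> box (l$3) (u$3)))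
        = emeasure lborel (box (l$1) (u$1)) * (emeasure lborel (box (l$2) (u$2)) * emeasure lborel (box (l$3) (u$3)))"
      by (subst sigma_finite_measure.emeasure_pair_measure_Times[OF N], simp, simp add: pair_measureI,
          subst lborel.emeasure_pair_measure_Times, simp_all)
    then show ?thesis using lu' by (simp add: ennreal_mult)
  qed
  also have "\<dots> = (\<Prod>b\<in>Basis. (u - l) \<bullet> b)"
  proof -
    have "(Basis :: (real^3) set) = range (\<lambda>i. axis i 1)"
      by (auto simp: Basis_vec_def)
    then have "(\<Prod>b\<in>Basis. (u - l) \<bullet> b) = (\<Prod>b\<in>range (\<lambda>i. axis i 1). (u - l) \<bullet> b)"
      by (simp only:)
    also have "\<dots> = (\<Prod>i\<in>UNIV. (u - l) \<bullet> axis i 1)"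
      by (subst prod.reindex) (auto simp: inj_on_def axis_eq_axis)
    also have "\<dots> = (u$1 - l$1) * ((u$2 - l$2) * (u$3 - l$3))"
    proof -
      have "(\<Prod>i\<in>UNIV. f i) = f 1 * (f 2 * f 3)" for f :: "3 \<Rightarrow> real"
        unfolding UNIV_3 by simp
      then show ?thesis by (simp only: inner_axis) simp
    qed
    finally show ?thesis by (simp only:)
  qed
  finally show "emeasure (distr (lborel \<Otimes>\<^sub>M (lborel \<Otimes>\<^sub>M lborel)) borel (\<lambda>(s, a, b). vector [s, a, b])) (box l u)
     = (\<Prod>b\<in>Basis. (u - l) \<bullet> b)" .
qed simp

lemma lborel_linear_image:
  fixes g :: "real^'n::{finite,wellorder} \<Rightarrow> real^'n::{finite,wellorder}"
  assumes lin: "linear g" and d: "det (matrix g) \<noteq> 0"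
  shows "density (distr lborel borel g) (\<lambda>_. \<bar>det (matrix g)\<bar>) = lborel"
proof (rule lborel_eqI[symmetric])
  have [measurable]: "g \<in> borel_measurable borel"
    using lin by (intro borel_measurable_continuous_onI linear_continuous_on linear_conv_bounded_linear[THEN iffD1])
  fix l u :: "real^'n::{finite,wellorder}"
  assume lu: "\<And>b. b \<in> Basis \<Longrightarrow> l \<bullet> b \<le> u \<bullet> b"
  obtain h where h: "linear h" "\<And>x. h (g x) = x" "\<And>x. g (h x) = x"
    using lin d by (metis det_nz_iff_inj linear_injective_isomorphism)
  define S where "S = g -` box l u"
  have gS: "g ` S = box l u" unfolding S_def using h by (metis surj_def surj_image_vimage_eq)
  have S[measurable]: "S \<in> sets borel" unfolding S_def using measurable_sets[of g borel borel "box l u"] by simp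
  have "S = h ` box l u" 
  proof (intro set_eqI iffI)
    fix x assume "x \<in> S"
    then show "x \<in> h ` box l u" using h(2)[of x] by (metis S_def image_eqI vimage_eq)
  next
    fix x assume "x \<in> h ` box l u"
    then show "x \<in> S" using h(3) by (auto simp: S_def)
  qed
  then have "bounded S" using h(1) by (simp add: bounded_linear_image linear_conv_bounded_linear bounded_box)
  then have lm: "S \<in> lmeasurable" using S by (intro bounded_set_imp_lmeasurable) auto
  have "emeasure lborel S < \<infinity>" using \<open>bounded S\<close> by (rule emeasure_bounded_finite)
  then have eS: "emeasure lborel S = ennreal (measure lebesgue S)"
    using S by (simp add: emeasure_eq_ennreal_measure)
  have "measure lebesgue (box l u) = \<bar>det (matrix g)\<bar> * measure lebesgue S"
    using measure_linear_image[OF lin lm] gS by simp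
  moreover have "emeasure (density (distr lborel borel g) (\<lambda>_. \<bar>det (matrix g)\<bar>)) (box l u)
      = ennreal \<bar>det (matrix g)\<bar> * emeasure lborel S"
    by (simp add: emeasure_density nn_integral_cmult emeasure_distr S_def)
  ultimately have "emeasure (density (distr lborel borel g) (\<lambda>_. \<bar>det (matrix g)\<bar>)) (box l u)
      = ennreal (measure lborel (box l u))"
    by (simp add: eS ennreal_mult')
  then show "emeasure (density (distr lborel borel g) (\<lambda>_. \<bar>det (matrix g)\<bar>)) (box l u)
      = (\<Prod>b\<in>Basis. (u - l) \<bullet> b)"
    using lu by (simp add: measure_lborel_box_eq)
qed simp

definition cone_map :: "real^3 \<Rightarrow> real^3 \<Rightarrow> real^3 \<Rightarrow> real \<times> real \<times> real \<Rightarrow> real^3" where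
  "cone_map n1 n2 n3 = (\<lambda>(s, a, b). s *\<^sub>R n1 + a *\<^sub>R n2 + b *\<^sub>R n3)"

lemma cone_map_measurable [measurable]:
  "cone_map n1 n2 n3 \<in> borel_measurable (lborel \<Otimes>\<^sub>M (lborel \<Otimes>\<^sub>M lborel))"
  unfolding cone_map_def case_prod_beta' by measurable

lemma lborel_cone_map:
  assumes d: "n1 \<bullet> cross3 n2 n3 \<noteq> 0"
  shows "lborel = density (distr (lborel \<Otimes>\<^sub>M (lborel \<Otimes>\<^sub>M lborel)) borel (cone_map n1 n2 n3))
     (\<lambda>_. \<bar>n1 \<bullet> cross3 n2 n3\<bar>)"
proof -
  define g where "g = (\<lambda>v::real^3. v $ 1 *\<^sub>R n1 + v $ 2 *\<^sub>R n2 + v $ 3 *\<^sub>R n3)"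
  have lin: "linear g" unfolding g_def by (auto intro!: linearI simp: algebra_simps)
  have det: "det (matrix g) = n1 \<bullet> cross3 n2 n3"
    by (simp add: det_3 matrix_def g_def axis_def cross3_def inner_vec_def sum_3 vector_def algebra_simps)
  have [measurable]: "g \<in> borel_measurable borel"
    using lin by (intro borel_measurable_continuous_onI linear_continuous_on linear_conv_bounded_linear[THEN iffD1])
  have vm: "(\<lambda>(s, a, b). vector [s, a, b] :: real^3) \<in> borel_measurable (lborel \<Otimes>\<^sub>M (lborel \<Otimes>\<^sub>M lborel))"
  proof -
    have "(\<lambda>x. (vector [fst x, fst (snd x), snd (snd x)] :: real^3)) = 
      (\<lambda>x. fst x *\<^sub>R axis 1 1 + fst (snd x) *\<^sub>R axis 2 1 + snd (snd x) *\<^sub>R axis 3 1)"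
      by (auto simp: vec_eq_iff forall_3 axis_def)
    then show ?thesis by (simp add: case_prod_beta')
  qed
  have "distr lborel borel g = distr (distr (lborel \<Otimes>\<^sub>M (lborel \<Otimes>\<^sub>M lborel)) borel (\<lambda>(s, a, b). vector [s, a, b])) borel g"
    by (simp only: lborel_vector3)
  also have "\<dots> = distr (lborel \<Otimes>\<^sub>M (lborel \<Otimes>\<^sub>M lborel)) borel (g \<circ> (\<lambda>(s, a, b). vector [s, a, b]))"
    by (rule distr_distr) (use vm in auto)
  also have "g \<circ> (\<lambda>(s, a, b). vector [s, a, b]) = cone_map n1 n2 n3"
    by (auto simp: g_def cone_map_def fun_eq_iff)
  finally show ?thesis using lborel_linear_image[OF lin] d by (simp add: det)
qed

text \<open>The substitution \<open>b = a * t\<close> with Jacobian \<open>a\<close> reduces the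
  norm to \<open>a * L t\<close>. The integral of \<open>a * (1 - a * L)\<close> over
  \<open>a\<close> from \<open>0\<close> to \<open>1 / L\<close> is
  \<open>1 / (6 * L^2)\<close>.\<close>

lemma sector_integral:
  fixes n2 n3 :: "'a::euclidean_space"
  assumes nz: "\<And>t. n2 + t *\<^sub>R n3 \<noteq> 0"
  shows "(\<integral>\<^sup>+x. indicator ({0<..} \<times> {0<..}) x * ennreal (max 0 (1 - norm (fst x *\<^sub>R n2 + snd x *\<^sub>R n3))) \<partial>(lborel \<Otimes>\<^sub>M lborel))
    = (\<integral>\<^sup>+t. indicator {0<..} t * ennreal (1 / (6 * (norm (n2 + t *\<^sub>R n3))^2)) \<partial>lborel)"
proof -
  define L where "L = (\<lambda>t. norm (n2 + t *\<^sub>R n3))"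
  have [measurable]: "L \<in> borel_measurable borel" unfolding L_def by measurable
  have Lpos: "L t > 0" for t using nz[of t] by (simp add: L_def)
  define \<phi> where "\<phi> = (\<lambda>x. max 0 (1 - norm (fst x *\<^sub>R n2 + snd x *\<^sub>R n3)) :: real)"
  have [measurable]: "\<phi> \<in> borel_measurable (lborel \<Otimes>\<^sub>M lborel)" unfolding \<phi>_def by measurable
  have "(\<integral>\<^sup>+x. indicator ({0<..} \<times> {0<..}) x * ennreal (\<phi> x) \<partial>(lborel \<Otimes>\<^sub>M lborel))
     = (\<integral>\<^sup>+a. \<integral>\<^sup>+b. indicator ({0<..} \<times> {0<..}) (a, b) * ennreal (\<phi> (a, b)) \<partial>lborel \<partial>lborel)"
    by (rule lborel.nn_integral_fst[symmetric]) (measurable; simp add: pair_measureI)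
  also have "\<dots> = (\<integral>\<^sup>+a. \<integral>\<^sup>+t. indicator {0<..} a * indicator {0<..} t * ennreal (a * max 0 (1 - a * L t)) \<partial>lborel \<partial>lborel)"
  proof (rule nn_integral_cong)
    fix a :: real
    show "(\<integral>\<^sup>+b. indicator ({0<..} \<times> {0<..}) (a, b) * ennreal (\<phi> (a, b)) \<partial>lborel)
       = (\<integral>\<^sup>+t. indicator {0<..} a * indicator {0<..} t * ennreal (a * max 0 (1 - a * L t)) \<partial>lborel)"
    proof (cases "0 < a")
      case True
      have "(\<integral>\<^sup>+b. indicator ({0<..} \<times> {0<..}) (a, b) * ennreal (\<phi> (a, b)) \<partial>lborel)
          = (\<integral>\<^sup>+b. indicator {0<..} b * ennreal (\<phi> (a, b)) \<partial>lborel)"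
        using True by (intro nn_integral_cong) (auto simp: indicator_def)
      also have "\<dots> = \<bar>a\<bar> * (\<integral>\<^sup>+t. indicator {0<..} (0 + a * t) * ennreal (\<phi> (a, 0 + a * t)) \<partial>lborel)"
        using True by (intro nn_integral_real_affine) (auto simp: \<phi>_def)
      also have "\<dots> = (\<integral>\<^sup>+t. ennreal a * (indicator {0<..} (a * t) * ennreal (\<phi> (a, a * t))) \<partial>lborel)"
        using True by (subst nn_integral_cmult) (auto simp: \<phi>_def)
      also have "\<dots> = (\<integral>\<^sup>+t. indicator {0<..} a * indicator {0<..} t * ennreal (a * max 0 (1 - a * L t)) \<partial>lborel)"
      proof (rule nn_integral_cong)
        fix t
        have "norm (a *\<^sub>R n2 + (a * t) *\<^sub>R n3) = norm (a *\<^sub>R (n2 + t *\<^sub>R n3))"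
          by (simp add: algebra_simps)
        also have "\<dots> = a * L t" using True by (simp only: norm_scaleR L_def)
        finally have "\<phi> (a, a * t) = max 0 (1 - a * L t)" by (simp add: \<phi>_def)
        then show "ennreal a * (indicator {0<..} (a * t) * ennreal (\<phi> (a, a * t)))
            = indicator {0<..} a * indicator {0<..} t * ennreal (a * max 0 (1 - a * L t))"
          using True by (auto simp: indicator_def ennreal_mult zero_less_mult_iff)
      qed
      finally show ?thesis .
    qed (simp add: indicator_def)
  qed
  also have "\<dots> = (\<integral>\<^sup>+t. \<integral>\<^sup>+a. indicator {0<..} a * indicator {0<..} t * ennreal (a * max 0 (1 - a * L t)) \<partial>lborel \<partial>lborel)"
    by (rule lborel_pair.Fubini') measurable
  also have "\<dots> = (\<integral>\<^sup>+t. indicator {0<..} t * ennreal (1 / (6 * (L t)^2)) \<partial>lborel)"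
  proof (rule nn_integral_cong)
    fix t
    have "(\<integral>\<^sup>+a. indicator {0<..} a * indicator {0<..} t * ennreal (a * max 0 (1 - a * L t)) \<partial>lborel)
       = (\<integral>\<^sup>+a. indicator {0<..} t * (ennreal (a * (1 - a * L t)) * indicator {0..1 / L t} a) \<partial>lborel)"
    proof (rule nn_integral_cong)
      fix a
      consider "a \<le> 0" | "0 < a" "a \<le> 1 / L t" | "0 < a" "1 / L t < a" by linarith
      then show "indicator {0<..} a * indicator {0<..} t * ennreal (a * max 0 (1 - a * L t))
         = indicator {0<..} t * (ennreal (a * (1 - a * L t)) * indicator {0..1 / L t} a)"
        by cases (use Lpos[of t] in \<open>auto simp: indicator_def max_def field_simps\<close>)
    qed
    also have "\<dots> = indicator {0<..} t * (\<integral>\<^sup>+a. ennreal (a * (1 - a * L t)) * indicator {0..1 / L t} a \<partial>lborel)"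
      by (rule nn_integral_cmult) measurable
    also have "(\<integral>\<^sup>+a. ennreal (a * (1 - a * L t)) * indicator {0..1 / L t} a \<partial>lborel)
       = ennreal (((1 / L t)^2 / 2 - (1 / L t)^3 * L t / 3) - (0^2 / 2 - 0^3 * L t / 3))"
    proof (rule nn_integral_FTC_Icc)
      fix a assume a: "a \<in> {0..1 / L t}"
      show "((\<lambda>a. a^2 / 2 - a^3 * L t / 3) has_real_derivative a * (1 - a * L t)) (at a)"
        by (auto intro!: derivative_eq_intros simp: algebra_simps power2_eq_square)
      have "a * L t \<le> 1" using a Lpos[of t] by (simp add: field_simps)
      then show "0 \<le> a * (1 - a * L t)" using a by simp
    qed (use Lpos[of t] in auto)
    also have "((1 / L t)^2 / 2 - (1 / L t)^3 * L t / 3) - (0^2 / 2 - 0^3 * L t / 3) = 1 / (6 * (L t)^2)"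
      using Lpos[of t] by (simp add: field_simps power2_eq_square power3_eq_cube)
    finally show "(\<integral>\<^sup>+a. indicator {0<..} a * indicator {0<..} t * ennreal (a * max 0 (1 - a * L t)) \<partial>lborel)
       = indicator {0<..} t * ennreal (1 / (6 * (L t)^2))" .
  qed
  finally show ?thesis by (simp add: \<phi>_def L_def)
qed

text \<open>As \<open>t\<close> runs from \<open>0\<close> to infinity, the direction of
  \<open>n2 + t *\<^sub>R n3\<close> sweeps a sector. The quotient
  \<open>(u - t * v) / (1 + t)\<close> is the tangent of its angle, which falls from
  \<open>arctan u\<close> to \<open>- arctan v\<close>.\<close>

lemma sector_arctan:
  fixes n2 n3 :: "'a::euclidean_space"
  assumes n: "\<And>t. (norm (n2 + t *\<^sub>R n3))^2 = k * ((1 + t)^2 + (u - t * v)^2)"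
    and k: "0 < k" and uv: "0 < u + v"
  shows "(\<integral>\<^sup>+t. indicator {0<..} t * ennreal (1 / (6 * (norm (n2 + t *\<^sub>R n3))^2)) \<partial>lborel)
     = ennreal ((arctan u + arctan v) / (6 * k * (u + v)))"
proof -
  define F where "F = (\<lambda>t. - arctan ((u - t * v) / (1 + t)) / (6 * k * (u + v)))"
  let ?f = "\<lambda>t. 1 / (6 * (norm (n2 + t *\<^sub>R n3))^2)"
  have "(\<integral>\<^sup>+t. indicator {0<..} t * ennreal (?f t) \<partial>lborel) = (\<integral>\<^sup>+t. ennreal (?f t) * indicator {0..} t \<partial>lborel)"
    by (rule nn_integral_cong_AE, use AE_lborel_singleton[of "0::real"] in eventually_elim) (auto simp: indicator_def)
  also have "\<dots> = ennreal (arctan v / (6 * k * (u + v)) - F 0)"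
  proof (rule nn_integral_FTC_atLeast)
    fix t :: real assume t: "0 \<le> t"
    have e: "1 + ((u - t * v) / (1 + t))^2 = ((1 + t)^2 + (u - t * v)^2) / (1 + t)^2"
      using t by (simp add: field_simps)
    have p: "(1 + t)^2 + (u - t * v)^2 > 0" using t by (simp add: add_pos_nonneg)
    have "((\<lambda>t. (u - t * v) / (1 + t)) has_real_derivative (- v * (1 + t) - (u - t * v) * 1) / ((1 + t) * (1 + t))) (at t)"
      using t by (auto intro!: derivative_eq_intros)
    then have "((\<lambda>t. (u - t * v) / (1 + t)) has_real_derivative - (u + v) / (1 + t)^2) (at t)"
      by (rule DERIV_cong) (simp add: power2_eq_square algebra_simps)
    note DERIV_chain2[OF DERIV_arctan this]
    moreover have "inverse (1 + ((u - t * v) / (1 + t))^2) * (- (u + v) / (1 + t)^2) = - (u + v) / ((1 + t)^2 + (u - t * v)^2)"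
      unfolding e using t by simp
    ultimately have "((\<lambda>t. arctan ((u - t * v) / (1 + t))) has_real_derivative - (u + v) / ((1 + t)^2 + (u - t * v)^2)) (at t)"
      by simp
    then have "(F has_real_derivative - (- (u + v) / ((1 + t)^2 + (u - t * v)^2)) / (6 * k * (u + v))) (at t)"
      unfolding F_def by (intro DERIV_cdivide DERIV_minus)
    moreover have "- (- (u + v) / ((1 + t)^2 + (u - t * v)^2)) / (6 * k * (u + v)) = ?f t"
    proof -
      have "- (- w / z) / (6 * k * w) = 1 / (6 * (k * z))" if "w \<noteq> 0" for w z :: real using that by simp
      then show ?thesis unfolding n using uv by (metis less_irrefl)
    qed
    ultimately show "(F has_real_derivative ?f t) (at t)" by simp
    show "0 \<le> ?f t" by simp
  next
    have "((\<lambda>t. (u - t * v) / (1 + t)) \<longlongrightarrow> - v) at_top"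
    proof -
      have "((\<lambda>t. (u + v) / (1 + t) - v) \<longlongrightarrow> 0 - v) at_top"
        by (intro tendsto_diff tendsto_const real_tendsto_divide_at_top[OF tendsto_const]
            filterlim_tendsto_add_at_top[OF tendsto_const] filterlim_ident)
      moreover have "eventually (\<lambda>t. (u + v) / (1 + t) - v = (u - t * v) / (1 + t)) at_top"
        using eventually_ge_at_top[of 0] by eventually_elim (simp add: field_simps)
      ultimately show ?thesis by (simp add: Lim_transform_eventually)
    qed
    then have "(F \<longlongrightarrow> - arctan (- v) / (6 * k * (u + v))) at_top"
      unfolding F_def using k uv by (intro tendsto_intros) auto
    then show "(F \<longlongrightarrow> arctan v / (6 * k * (u + v))) at_top" by (simp add: arctan_minus)
  qed simp
  also have "arctan v / (6 * k * (u + v)) - F 0 = (arctan u + arctan v) / (6 * k * (u + v))"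
    by (simp add: F_def add_divide_distrib)
  finally show ?thesis .
qed

lemma integrable_cone:
  assumes [measurable]: "C \<in> sets borel"
  shows "integrable lborel (\<lambda>x::'a::euclidean_space. indicator C x * (indicator (ball 0 1) x * (x \<bullet> n / norm x)))"
proof (rule Bochner_Integration.integrable_bound[where f = "\<lambda>x. norm n * indicator (ball 0 1) x"])
  show "integrable lborel (\<lambda>x::'a. norm n * indicator (ball 0 1) x)"
    by (intro integrable_mult_right integrable_real_indicator emeasure_lborel_ball_finite) auto
  show "AE x in lborel. norm (indicator C x * (indicator (ball 0 1) x * (x \<bullet> n / norm x)))
      \<le> norm (norm n * indicator (ball 0 1) x)"
  proof (rule AE_I2)
    fix x :: 'a
    have "\<bar>x \<bullet> n / norm x\<bar> \<le> norm n"
      using Cauchy_Schwarz_ineq2[of x n] by (cases "x = 0") (simp_all add: field_simps)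
    then show "norm (indicator C x * (indicator (ball 0 1) x * (x \<bullet> n / norm x)))
      \<le> norm (norm n * indicator (ball 0 1) x)"
      by (simp add: indicator_def)
  qed
  have [measurable]: "(ball 0 1 :: 'a set) \<in> sets borel" by simp
  show "(\<lambda>x. indicator C x * (indicator (ball 0 1) x * (x \<bullet> n / norm x))) \<in> borel_measurable lborel"
    by simp
qed

text \<open>Up to positive factors the \<open>m\<close>'s are the basis dual to the
  \<open>n\<close>'s, so the domain is the open cone spanned by \<open>n1\<close>,
  \<open>n2\<close>, \<open>n3\<close>. The integrand \<open>x \<bullet> n1 / norm x\<close> is the
  derivative of the norm in direction \<open>n1\<close>; integrating along \<open>n1\<close> first
  therefore leaves a plane integral over the sector of \<open>n2\<close> and
  \<open>n3\<close>.\<close>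

lemma cone_integral:
  fixes n1 n2 n3 m1 m2 m3 :: "real^3"
  assumes d: "n1 \<bullet> cross3 n2 n3 \<noteq> 0"
    and m1: "0 < n1 \<bullet> m1" "n2 \<bullet> m1 = 0" "n3 \<bullet> m1 = 0"
    and m2: "n1 \<bullet> m2 = 0" "0 < n2 \<bullet> m2" "n3 \<bullet> m2 = 0"
    and m3: "n1 \<bullet> m3 = 0" "n2 \<bullet> m3 = 0" "0 < n3 \<bullet> m3"
    and n: "\<And>t. (norm (n2 + t *\<^sub>R n3))^2 = k * ((1 + t)^2 + (u - t * v)^2)"
    and k: "0 < k" and uv: "0 < u + v"
  shows "(\<integral>x. indicator {x. 0 < x \<bullet> m1 \<and> 0 < x \<bullet> m2 \<and> 0 < x \<bullet> m3} x *
      (indicator (ball 0 1) x * (x \<bullet> n1 / norm x)) \<partial>lborel)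
    = \<bar>n1 \<bullet> cross3 n2 n3\<bar> * ((arctan u + arctan v) / (6 * k * (u + v)))"
proof -
  define C where "C = {x. 0 < x \<bullet> m1 \<and> 0 < x \<bullet> m2 \<and> 0 < x \<bullet> m3}"
  have C[measurable]: "C \<in> sets borel" unfolding C_def by measurable
  define F where "F = (\<lambda>x. indicator C x * (indicator (ball 0 1) x * (x \<bullet> n1 / norm x)) :: real)"
  have F: "integrable lborel F" unfolding F_def by (rule integrable_cone) (rule C)
  then have [measurable]: "F \<in> borel_measurable borel" by auto
  let ?Q = "lborel \<Otimes>\<^sub>M lborel :: (real \<times> real) measure"
  let ?P = "lborel \<Otimes>\<^sub>M ?Q :: (real \<times> real \<times> real) measure"
  let ?\<phi> = "cone_map n1 n2 n3"
  let ?d = "\<bar>n1 \<bullet> cross3 n2 n3\<bar>"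
  interpret Q: pair_sigma_finite "lborel :: real measure" ?Q
    unfolding lborel_prod by unfold_locales
  have "integrable (density (distr ?P borel ?\<phi>) (\<lambda>_. ennreal ?d)) F"
    using F by (simp only: lborel_cone_map[OF d, symmetric])
  then have FP: "integrable ?P (\<lambda>(s, y). F (?\<phi> (s, y)))"
    using d by (subst (asm) integrable_density) (auto simp: integrable_distr_eq case_prod_beta')
  have "integral\<^sup>L lborel F = integral\<^sup>L (density (distr ?P borel ?\<phi>) (\<lambda>_. ennreal ?d)) F"
    by (simp only: lborel_cone_map[OF d, symmetric])
  also have "\<dots> = ?d * integral\<^sup>L ?P (\<lambda>(s, y). F (?\<phi> (s, y)))"
    by (subst integral_density) (auto simp: integral_distr case_prod_beta')
  also have "integral\<^sup>L ?P (\<lambda>(s, y). F (?\<phi> (s, y))) = (\<integral>y. \<integral>s. F (?\<phi> (s, y)) \<partial>lborel \<partial>?Q)"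
    by (rule Q.integral_snd[OF FP, symmetric])
  also have "\<dots> = (\<integral>y. indicator ({0<..} \<times> {0<..}) y * max 0 (1 - norm (fst y *\<^sub>R n2 + snd y *\<^sub>R n3)) \<partial>?Q)"
  proof (rule Bochner_Integration.integral_cong[OF refl])
    fix y :: "real \<times> real"
    obtain a b where y: "y = (a, b)" by (cases y)
    have eq: "?\<phi> (s, y) = (a *\<^sub>R n2 + b *\<^sub>R n3) + s *\<^sub>R n1" for s
      by (simp add: y cone_map_def)
    have mem: "(a *\<^sub>R n2 + b *\<^sub>R n3) + s *\<^sub>R n1 \<in> C \<longleftrightarrow> 0 < s \<and> 0 < a \<and> 0 < b" for s
      using m1 m2 m3 by (auto simp: C_def inner_add_left zero_less_mult_iff)
    show "(\<integral>s. F (?\<phi> (s, y)) \<partial>lborel) =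
        indicator ({0<..} \<times> {0<..}) y * max 0 (1 - norm (fst y *\<^sub>R n2 + snd y *\<^sub>R n3))"
    proof (cases "0 < a \<and> 0 < b")
      case True
      have nz: "(a *\<^sub>R n2 + b *\<^sub>R n3) + s *\<^sub>R n1 \<noteq> 0" for s
      proof
        assume "(a *\<^sub>R n2 + b *\<^sub>R n3) + s *\<^sub>R n1 = 0"
        then have "((a *\<^sub>R n2 + b *\<^sub>R n3) + s *\<^sub>R n1) \<bullet> m2 = 0" by simp
        then show False using m2 True by (simp add: inner_add_left)
      qed
      have "(\<integral>s. F (?\<phi> (s, y)) \<partial>lborel) = (\<integral>s. indicator {0<..} s * (indicator (ball 0 1) ((a *\<^sub>R n2 + b *\<^sub>R n3) + s *\<^sub>R n1) *
         (((a *\<^sub>R n2 + b *\<^sub>R n3) + s *\<^sub>R n1) \<bullet> n1 / norm ((a *\<^sub>R n2 + b *\<^sub>R n3) + s *\<^sub>R n1))) \<partial>lborel)"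
        unfolding eq F_def using mem True by (intro Bochner_Integration.integral_cong refl) (simp add: indicator_def)
      also have "\<dots> = max 0 (1 - norm (a *\<^sub>R n2 + b *\<^sub>R n3))"
        using m1 by (intro ray_integral nz) auto
      finally show ?thesis using True by (simp add: y)
    next
      case False
      then have "F (?\<phi> (s, y)) = 0" for s unfolding eq F_def using mem[of s] by auto
      then have "(\<integral>s. F (?\<phi> (s, y)) \<partial>lborel) = 0" by simp
      moreover have "y \<notin> {0<..} \<times> {0<..}" using False by (simp add: y)
      ultimately show ?thesis by simp
    qed
  qed
  also have "\<dots> = enn2real (\<integral>\<^sup>+y. ennreal (indicator ({0<..} \<times> {0<..}) y * max 0 (1 - norm (fst y *\<^sub>R n2 + snd y *\<^sub>R n3))) \<partial>?Q)"
  proof (rule integral_eq_nn_integral)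
    have [measurable]: "({0<..} \<times> {0<..} :: (real \<times> real) set) \<in> sets ?Q" by (simp add: pair_measureI)
    show "(\<lambda>y. indicator ({0<..} \<times> {0<..}) y * max 0 (1 - norm (fst y *\<^sub>R n2 + snd y *\<^sub>R n3))) \<in> borel_measurable ?Q"
      by measurable
  qed simp
  also have "(\<integral>\<^sup>+y. ennreal (indicator ({0<..} \<times> {0<..}) y * max 0 (1 - norm (fst y *\<^sub>R n2 + snd y *\<^sub>R n3))) \<partial>?Q)
     = (\<integral>\<^sup>+y. indicator ({0<..} \<times> {0<..}) y * ennreal (max 0 (1 - norm (fst y *\<^sub>R n2 + snd y *\<^sub>R n3))) \<partial>?Q)"
    by (intro nn_integral_cong) (simp add: indicator_def)
  also have "\<dots> = (\<integral>\<^sup>+t. indicator {0<..} t * ennreal (1 / (6 * (norm (n2 + t *\<^sub>R n3))^2)) \<partial>lborel)"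
  proof (rule sector_integral)
    fix t
    have "(n2 + t *\<^sub>R n3) \<bullet> m2 > 0" using m2 by (simp add: inner_add_left)
    then show "n2 + t *\<^sub>R n3 \<noteq> 0" by auto
  qed
  also have "\<dots> = ennreal ((arctan u + arctan v) / (6 * k * (u + v)))"
    by (rule sector_arctan[OF n k uv])
  also have "enn2real \<dots> = (arctan u + arctan v) / (6 * k * (u + v))"
  proof -
    have "arctan (- v) < arctan u" using uv by (simp only: arctan_less_iff)
    then have "0 < arctan u + arctan v" by (simp add: arctan_minus)
    then show ?thesis using k uv by (intro enn2real_ennreal divide_nonneg_nonneg mult_nonneg_nonneg) auto
  qed
  finally show ?thesis unfolding F_def C_def .
qed

section \<open>The width of an inscribed simplex\<close>

lemma vol3_expand:
  "vol3 p q r *\<^sub>R w = (w \<bullet> p) *\<^sub>R cross3 q r + (w \<bullet> q) *\<^sub>R cross3 r p + (w \<bullet> r) *\<^sub>R cross3 p q"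
  by (simp add: cross3_simps forall_3)

lemma inner_basis_eq_0:
  assumes "vol3 p q r \<noteq> 0" "w \<bullet> p = 0" "w \<bullet> q = 0" "w \<bullet> r = 0"
  shows "w = 0"
  using vol3_expand[of p q r w] assms by simp

text \<open>The vertex of the polar body that corresponds to the face; by
  \<open>face_dual_inner\<close> it has inner product \<open>1\<close> with all three vertices. Its
  direction is that of the spherical circumcentre, up to sign.\<close>

definition face_dual :: "real^3 \<Rightarrow> real^3 \<Rightarrow> real^3 \<Rightarrow> real^3" where
  "face_dual p q r = (1 / vol3 p q r) *\<^sub>R (cross3 p q + cross3 q r + cross3 r p)"

lemma face_dual_rotate: "face_dual q r p = face_dual p q r"
  by (simp add: face_dual_def vol3_rotate add_ac)

lemma face_dual_inner:
  assumes "vol3 p q r \<noteq> 0"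
  shows "face_dual p q r \<bullet> p = 1" "face_dual p q r \<bullet> q = 1" "face_dual p q r \<bullet> r = 1"
proof -
  have "(cross3 p q + cross3 q r + cross3 r p) \<bullet> p = vol3 p q r" 
    "(cross3 p q + cross3 q r + cross3 r p) \<bullet> q = vol3 p q r"
    "(cross3 p q + cross3 q r + cross3 r p) \<bullet> r = vol3 p q r"
    by (simp_all add: cross3_simps)
  then show "face_dual p q r \<bullet> p = 1" "face_dual p q r \<bullet> q = 1" "face_dual p q r \<bullet> r = 1"
    using assms by (simp_all add: face_dual_def)
qed

lemma face_dual_opposite:
  assumes V: "vol3 p q r > 0" "vol3 p r l > 0" "vol3 p l q > 0" "vol3 r q l > 0"
  shows "face_dual p r l \<bullet> q < 0"
proof -
  have "(cross3 p r + cross3 r l + cross3 l p) \<bullet> q = - (vol3 p q r + vol3 p l q + vol3 r q l)"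
    by (simp add: cross3_simps)
  then show ?thesis using V by (simp add: face_dual_def divide_neg_pos)
qed

text \<open>An orthogonal decomposition adapted to the edge \<open>p q\<close>. The component along
  \<open>p + q\<close> is the same for both faces at this edge; the component along
  \<open>cross3 p q\<close> carries the signed distance of the circumcentre from the
  midpoint.\<close>

lemma face_dual_decomp:
  assumes u: "norm p = 1" "norm q = 1" "norm r = 1" and d: "vol3 p q r > 0"
  shows "face_dual p q r = (1 / (1 + p \<bullet> q)) *\<^sub>R (p + q + (apex_inner p q r / vol3 p q r) *\<^sub>R cross3 p q)"
proof -
  let ?d = "vol3 p q r" and ?g = "1 + p \<bullet> q"
  have g: "0 < ?g" using edge_fun_half_arc(3)[OF u d] by simp
  have pp: "p \<bullet> p = 1" "q \<bullet> q = 1" using u by (simp_all add: dot_square_norm)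
  have "?d *\<^sub>R p + ?d *\<^sub>R q = ?g *\<^sub>R (cross3 q r + cross3 r p) + (p \<bullet> r + q \<bullet> r) *\<^sub>R cross3 p q"
    unfolding vol3_expand[of p q r p] vol3_expand[of p q r q] pp
    by (simp add: algebra_simps inner_commute)
  then have "?g *\<^sub>R (cross3 p q + cross3 q r + cross3 r p) = ?d *\<^sub>R (p + q) + apex_inner p q r *\<^sub>R cross3 p q"
    unfolding apex_inner_unit[OF u(3)] by (simp add: algebra_simps)
  then have "(1 / (?d * ?g)) *\<^sub>R (?g *\<^sub>R (cross3 p q + cross3 q r + cross3 r p))
     = (1 / (?d * ?g)) *\<^sub>R (?d *\<^sub>R (p + q) + apex_inner p q r *\<^sub>R cross3 p q)" by simp
  then show ?thesis using g d by (simp add: face_dual_def scaleR_add_right)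
qed

text \<open>The interior of the normal cone of the simplex at \<open>p\<close>, where
  \<open>p\<close> is the unique maximizer of \<open>x\<close>. The omitted boundaries are null
  sets.\<close>

definition vertex_cone :: "real^3 \<Rightarrow> real^3 \<Rightarrow> real^3 \<Rightarrow> real^3 \<Rightarrow> (real^3) set" where
  "vertex_cone p q r l = {x. 0 < x \<bullet> (p - q) \<and> 0 < x \<bullet> (p - r) \<and> 0 < x \<bullet> (p - l)}"

lemma vertex_cone_sets [measurable]: "vertex_cone p q r l \<in> sets borel"
  unfolding vertex_cone_def by measurable

definition cone_moment :: "(real^3) set \<Rightarrow> real^3 \<Rightarrow> real" where
  "cone_moment C n = (\<integral>x. indicator C x * (indicator (ball 0 1) x * (x \<bullet> n / norm x)) \<partial>lborel)"

text \<open>The dual of the face opposite \<open>q\<close> serves as the ray direction of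
  \<open>cone_integral\<close>. What remains is the sector between the duals of the two faces at the
  edge \<open>p q\<close>, and its opening is the exterior angle at that edge.\<close>

lemma cone_moment_face_dual:
  assumes u: "norm p = 1" "norm q = 1" "norm r = 1" "norm l = 1"
    and V: "vol3 p q r > 0" "vol3 p r l > 0" "vol3 p l q > 0" "vol3 r q l > 0"
    and c: "0 < a" "0 < b" "0 < c" "0 < e" "a *\<^sub>R p + b *\<^sub>R q + c *\<^sub>R r + e *\<^sub>R l = 0"
  shows "cone_moment (vertex_cone p q r l) (face_dual p r l)
    = (1 - face_dual p r l \<bullet> q) * (half_arc p q r + half_arc q p l) / (12 * half_len p q)"
proof -
  define n1 n2 n3 where "n1 = face_dual p r l" "n2 = face_dual p q r" "n3 = face_dual q p l"
  have V3': "vol3 q p l > 0" using V(3) by (metis vol3_rotate)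
  have n3: "n3 = face_dual p l q" by (simp add: n1_n2_n3_def face_dual_rotate[of p l q, symmetric])
  define g where "g = 1 + p \<bullet> q"
  define s where "s = half_len p q"
  note E = edge_fun_half_arc[OF u(1-3) V(1)]
  have g: "0 < g" using E(3) by (simp add: g_def)
  have s: "0 < s" using E(2) by (simp add: s_def)
  have s2: "s^2 = (2 - g) / 2"
  proof -
    have "0 \<le> (1 - p \<bullet> q) / 2" using E(2) by (simp add: half_len_def)
    then show ?thesis by (simp add: s_def half_len_def g_def)
  qed
  define x where "x = apex_inner p q r / vol3 p q r"
  define y where "y = apex_inner q p l / vol3 q p l"
  define z where "z = cross3 p q"
  have N2: "n2 = (1 / g) *\<^sub>R (p + q + x *\<^sub>R z)"
    unfolding n1_n2_n3_def g_def x_def z_def by (rule face_dual_decomp[OF u(1-3) V(1)])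
  have N3: "n3 = (1 / g) *\<^sub>R (p + q - y *\<^sub>R z)"
    unfolding n1_n2_n3_def face_dual_decomp[OF u(2,1,4) V3'] g_def y_def z_def
    by (simp add: inner_commute add.commute cross_skew[of q p])
  have pp: "p \<bullet> p = 1" "q \<bullet> q = 1" using u by (simp_all add: dot_square_norm)
  have pz: "p \<bullet> z = 0" "q \<bullet> z = 0" "z \<bullet> p = 0" "z \<bullet> q = 0" by (simp_all add: z_def dot_cross_self)
  have zz: "z \<bullet> z = g * (2 - g)"
    by (simp add: z_def cross3_inner_cross3 pp g_def inner_commute algebra_simps)
  have pq2: "(p + q) \<bullet> (p + q) = 2 * g"
    by (simp add: inner_add_left inner_add_right pp inner_commute g_def)
  have nrm: "(norm (n2 + t *\<^sub>R n3))^2 = (2 / g) * ((1 + t)^2 + (s * x - t * (s * y))^2)" for t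
  proof -
    have "n2 + t *\<^sub>R n3 = (1 / g) *\<^sub>R ((1 + t) *\<^sub>R (p + q) + (x - t * y) *\<^sub>R z)"
      unfolding N2 N3 by (simp add: algebra_simps)
    then have "(norm (n2 + t *\<^sub>R n3))^2 = (1 / g)^2 * (norm ((1 + t) *\<^sub>R (p + q) + (x - t * y) *\<^sub>R z))^2"
      using g by (simp only: norm_scaleR power_mult_distrib) simp
    also have "(norm ((1 + t) *\<^sub>R (p + q) + (x - t * y) *\<^sub>R z))^2
        = (1 + t)^2 * ((p + q) \<bullet> (p + q)) + (x - t * y)^2 * (z \<bullet> z)"
      unfolding dot_square_norm[symmetric]
      by (simp add: inner_add_left inner_add_right pz power2_eq_square algebra_simps)
    also have "(1 / g)^2 * \<dots> = (2 / g) * ((1 + t)^2 + (x - t * y)^2 * ((2 - g) / 2))"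
      unfolding pq2 zz using g by (simp add: field_simps power2_eq_square)
    also have "(x - t * y)^2 * ((2 - g) / 2) = (s * x - t * (s * y))^2"
      unfolding s2[symmetric] by (simp add: power2_eq_square algebra_simps)
    finally show ?thesis .
  qed
  \<comment> \<open>Both duals are constant on the edge, so their cross product is parallel to
    \<open>q - p\<close>. This reduces the determinant to \<open>1 - n1 \<bullet> q\<close>.\<close>
  have cr: "cross3 n2 n3 = ((x + y) / g) *\<^sub>R (q - p)"
  proof -
    have "cross3 (p + q + x *\<^sub>R z) (p + q - y *\<^sub>R z) = (x + y) *\<^sub>R cross3 z (p + q)"
      by (simp add: cross3_simps forall_3)
    also have "cross3 z (p + q) = (p \<bullet> p + p \<bullet> q) *\<^sub>R q - (p \<bullet> q + q \<bullet> q) *\<^sub>R p"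
      unfolding z_def by (simp add: cross3_simps forall_3)
    also have "\<dots> = g *\<^sub>R (q - p)" by (simp add: pp g_def algebra_simps)
    finally have "cross3 (p + q + x *\<^sub>R z) (p + q - y *\<^sub>R z) = (x + y) *\<^sub>R (g *\<^sub>R (q - p))" .
    then show ?thesis unfolding N2 N3 cross_mult_left cross_mult_right using g by simp
  qed
  have arcs: "half_arc p q r = arctan (s * x)" "half_arc q p l = arctan (s * y)"
    by (simp_all add: half_arc_def s_def x_def y_def half_len_def inner_commute)
  have "0 < arctan (s * x) + arctan (s * y)"
    using half_arc_add_pos[OF u V(1) V3' c] by (simp add: arcs)
  then have "arctan (- (s * y)) < arctan (s * x)" by (simp add: arctan_minus)
  then have sxy: "0 < s * x + s * y" by (simp only: arctan_less_iff)
  then have xy: "0 < x + y" using s by (metis distrib_left zero_less_mult_pos)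
  have op: "face_dual p r l \<bullet> q < 0" "face_dual p l q \<bullet> r < 0" "face_dual p q r \<bullet> l < 0"
    using face_dual_opposite[of p q r l] face_dual_opposite[of p r l q] face_dual_opposite[of p l q r] V
    by (simp_all add: vol3_rotate) (metis vol3_rotate)+
  have in1: "n1 \<bullet> p = 1" "n1 \<bullet> r = 1" "n1 \<bullet> l = 1" "n2 \<bullet> p = 1" "n2 \<bullet> q = 1" "n2 \<bullet> r = 1"
    "n3 \<bullet> p = 1" "n3 \<bullet> l = 1" "n3 \<bullet> q = 1"
    using V face_dual_inner[of p r l] face_dual_inner[of p q r] face_dual_inner[of p l q]
    by (auto simp: n1_n2_n3_def(1,2) n3)
  have det: "n1 \<bullet> cross3 n2 n3 = - ((x + y) / g * (1 - n1 \<bullet> q))"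
  proof -
    have "w * (m - 1) = - (w * (1 - m))" for w m :: real by (simp add: algebra_simps)
    then show ?thesis unfolding cr by (simp only: inner_scaleR_right inner_diff_right in1)
  qed
  have op': "n1 \<bullet> q < 0" "n3 \<bullet> r < 0" "n2 \<bullet> l < 0" using op by (simp_all add: n1_n2_n3_def(1,2) n3)
  have pos: "0 < (x + y) / g * (1 - n1 \<bullet> q)" using xy g op' by simp
  have "cone_moment {z. 0 < z \<bullet> (p - q) \<and> 0 < z \<bullet> (p - l) \<and> 0 < z \<bullet> (p - r)} n1
    = \<bar>n1 \<bullet> cross3 n2 n3\<bar> * ((arctan (s * x) + arctan (s * y)) / (6 * (2 / g) * (s * x + s * y)))"
    unfolding cone_moment_def
    by (rule cone_integral) (use nrm sxy g det pos op' in1 in \<open>auto simp: inner_diff_right\<close>)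
  also have "\<bar>n1 \<bullet> cross3 n2 n3\<bar> = (x + y) / g * (1 - n1 \<bullet> q)"
    unfolding det using pos by (simp only: abs_minus_cancel abs_of_pos)
  also have "(x + y) / g * (1 - n1 \<bullet> q) * ((arctan (s * x) + arctan (s * y)) / (6 * (2 / g) * (s * x + s * y)))
    = (1 - n1 \<bullet> q) * (arctan (s * x) + arctan (s * y)) / (12 * s)"
  proof -
    have "w / g * m * (b / (6 * (2 / g) * (s * w))) = m * b / (12 * s)" if "w \<noteq> 0" for w m b
      using that g s by (simp add: field_simps)
    then show ?thesis unfolding distrib_left[symmetric] using xy by (metis less_irrefl)
  qed
  also have "{z. 0 < z \<bullet> (p - q) \<and> 0 < z \<bullet> (p - l) \<and> 0 < z \<bullet> (p - r)} = vertex_cone p q r l"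
    by (auto simp: vertex_cone_def)
  finally show ?thesis unfolding arcs s_def[symmetric] n1_n2_n3_def(1) .
qed

text \<open>The moment is linear in its direction, and \<open>p\<close> is a combination of the
  three duals spanning its normal cone. Each coefficient contains a factor
  \<open>1 - p \<bullet> q = 2 * (half_len p q)^2\<close>, which moves the half length from the
  denominator to the numerator.\<close>

lemma cone_moment_vertex:
  assumes u: "norm p = 1" "norm q = 1" "norm r = 1" "norm l = 1"
    and V: "vol3 p q r > 0" "vol3 p r l > 0" "vol3 p l q > 0" "vol3 r q l > 0"
    and c: "0 < a" "0 < b" "0 < c" "0 < e" "a *\<^sub>R p + b *\<^sub>R q + c *\<^sub>R r + e *\<^sub>R l = 0"
  shows "cone_moment (vertex_cone p q r l) p
    = (half_len p q * (half_arc p q r + half_arc q p l)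
     + half_len p r * (half_arc p r l + half_arc r p q)
     + half_len p l * (half_arc p l q + half_arc l p r)) / 6"
proof -
  let ?C = "vertex_cone p q r l"
  define n1 n2 n3 where "n1 = face_dual p r l" "n2 = face_dual p l q" "n3 = face_dual p q r"
  have V4: "vol3 l r q > 0" "vol3 q l r > 0" using V(4) by (metis vol3_rotate)+
  have c2: "a *\<^sub>R p + c *\<^sub>R r + e *\<^sub>R l + b *\<^sub>R q = 0" "a *\<^sub>R p + e *\<^sub>R l + b *\<^sub>R q + c *\<^sub>R r = 0"
    using c(5) by (simp_all add: algebra_simps)
  note M1 = cone_moment_face_dual[OF u V c]
  note M2 = cone_moment_face_dual[OF u(1,3,4,2) V(2,3,1) V4(1) c(1,3,4,2) c2(1)]
  note M3 = cone_moment_face_dual[OF u(1,4,2,3) V(3,1,2) V4(2) c(1,4,2,3) c2(2)]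
  have op: "n1 \<bullet> q < 0" "n2 \<bullet> r < 0" "n3 \<bullet> l < 0"
    using face_dual_opposite[OF V] face_dual_opposite[OF V(2,3,1) V4(1)] face_dual_opposite[OF V(3,1,2) V4(2)]
    by (simp_all add: n1_n2_n3_def)
  have in1: "n1 \<bullet> p = 1" "n1 \<bullet> r = 1" "n1 \<bullet> l = 1" "n2 \<bullet> p = 1" "n2 \<bullet> l = 1" "n2 \<bullet> q = 1"
    "n3 \<bullet> p = 1" "n3 \<bullet> q = 1" "n3 \<bullet> r = 1"
    using V face_dual_inner[of p r l] face_dual_inner[of p q r] face_dual_inner[of p l q]
    by (auto simp: n1_n2_n3_def)
  have pp: "p \<bullet> p = 1" using u by (simp add: dot_square_norm)
  \<comment> \<open>Each dual is orthogonal to two of the differences \<open>p - q\<close>,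
    \<open>p - r\<close>, \<open>p - l\<close>, so pairing with one difference isolates one
    coefficient.\<close>
  define c1 c2 c3 where "c1 = (1 - p \<bullet> q) / (1 - n1 \<bullet> q)" "c2 = (1 - p \<bullet> r) / (1 - n2 \<bullet> r)" "c3 = (1 - p \<bullet> l) / (1 - n3 \<bullet> l)"
  have cc: "c1 * (1 - n1 \<bullet> q) = 1 - p \<bullet> q" "c2 * (1 - n2 \<bullet> r) = 1 - p \<bullet> r" "c3 * (1 - n3 \<bullet> l) = 1 - p \<bullet> l"
    using op by (simp_all add: c1_c2_c3_def)
  have "p - (c1 *\<^sub>R n1 + c2 *\<^sub>R n2 + c3 *\<^sub>R n3) = 0"
  proof (rule inner_basis_eq_0[of "p - q" "p - r" "p - l"])
    have "vol3 (p - q) (p - r) (p - l) = vol3 p q r + vol3 p r l + vol3 p l q + vol3 r q l"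
      by (simp add: cross3_simps)
    then show "vol3 (p - q) (p - r) (p - l) \<noteq> 0" using V by simp
  qed (use cc in \<open>simp_all add: inner_diff_left inner_diff_right inner_add_left in1 pp algebra_simps\<close>)
  then have p: "p = c1 *\<^sub>R n1 + c2 *\<^sub>R n2 + c3 *\<^sub>R n3" by simp
  define G where "G = (\<lambda>n x. indicator ?C x * (indicator (ball 0 1) x * (x \<bullet> n / norm x)) :: real)"
  have I: "integrable lborel (G n)" for n
    unfolding G_def by (rule integrable_cone) simp
  have G: "cone_moment ?C n = integral\<^sup>L lborel (G n)" for n
    by (simp add: cone_moment_def G_def)
  have "G p x = c1 * G n1 x + c2 * G n2 x + c3 * G n3 x" for x
  proof -
    have "x \<bullet> p = c1 * (x \<bullet> n1) + c2 * (x \<bullet> n2) + c3 * (x \<bullet> n3)"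
      by (subst p) (simp add: inner_add_right)
    then show ?thesis by (simp add: G_def add_divide_distrib algebra_simps)
  qed
  then have "cone_moment ?C p = (\<integral>x. c1 * G n1 x + c2 * G n2 x + c3 * G n3 x \<partial>lborel)"
    unfolding G by (intro Bochner_Integration.integral_cong refl)
  also have "\<dots> = c1 * cone_moment ?C n1 + c2 * cone_moment ?C n2 + c3 * cone_moment ?C n3"
    unfolding G by (simp add: I)
  finally have main: "cone_moment ?C p = c1 * cone_moment ?C n1 + c2 * cone_moment ?C n2 + c3 * cone_moment ?C n3" .
  have "c1 * cone_moment ?C n1 = half_len p q * (half_arc p q r + half_arc q p l) / 6"
    "c2 * cone_moment ?C n2 = half_len p r * (half_arc p r l + half_arc r p q) / 6"
    "c3 * cone_moment ?C n3 = half_len p l * (half_arc p l q + half_arc l p r) / 6"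
  proof -
    have *: "(1 - p \<bullet> z) / (1 - m) * ((1 - m) * b / (12 * half_len p z)) = half_len p z * b / 6"
      if "m < 0" "0 < half_len p z" for z m b
    proof -
      have "1 - p \<bullet> z = 2 * (half_len p z * half_len p z)"
      proof -
        have "0 < 1 - p \<bullet> z" using that(2) by (simp add: half_len_def)
        then show ?thesis by (simp add: half_len_def)
      qed
      moreover have "2 * (w * w) / (1 - m) * ((1 - m) * b / (12 * w)) = w * b / 6" if "0 < w" for w
        using that \<open>m < 0\<close> by (simp add: field_simps)
      ultimately show ?thesis using that(2) by (simp only:)
    qed
    have h: "0 < half_len p q" "0 < half_len p r" "0 < half_len p l"
      using edge_fun_half_arc(2)[OF u(1,2,3) V(1)] edge_fun_half_arc(2)[OF u(1,3,4) V(2)] edge_fun_half_arc(2)[OF u(1,4,2) V(3)]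
      by auto
    show "c1 * cone_moment ?C n1 = half_len p q * (half_arc p q r + half_arc q p l) / 6"
      using *[OF op(1) h(1)] M1 by (simp only: c1_c2_c3_def n1_n2_n3_def)
    have "vertex_cone p r l q = ?C" "vertex_cone p l q r = ?C" by (auto simp: vertex_cone_def)
    then show "c2 * cone_moment ?C n2 = half_len p r * (half_arc p r l + half_arc r p q) / 6"
      "c3 * cone_moment ?C n3 = half_len p l * (half_arc p l q + half_arc l p r) / 6"
      using *[OF op(2) h(2)] M2 *[OF op(3) h(3)] M3 by (simp_all only: c1_c2_c3_def n1_n2_n3_def)
  qed
  then show ?thesis unfolding main by (simp add: add_divide_distrib)
qed

section \<open>Decomposition of the width over the normal cones\<close>

definition max4 :: "real^3 \<Rightarrow> real^3 \<Rightarrow> real^3 \<Rightarrow> real^3 \<Rightarrow> real^3 \<Rightarrow> real" where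
  "max4 p q r l x = max (max (x \<bullet> p) (x \<bullet> q)) (max (x \<bullet> r) (x \<bullet> l))"

text \<open>The support function is positively homogeneous, so \<open>max4\<close> divided by
  \<open>norm x\<close> is its value at the radial projection of \<open>x\<close>. Integrating this
  over the ball replaces integration over the sphere.\<close>

definition ball_width :: "real^3 \<Rightarrow> real^3 \<Rightarrow> real^3 \<Rightarrow> real^3 \<Rightarrow> real" where
  "ball_width p q r l = (\<integral>x. indicator (ball 0 1) x * (max4 p q r l x / norm x) \<partial>lborel)"

lemma AE_inner_neq_0:
  fixes v :: "'a::euclidean_space"
  assumes "v \<noteq> 0" shows "AE x in lborel. x \<bullet> v \<noteq> 0"
proof -
  have "negligible {x. v \<bullet> x = 0}" using assms by (intro negligible_hyperplane) auto
  then have "{x. v \<bullet> x = 0} \<in> null_sets lebesgue" by (simp add: negligible_iff_null_sets)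
  moreover have "{x. v \<bullet> x = 0} \<in> sets lborel"
    using closed_hyperplane[of v 0] by simp
  ultimately have "{x. v \<bullet> x = 0} \<in> null_sets lborel"
    by (simp add: null_sets_completion_iff)
  then have "AE x in lborel. x \<notin> {x. v \<bullet> x = 0}" by (rule AE_not_in)
  then show ?thesis by (simp add: inner_commute)
qed

lemma ball_width_eq_cone_moments:
  assumes "p \<noteq> q" "p \<noteq> r" "p \<noteq> l" "q \<noteq> r" "q \<noteq> l" "r \<noteq> l"
  shows "ball_width p q r l = cone_moment (vertex_cone p q r l) p + cone_moment (vertex_cone q r p l) q
    + cone_moment (vertex_cone r p q l) r + cone_moment (vertex_cone l q p r) l"
proof -
  define f where "f = (\<lambda>C n (x::real^3). indicator C x * (indicator (ball 0 1) x * (x \<bullet> n / norm x)) :: real)"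
  have I: "integrable lborel (f C n)" if "C \<in> sets borel" for C and n :: "real^3"
    unfolding f_def using that by (rule integrable_cone)
  have [measurable]: "f C n \<in> borel_measurable borel" if "C \<in> sets borel" for C and n :: "real^3"
    using I[OF that] by auto
  have [measurable]: "(ball 0 1 :: (real^3) set) \<in> sets borel" by simp
  have "ball_width p q r l = (\<integral>x. f (vertex_cone p q r l) p x + f (vertex_cone q r p l) q x
    + f (vertex_cone r p q l) r x + f (vertex_cone l q p r) l x \<partial>lborel)"
    unfolding ball_width_def
  proof (rule integral_cong_AE)
    have real: "max (max a b) (max c d) * m = of_bool (b < a \<and> c < a \<and> d < a) * (a * m) + of_bool (c < b \<and> a < b \<and> d < b) * (b * m)
       + of_bool (a < c \<and> b < c \<and> d < c) * (c * m) + of_bool (b < d \<and> a < d \<and> c < d) * (d * m)"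
      if "a \<noteq> b" "a \<noteq> c" "a \<noteq> d" "b \<noteq> c" "b \<noteq> d" "c \<noteq> d" for a b c d m :: real
      using that by (auto simp: max_def of_bool_def)
    have "AE x in lborel. x \<bullet> (p - q) \<noteq> 0" "AE x in lborel. x \<bullet> (p - r) \<noteq> 0" "AE x in lborel. x \<bullet> (p - l) \<noteq> 0"
      "AE x in lborel. x \<bullet> (q - r) \<noteq> 0" "AE x in lborel. x \<bullet> (q - l) \<noteq> 0" "AE x in lborel. x \<bullet> (r - l) \<noteq> 0"
      using assms by (auto intro!: AE_inner_neq_0)
    then show "AE x in lborel. indicator (ball 0 1) x * (max4 p q r l x / norm x) = f (vertex_cone p q r l) p x
      + f (vertex_cone q r p l) q x + f (vertex_cone r p q l) r x + f (vertex_cone l q p r) l x"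
    proof eventually_elim
      case (elim x)
      have "indicator (ball 0 1) x * (max4 p q r l x / norm x) = max4 p q r l x * (indicator (ball 0 1) x / norm x)"
        by simp
      also have "\<dots> = of_bool (x \<bullet> q < x \<bullet> p \<and> x \<bullet> r < x \<bullet> p \<and> x \<bullet> l < x \<bullet> p) * (x \<bullet> p * (indicator (ball 0 1) x / norm x))
         + of_bool (x \<bullet> r < x \<bullet> q \<and> x \<bullet> p < x \<bullet> q \<and> x \<bullet> l < x \<bullet> q) * (x \<bullet> q * (indicator (ball 0 1) x / norm x))
         + of_bool (x \<bullet> p < x \<bullet> r \<and> x \<bullet> q < x \<bullet> r \<and> x \<bullet> l < x \<bullet> r) * (x \<bullet> r * (indicator (ball 0 1) x / norm x))
         + of_bool (x \<bullet> q < x \<bullet> l \<and> x \<bullet> p < x \<bullet> l \<and> x \<bullet> r < x \<bullet> l) * (x \<bullet> l * (indicator (ball 0 1) x / norm x))"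
        unfolding max4_def by (rule real) (use elim in \<open>simp_all add: inner_diff_right\<close>)
      also have "\<dots> = f (vertex_cone p q r l) p x + f (vertex_cone q r p l) q x
          + f (vertex_cone r p q l) r x + f (vertex_cone l q p r) l x"
        by (simp add: f_def vertex_cone_def indicator_def inner_diff_right of_bool_def)
      finally show ?case .
    qed
  qed (auto simp: max4_def)
  also have "\<dots> = integral\<^sup>L lborel (f (vertex_cone p q r l) p) + integral\<^sup>L lborel (f (vertex_cone q r p l) q)
     + integral\<^sup>L lborel (f (vertex_cone r p q l) r) + integral\<^sup>L lborel (f (vertex_cone l q p r) l)"
    by (simp add: I)
  finally show ?thesis by (simp add: f_def cone_moment_def)
qed

text \<open>Every edge contributes to the normal cones of both of its ends, which turns the factor
  \<open>1/6\<close> into \<open>1/3\<close>.\<close>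

lemma ball_width_formula:
  assumes u: "norm p = 1" "norm q = 1" "norm r = 1" "norm l = 1"
    and c: "0 < a" "0 < b" "0 < c" "0 < e" "a *\<^sub>R p + b *\<^sub>R q + c *\<^sub>R r + e *\<^sub>R l = 0"
    and d: "vol3 p q r > 0"
  shows "ball_width p q r l = arc_sum p q r l / 3"
proof -
  note d' = vol3_dependent[OF c d]
  have rot: "vol3 q r p > 0" "vol3 r p q > 0" "vol3 p l q > 0" "vol3 l q p > 0" "vol3 q l r > 0"
    "vol3 l r q > 0" "vol3 r l p > 0" "vol3 l p r > 0"
    using d d' by (metis vol3_rotate)+
  have cs: "b *\<^sub>R q + c *\<^sub>R r + a *\<^sub>R p + e *\<^sub>R l = 0" "c *\<^sub>R r + a *\<^sub>R p + b *\<^sub>R q + e *\<^sub>R l = 0"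
    "e *\<^sub>R l + b *\<^sub>R q + a *\<^sub>R p + c *\<^sub>R r = 0"
    using c(5) by (simp_all add: algebra_simps)
  note P = cone_moment_vertex[OF u(1,2,3,4) d d'(3) rot(3) d'(2) c(1,2,3,4) c(5)]
  note Q = cone_moment_vertex[OF u(2,3,1,4) rot(1) d'(1) rot(5) d'(3) c(2,3,1,4) cs(1)]
  note R = cone_moment_vertex[OF u(3,1,2,4) rot(2) d'(2) rot(7) d'(1) c(3,1,2,4) cs(2)]
  note L = cone_moment_vertex[OF u(4,2,1,3) rot(4) rot(8) rot(6) d c(4,2,1,3) cs(3)]
  have ne: "p \<noteq> q" "p \<noteq> r" "p \<noteq> l" "q \<noteq> r" "q \<noteq> l" "r \<noteq> l"
    using vol3_distinct[of p q r] vol3_distinct[of p r l] vol3_distinct[of r q l] d d' by auto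
  have h: "half_len q p = half_len p q" "half_len r p = half_len p r" "half_len l p = half_len p l"
    "half_len r q = half_len q r" "half_len l q = half_len q l" "half_len l r = half_len r l"
    by (simp_all add: half_len_def inner_commute)
  show ?thesis
    unfolding ball_width_eq_cone_moments[OF ne] P Q R L arc_sum_def arc_term_def h
    by (simp add: field_simps)
qed

section \<open>Reduction to inscribed simplices\<close>

lemma vol3_neq_0_if_independent:
  assumes "independent {a, b, c}" "card {a, b, c} = 3"
  shows "vol3 a b c \<noteq> 0"
proof -
  define A where "A = (vector [a, b, c] :: real^3^3)"
  have "rows A = {a, b, c}"
  proof -
    have "rows A = (\<lambda>i. A $ i) ` UNIV" by (auto simp: rows_def row_def vec_lambda_eta image_def)
    then show ?thesis unfolding UNIV_3 by (simp add: A_def)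
  qed
  then have "rank A = 3"
    using assms by (simp add: row_rank_def dim_eq_card_independent)
  then have "inj ((*v) A)" using full_rank_injective[of A] by simp
  then have "det A \<noteq> 0"
    using det_nz_iff_inj[of "(*v) A"] by (simp add: matrix_of_matrix_vector_mul)
  then show ?thesis by (simp add: dot_cross_det A_def)
qed

lemma simplex3_vertices:
  fixes T :: "(real^3) set"
  assumes "3 simplex T"
  obtains p q r l where "T = convex hull {p, q, r, l}" "vol3 (p - q) (p - r) (p - l) \<noteq> 0"
proof -
  obtain C where C: "finite C" "\<not> affine_dependent C" "int (card C) = 3 + 1" "T = convex hull C"
    using assms unfolding simplex by blast
  then have "card C = Suc 3" by simp
  then obtain p D where D: "C = insert p D" "p \<notin> D" "card D = 3" by (metis card_eq_SucD)
  then obtain q r l where q: "D = {q, r, l}" "q \<noteq> r" "r \<noteq> l" "q \<noteq> l" using card_3_iff by metis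
  have "independent ((\<lambda>x. - p + x) ` D)"
    using C(2) affine_dependent_iff_dependent[OF D(2)] D(1) by simp
  then have "independent {q - p, r - p, l - p}" by (simp add: q)
  moreover have "card {q - p, r - p, l - p} = 3" using q by simp
  ultimately have "vol3 (q - p) (r - p) (l - p) \<noteq> 0" by (rule vol3_neq_0_if_independent)
  moreover have "vol3 (q - p) (r - p) (l - p) = - vol3 (p - q) (p - r) (p - l)"
    by (simp add: cross3_simps)
  ultimately show ?thesis using that[of p q r l] C(4) D(1) q(1) by auto
qed

section \<open>From the measure on the sphere to the ball\<close>

definition ball_volume :: real where "ball_volume = measure lborel (ball 0 1 :: (real^3) set)"

lemma ball_volume_pos: "0 < ball_volume"
proof -
  have "emeasure lborel (ball 0 1 :: (real^3) set) > 0"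
  proof (rule ccontr)
    assume "\<not> ?thesis"
    then have "ball 0 1 \<in> null_sets (lborel :: (real^3) measure)" by (auto intro!: null_setsI)
    then show False using open_not_negligible[of "ball (0::real^3) 1"]
      by (auto simp: negligible_iff_null_sets null_sets_completion_iff)
  qed
  moreover have "emeasure lborel (ball 0 1 :: (real^3) set) < \<infinity>" by (rule emeasure_lborel_ball_finite)
  ultimately show ?thesis
    by (simp add: ball_volume_def measure_def enn2real_positive_iff)
qed

lemma support_fun_hull4:
  "support_fun (convex hull {p, q, r, l}) u = max4 p q r l u"
proof -
  let ?m = "max4 p q r l u"
  have "(SUP x\<in>convex hull {p, q, r, l}. u \<bullet> x) = ?m"
  proof (rule cSup_eq_maximum)
    have "?m \<in> (\<lambda>x. u \<bullet> x) ` {p, q, r, l}"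
      by (auto simp: max4_def max_def)
    moreover have "{p, q, r, l} \<subseteq> convex hull {p, q, r, l}" by (rule hull_subset)
    ultimately show "?m \<in> (\<lambda>x. u \<bullet> x) ` (convex hull {p, q, r, l})" by blast
  next
    fix y assume "y \<in> (\<lambda>x. u \<bullet> x) ` (convex hull {p, q, r, l})"
    then obtain x where x: "x \<in> convex hull {p, q, r, l}" "y = u \<bullet> x" by auto
    have "convex hull {p, q, r, l} \<subseteq> {x. u \<bullet> x \<le> ?m}"
      by (rule hull_minimal) (auto simp: max4_def convex_halfspace_le)
    then show "y \<le> ?m" using x by auto
  qed
  then show ?thesis by (simp add: support_fun_def)
qed

lemma max4_measurable [measurable]: "max4 p q r l \<in> borel_measurable borel"
  unfolding max4_def by measurable

lemma max4_scaleR: "0 \<le> c \<Longrightarrow> max4 p q r l (c *\<^sub>R x) = c * max4 p q r l x"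
  by (simp add: max4_def max_mult_distrib_left)

lemma mean_width_hull4:
  "mean_width (convex hull {p, q, r, l}) = 2 / ball_volume * ball_width p q r l"
proof -
  let ?B = "ball 0 1 :: (real^3) set"
  have eB: "emeasure lborel ?B = ennreal ball_volume"
    unfolding ball_volume_def
    using emeasure_lborel_ball_finite[of "0::real^3" 1] by (intro emeasure_eq_ennreal_measure) auto
  have u: "uniform_measure lborel ?B = density lborel (\<lambda>x. ennreal (indicator ?B x / ball_volume))"
    unfolding uniform_measure_def eB
    by (intro density_cong) (auto simp: indicator_def divide_ennreal ball_volume_pos less_imp_le simp flip: ennreal_1)
  have [measurable]: "?B \<in> sets borel" by simp
  have "integral\<^sup>L sphere_measure (support_fun (convex hull {p, q, r, l}))
     = integral\<^sup>L sphere_measure (max4 p q r l)"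
    by (simp add: support_fun_hull4 [abs_def])
  also have "\<dots> = (\<integral>x. max4 p q r l (x /\<^sub>R norm x) \<partial>uniform_measure lborel ?B)"
    unfolding sphere_measure_def by (subst integral_distr) auto
  also have "\<dots> = (\<integral>x. indicator ?B x / ball_volume * max4 p q r l (x /\<^sub>R norm x) \<partial>lborel)"
    unfolding u using ball_volume_pos by (subst integral_density) (auto simp: less_imp_le)
  also have "\<dots> = (\<integral>x. (1 / ball_volume) * (indicator ?B x * (max4 p q r l x / norm x)) \<partial>lborel)"
    by (intro Bochner_Integration.integral_cong refl) (simp add: max4_scaleR divide_inverse mult_ac)
  also have "\<dots> = ball_width p q r l / ball_volume"
    unfolding ball_width_def integral_mult_right_zero by simp
  finally show ?thesis by (simp add: mean_width_def)
qed

text \<open>The vector representing the linear form \<open>cone_moment C\<close>. For the four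
  vertex cones these vectors are subgradients of \<open>ball_width\<close> with respect to the
  vertices.\<close>

definition ball_moment :: "(real^3) set \<Rightarrow> real^3" where
  "ball_moment C = (\<integral>x. (indicator C x * indicator (ball 0 1) x / norm x) *\<^sub>R x \<partial>lborel)"

lemma integrable_ball_moment:
  assumes [measurable]: "C \<in> sets borel"
  shows "integrable lborel (\<lambda>x::real^3. (indicator C x * indicator (ball 0 1) x / norm x) *\<^sub>R x)"
proof (rule Bochner_Integration.integrable_bound[where f = "indicator (ball 0 1) :: real^3 \<Rightarrow> real"])
  have [measurable]: "(ball 0 1 :: (real^3) set) \<in> sets borel" by simp
  show "(\<lambda>x::real^3. (indicator C x * indicator (ball 0 1) x / norm x) *\<^sub>R x) \<in> borel_measurable lborel"
    by simp
  show "integrable lborel (indicator (ball 0 1) :: real^3 \<Rightarrow> real)"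
    by (intro integrable_real_indicator emeasure_lborel_ball_finite) auto
qed (auto simp: indicator_def)

lemma cone_moment_eq_inner:
  assumes "C \<in> sets borel"
  shows "cone_moment C n = ball_moment C \<bullet> n"
proof -
  have "ball_moment C \<bullet> n = (\<integral>x. ((indicator C x * indicator (ball 0 1) x / norm x) *\<^sub>R x) \<bullet> n \<partial>lborel)"
    unfolding ball_moment_def using integrable_ball_moment[OF assms] by (intro integral_inner_left[symmetric]) auto
  then show ?thesis unfolding cone_moment_def by (simp add: mult.assoc)
qed

lemma integral_lborel_odd:
  fixes f :: "'a::euclidean_space \<Rightarrow> real"
  assumes [measurable]: "f \<in> borel_measurable borel" and odd: "\<And>x. f (- x) = - f x"
  shows "integral\<^sup>L lborel f = 0"
proof -
  have l: "lborel = distr lborel borel (uminus :: 'a \<Rightarrow> 'a)"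
    using lborel_affine[of "-1" "0::'a"] by (simp add: density_1)
  have "integral\<^sup>L lborel f = (\<integral>x. f (- x) \<partial>lborel)"
    by (subst l) (simp add: integral_distr)
  also have "\<dots> = - integral\<^sup>L lborel f" by (simp add: odd)
  finally show ?thesis by simp
qed

lemma vertex_cone_cases:
  assumes "vol3 (p - q) (p - r) (p - l) \<noteq> 0"
  shows "AE x in lborel. (x \<in> vertex_cone p q r l \<and> x \<notin> vertex_cone q r p l \<and> x \<notin> vertex_cone r p q l \<and> x \<notin> vertex_cone l q p r)
    \<or> (x \<notin> vertex_cone p q r l \<and> x \<in> vertex_cone q r p l \<and> x \<notin> vertex_cone r p q l \<and> x \<notin> vertex_cone l q p r)
    \<or> (x \<notin> vertex_cone p q r l \<and> x \<notin> vertex_cone q r p l \<and> x \<in> vertex_cone r p q l \<and> x \<notin> vertex_cone l q p r)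
    \<or> (x \<notin> vertex_cone p q r l \<and> x \<notin> vertex_cone q r p l \<and> x \<notin> vertex_cone r p q l \<and> x \<in> vertex_cone l q p r)"
    and "p \<noteq> q \<and> p \<noteq> r \<and> p \<noteq> l \<and> q \<noteq> r \<and> q \<noteq> l \<and> r \<noteq> l"
proof -
  show ne: "p \<noteq> q \<and> p \<noteq> r \<and> p \<noteq> l \<and> q \<noteq> r \<and> q \<noteq> l \<and> r \<noteq> l"
    using assms by (auto simp: dot_cross_self)
  have "AE x in lborel. x \<bullet> (p - q) \<noteq> 0" "AE x in lborel. x \<bullet> (p - r) \<noteq> 0" "AE x in lborel. x \<bullet> (p - l) \<noteq> 0"
      "AE x in lborel. x \<bullet> (q - r) \<noteq> 0" "AE x in lborel. x \<bullet> (q - l) \<noteq> 0" "AE x in lborel. x \<bullet> (r - l) \<noteq> 0"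
    using ne by (auto intro!: AE_inner_neq_0)
  then show "AE x in lborel. (x \<in> vertex_cone p q r l \<and> x \<notin> vertex_cone q r p l \<and> x \<notin> vertex_cone r p q l \<and> x \<notin> vertex_cone l q p r)
    \<or> (x \<notin> vertex_cone p q r l \<and> x \<in> vertex_cone q r p l \<and> x \<notin> vertex_cone r p q l \<and> x \<notin> vertex_cone l q p r)
    \<or> (x \<notin> vertex_cone p q r l \<and> x \<notin> vertex_cone q r p l \<and> x \<in> vertex_cone r p q l \<and> x \<notin> vertex_cone l q p r)
    \<or> (x \<notin> vertex_cone p q r l \<and> x \<notin> vertex_cone q r p l \<and> x \<notin> vertex_cone r p q l \<and> x \<in> vertex_cone l q p r)"
  proof eventually_elim
    case (elim x)
    then show ?case unfolding vertex_cone_def inner_diff_right by simp linarith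
  qed
qed

text \<open>The four normal cones cover space up to a null set, so the sum is the moment of the
  whole ball, which vanishes by the symmetry \<open>x \<mapsto> - x\<close>.\<close>

lemma ball_moment_sum:
  assumes "vol3 (p - q) (p - r) (p - l) \<noteq> 0"
  shows "ball_moment (vertex_cone p q r l) + ball_moment (vertex_cone q r p l)
     + ball_moment (vertex_cone r p q l) + ball_moment (vertex_cone l q p r) = 0" (is "?S = 0")
proof -
  have [measurable]: "(ball 0 1 :: (real^3) set) \<in> sets borel" by simp
  define f where "f = (\<lambda>C n (x::real^3). indicator C x * (indicator (ball 0 1) x * (x \<bullet> n / norm x)) :: real)"
  have I: "integrable lborel (f C n)" if "C \<in> sets borel" for C and n :: "real^3"
    unfolding f_def using that by (rule integrable_cone)
  have [measurable]: "f C n \<in> borel_measurable borel" if "C \<in> sets borel" for C and n :: "real^3"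
    using I[OF that] by auto
  have "?S \<bullet> n = 0" for n
  proof -
    have "?S \<bullet> n = integral\<^sup>L lborel (f (vertex_cone p q r l) n) + integral\<^sup>L lborel (f (vertex_cone q r p l) n)
     + integral\<^sup>L lborel (f (vertex_cone r p q l) n) + integral\<^sup>L lborel (f (vertex_cone l q p r) n)"
      by (simp add: inner_add_left cone_moment_eq_inner[symmetric] cone_moment_def f_def)
    also have "\<dots> = (\<integral>x. f (vertex_cone p q r l) n x + f (vertex_cone q r p l) n x
      + f (vertex_cone r p q l) n x + f (vertex_cone l q p r) n x \<partial>lborel)"
      by (simp add: I)
    also have "\<dots> = (\<integral>x. indicator (ball 0 1) x * (x \<bullet> n / norm x) \<partial>lborel)"
    proof (rule integral_cong_AE)
      show "AE x in lborel. f (vertex_cone p q r l) n x + f (vertex_cone q r p l) n x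
        + f (vertex_cone r p q l) n x + f (vertex_cone l q p r) n x = indicator (ball 0 1) x * (x \<bullet> n / norm x)"
        using vertex_cone_cases(1)[OF assms] by eventually_elim (auto simp: f_def)
    qed auto
    also have "\<dots> = 0"
      by (rule integral_lborel_odd) (auto simp: indicator_def)
    finally show ?thesis .
  qed
  then show ?thesis by (metis inner_eq_zero_iff)
qed

lemma integrable_max4: "integrable lborel (\<lambda>x. indicator (ball 0 1) x * (max4 p q r l x / norm x))"
proof (rule Bochner_Integration.integrable_bound[where f = "\<lambda>x. (norm p + norm q + norm r + norm l) * indicator (ball 0 1) x"])
  have [measurable]: "(ball 0 1 :: (real^3) set) \<in> sets borel" by simp
  show "(\<lambda>x. indicator (ball 0 1) x * (max4 p q r l x / norm x)) \<in> borel_measurable lborel" by simp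
  show "integrable lborel (\<lambda>x::real^3. (norm p + norm q + norm r + norm l) * indicator (ball 0 1) x)"
    by (intro integrable_mult_right integrable_real_indicator emeasure_lborel_ball_finite) auto
  show "AE x in lborel. norm (indicator (ball 0 1) x * (max4 p q r l x / norm x))
     \<le> norm ((norm p + norm q + norm r + norm l) * indicator (ball 0 1) x)"
  proof (rule AE_I2)
    fix x :: "real^3"
    have "max4 p q r l x \<in> {x \<bullet> p, x \<bullet> q, x \<bullet> r, x \<bullet> l}" by (auto simp: max4_def max_def)
    then have "\<bar>max4 p q r l x\<bar> \<le> norm x * norm p + norm x * norm q + norm x * norm r + norm x * norm l"
      using Cauchy_Schwarz_ineq2[of x p] Cauchy_Schwarz_ineq2[of x q] Cauchy_Schwarz_ineq2[of x r] Cauchy_Schwarz_ineq2[of x l]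
        mult_nonneg_nonneg[OF norm_ge_zero[of x] norm_ge_zero[of p]] mult_nonneg_nonneg[OF norm_ge_zero[of x] norm_ge_zero[of q]]
        mult_nonneg_nonneg[OF norm_ge_zero[of x] norm_ge_zero[of r]] mult_nonneg_nonneg[OF norm_ge_zero[of x] norm_ge_zero[of l]]
      by (elim insertE emptyE) simp_all
    also have "\<dots> = (norm p + norm q + norm r + norm l) * norm x" by (simp add: algebra_simps)
    finally have "\<bar>max4 p q r l x / norm x\<bar> \<le> norm p + norm q + norm r + norm l"
      by (cases "x = 0") (simp_all add: field_simps)
    then show "norm (indicator (ball 0 1) x * (max4 p q r l x / norm x))
     \<le> norm ((norm p + norm q + norm r + norm l) * indicator (ball 0 1) x)"
      by (simp add: indicator_def)
  qed
qed

text \<open>On each cone of the old simplex the maximum over the new vertices is at least the inner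
  product with the corresponding new vertex. For the old vertices themselves equality holds, by
  \<open>ball_width_eq_moments\<close>.\<close>

lemma ball_width_ge:
  assumes "vol3 (p - q) (p - r) (p - l) \<noteq> 0"
  shows "ball_width p' q' r' l' \<ge> ball_moment (vertex_cone p q r l) \<bullet> p' + ball_moment (vertex_cone q r p l) \<bullet> q'
     + ball_moment (vertex_cone r p q l) \<bullet> r' + ball_moment (vertex_cone l q p r) \<bullet> l'" (is "_ \<ge> ?S")
proof -
  define f where "f = (\<lambda>C n (x::real^3). indicator C x * (indicator (ball 0 1) x * (x \<bullet> n / norm x)) :: real)"
  have I: "integrable lborel (f C n)" if "C \<in> sets borel" for C and n :: "real^3"
    unfolding f_def using that by (rule integrable_cone)
  have "?S = integral\<^sup>L lborel (f (vertex_cone p q r l) p') + integral\<^sup>L lborel (f (vertex_cone q r p l) q')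
     + integral\<^sup>L lborel (f (vertex_cone r p q l) r') + integral\<^sup>L lborel (f (vertex_cone l q p r) l')"
    by (simp add: cone_moment_eq_inner[symmetric] cone_moment_def f_def)
  also have "\<dots> = (\<integral>x. f (vertex_cone p q r l) p' x + f (vertex_cone q r p l) q' x
      + f (vertex_cone r p q l) r' x + f (vertex_cone l q p r) l' x \<partial>lborel)"
    by (simp add: I)
  also have "\<dots> \<le> ball_width p' q' r' l'"
    unfolding ball_width_def
  proof (rule integral_mono_AE[OF _ integrable_max4])
    show "integrable lborel (\<lambda>x. f (vertex_cone p q r l) p' x + f (vertex_cone q r p l) q' x
      + f (vertex_cone r p q l) r' x + f (vertex_cone l q p r) l' x)"
      by (simp add: I)
    show "AE x in lborel. f (vertex_cone p q r l) p' x + f (vertex_cone q r p l) q' x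
        + f (vertex_cone r p q l) r' x + f (vertex_cone l q p r) l' x
        \<le> indicator (ball 0 1) x * (max4 p' q' r' l' x / norm x)"
      using vertex_cone_cases(1)[OF assms]
      by eventually_elim (auto simp: f_def max4_def indicator_def intro!: divide_right_mono)
  qed
  finally show ?thesis .
qed

lemma ball_width_eq_moments:
  assumes "vol3 (p - q) (p - r) (p - l) \<noteq> 0"
  shows "ball_width p q r l = ball_moment (vertex_cone p q r l) \<bullet> p + ball_moment (vertex_cone q r p l) \<bullet> q
     + ball_moment (vertex_cone r p q l) \<bullet> r + ball_moment (vertex_cone l q p r) \<bullet> l"
  using vertex_cone_cases(2)[OF assms]
  by (subst ball_width_eq_cone_moments) (auto simp: cone_moment_eq_inner)

text \<open>On the cone every \<open>x\<close> has positive inner product with \<open>p - q\<close>,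
  so a vanishing moment would make the open set \<open>?C \<inter> ball 0 1\<close> negligible. It
  then remains to see that this set is nonempty.\<close>

lemma ball_moment_neq_0:
  assumes v: "vol3 (p - q) (p - r) (p - l) \<noteq> 0"
  shows "ball_moment (vertex_cone p q r l) \<noteq> 0"
proof
  let ?C = "vertex_cone p q r l"
  let ?f = "\<lambda>x. indicator ?C x * (indicator (ball 0 1) x * (x \<bullet> (p - q) / norm x)) :: real"
  assume "ball_moment ?C = 0"
  then have "integral\<^sup>L lborel ?f = 0"
    using cone_moment_eq_inner[of ?C "p - q"] by (simp add: cone_moment_def)
  moreover have "integrable lborel ?f" by (rule integrable_cone) simp
  moreover have "AE x in lborel. 0 \<le> ?f x" by (rule AE_I2) (auto simp: indicator_def vertex_cone_def)
  ultimately have "AE x in lborel. ?f x = 0" by (simp only: integral_nonneg_eq_0_iff_AE)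
  then have "AE x in lborel. x \<notin> ?C \<inter> ball 0 1"
    by eventually_elim (auto simp: vertex_cone_def)
  then have "?C \<inter> ball 0 1 \<in> null_sets lborel"
    by (subst (asm) AE_iff_null_sets[symmetric]) auto
  then have neg: "negligible (?C \<inter> ball 0 1)"
    by (simp add: negligible_iff_null_sets null_sets_completion_iff null_setsD2)
  have "open ?C" unfolding vertex_cone_def
    by (intro open_Collect_conj open_Collect_less continuous_intros)
  then have op: "open (?C \<inter> ball 0 1)" by auto
  \<comment> \<open>A vector with inner product \<open>1\<close> with all three differences; a small
    positive multiple of it lies in the cone and in the ball.\<close>
  define w where "w = face_dual (p - q) (p - r) (p - l)"
  have w: "w \<bullet> (p - q) = 1" "w \<bullet> (p - r) = 1" "w \<bullet> (p - l) = 1"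
    unfolding w_def by (rule face_dual_inner[OF v])+
  define t where "t = 1 / (2 * (norm w + 1))"
  have t: "0 < t" "t * norm w < 1" by (auto simp: t_def field_simps add_pos_nonneg intro: add_nonneg_pos)
  have "t *\<^sub>R w \<in> ?C \<inter> ball 0 1" using w t by (auto simp: vertex_cone_def)
  then show False using op neg open_not_negligible by blast
qed

lemma vol3_diff_cyclic:
  "vol3 (q - r) (q - p) (q - l) = vol3 (p - q) (p - r) (p - l)"
  "vol3 (r - p) (r - q) (r - l) = vol3 (p - q) (p - r) (p - l)"
  "vol3 (l - q) (l - p) (l - r) = vol3 (p - q) (p - r) (p - l)"
  by (simp_all add: cross3_simps)

lemma inner_le_norm_sgn:
  fixes g x :: "'a::real_inner"
  assumes "norm x \<le> 1"
  shows "g \<bullet> x \<le> g \<bullet> sgn g" and "g \<noteq> 0 \<Longrightarrow> g \<bullet> x = g \<bullet> sgn g \<Longrightarrow> x = sgn g"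
proof -
  have e: "g \<bullet> sgn g = norm g"
    by (cases "g = 0") (simp_all add: sgn_div_norm dot_square_norm power2_eq_square)
  have "g \<bullet> x \<le> norm g * norm x" by (rule norm_cauchy_schwarz)
  also have "\<dots> \<le> norm g" using assms by (simp add: mult_left_le)
  finally show "g \<bullet> x \<le> g \<bullet> sgn g" by (simp add: e)
  assume g: "g \<noteq> 0" and eq: "g \<bullet> x = g \<bullet> sgn g"
  then have "sgn g \<bullet> x = 1" unfolding e by (simp add: sgn_div_norm)
  moreover have "sgn g \<bullet> sgn g = 1" using g by (simp add: dot_square_norm norm_sgn)
  moreover have "x \<bullet> x \<le> 1" using assms by (simp add: dot_square_norm power_le_one)
  ultimately have "(x - sgn g) \<bullet> (x - sgn g) \<le> 0"
    by (simp add: inner_diff_left inner_diff_right inner_commute)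
  then have "x - sgn g = 0" by (metis inner_eq_zero_iff inner_ge_zero order_antisym)
  then show "x = sgn g" by simp
qed

text \<open>One step of ascent: the moments of the vertex cones are a subgradient of the width
  functional, so replacing each vertex by the unit vector in the direction of its moment
  does not decrease the width; as the moments add up to 0, the new vertices are
  positively dependent.\<close>

lemma ball_width_ascent:
  assumes v: "vol3 (p - q) (p - r) (p - l) \<noteq> 0"
    and n: "norm p \<le> 1" "norm q \<le> 1" "norm r \<le> 1" "norm l \<le> 1"
  obtains p' q' r' l' a b c e where
    "norm p' = 1" "norm q' = 1" "norm r' = 1" "norm l' = 1"
    "0 < a" "0 < b" "0 < c" "0 < e" "a *\<^sub>R p' + b *\<^sub>R q' + c *\<^sub>R r' + e *\<^sub>R l' = 0"
    "ball_width p q r l \<le> ball_width p' q' r' l'"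
    "ball_width p q r l = ball_width p' q' r' l' \<longrightarrow> p = p' \<and> q = q' \<and> r = r' \<and> l = l'"
proof -
  define g1 g2 g3 g4 where "g1 = ball_moment (vertex_cone p q r l)" "g2 = ball_moment (vertex_cone q r p l)"
    "g3 = ball_moment (vertex_cone r p q l)" "g4 = ball_moment (vertex_cone l q p r)"
  have nz: "g1 \<noteq> 0" "g2 \<noteq> 0" "g3 \<noteq> 0" "g4 \<noteq> 0"
    unfolding g1_g2_g3_g4_def using v
    by (auto intro!: ball_moment_neq_0 simp only: vol3_diff_cyclic[where p = p and q = q and r = r and l = l])
  have W: "ball_width p q r l = g1 \<bullet> p + g2 \<bullet> q + g3 \<bullet> r + g4 \<bullet> l"
    unfolding g1_g2_g3_g4_def by (rule ball_width_eq_moments[OF v])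
  have W': "g1 \<bullet> sgn g1 + g2 \<bullet> sgn g2 + g3 \<bullet> sgn g3 + g4 \<bullet> sgn g4 \<le> ball_width (sgn g1) (sgn g2) (sgn g3) (sgn g4)"
    unfolding g1_g2_g3_g4_def by (rule ball_width_ge[OF v])
  note le = inner_le_norm_sgn(1)[OF n(1), of g1] inner_le_norm_sgn(1)[OF n(2), of g2]
    inner_le_norm_sgn(1)[OF n(3), of g3] inner_le_norm_sgn(1)[OF n(4), of g4]
  show ?thesis
  proof (rule that[of "sgn g1" "sgn g2" "sgn g3" "sgn g4" "norm g1" "norm g2" "norm g3" "norm g4"])
    have "norm g1 *\<^sub>R sgn g1 + norm g2 *\<^sub>R sgn g2 + norm g3 *\<^sub>R sgn g3 + norm g4 *\<^sub>R sgn g4 = g1 + g2 + g3 + g4"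
      using nz by (simp add: sgn_div_norm)
    also have "\<dots> = 0" unfolding g1_g2_g3_g4_def by (rule ball_moment_sum[OF v])
    finally show "norm g1 *\<^sub>R sgn g1 + norm g2 *\<^sub>R sgn g2 + norm g3 *\<^sub>R sgn g3 + norm g4 *\<^sub>R sgn g4 = 0" .
    show "ball_width p q r l \<le> ball_width (sgn g1) (sgn g2) (sgn g3) (sgn g4)"
      using W W' le by linarith
    have "p = sgn g1 \<and> q = sgn g2 \<and> r = sgn g3 \<and> l = sgn g4"
      if "ball_width p q r l = ball_width (sgn g1) (sgn g2) (sgn g3) (sgn g4)"
    proof -
      have "g1 \<bullet> p = g1 \<bullet> sgn g1" "g2 \<bullet> q = g2 \<bullet> sgn g2" "g3 \<bullet> r = g3 \<bullet> sgn g3" "g4 \<bullet> l = g4 \<bullet> sgn g4"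
        using that W W' le by linarith+
      then show ?thesis using inner_le_norm_sgn(2) n nz by blast
    qed
    then show "ball_width p q r l = ball_width (sgn g1) (sgn g2) (sgn g3) (sgn g4) \<longrightarrow>
      p = sgn g1 \<and> q = sgn g2 \<and> r = sgn g3 \<and> l = sgn g4" ..
  qed (use nz in \<open>simp_all add: norm_sgn\<close>)
qed

lemma ball_width_swap: "ball_width q p r l = ball_width p q r l"
  by (simp add: ball_width_def max4_def max.commute)

lemma ball_width_inscribed:
  assumes u: "norm p = 1" "norm q = 1" "norm r = 1" "norm l = 1"
    and c: "0 < a" "0 < b" "0 < c" "0 < e" "a *\<^sub>R p + b *\<^sub>R q + c *\<^sub>R r + e *\<^sub>R l = 0"
    and d: "vol3 p q r \<noteq> 0"
  shows "ball_width p q r l \<le> arc_max / 3"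
    and "ball_width p q r l = arc_max / 3 \<Longrightarrow> p \<bullet> q = -1/3 \<and> p \<bullet> r = -1/3 \<and> p \<bullet> l = -1/3 \<and> q \<bullet> r = -1/3 \<and> q \<bullet> l = -1/3 \<and> r \<bullet> l = -1/3"
proof -
  have "ball_width p q r l \<le> arc_max / 3 \<and> (ball_width p q r l = arc_max / 3 \<longrightarrow>
    p \<bullet> q = -1/3 \<and> p \<bullet> r = -1/3 \<and> p \<bullet> l = -1/3 \<and> q \<bullet> r = -1/3 \<and> q \<bullet> l = -1/3 \<and> r \<bullet> l = -1/3)"
  proof (cases "vol3 p q r > 0")
    case True
    show ?thesis
      using arc_sum_le[OF u c True] ball_width_formula[OF u c True] by auto
  next
    case False
    then have d': "vol3 q p r > 0" using d vol3_swap[of q p r] by simp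
    have c': "b *\<^sub>R q + a *\<^sub>R p + c *\<^sub>R r + e *\<^sub>R l = 0" using c(5) by (simp add: add_ac)
    note c = c(2,1,3,4) c'
    show ?thesis
      using arc_sum_le[OF u(2,1,3,4) c d'] ball_width_formula[OF u(2,1,3,4) c d']
      by (auto simp: ball_width_swap[of q p] inner_commute[of q p])
  qed
  then show "ball_width p q r l \<le> arc_max / 3"
    and "ball_width p q r l = arc_max / 3 \<Longrightarrow> p \<bullet> q = -1/3 \<and> p \<bullet> r = -1/3 \<and> p \<bullet> l = -1/3 \<and> q \<bullet> r = -1/3 \<and> q \<bullet> l = -1/3 \<and> r \<bullet> l = -1/3"
    by auto
qed

section \<open>Continuity and degenerate configurations\<close>

lemma ball_width_lipschitz:
  "ball_width p q r l \<le> ball_width p' q' r' l'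
     + (norm (p - p') + norm (q - q') + norm (r - r') + norm (l - l')) * ball_volume"
proof -
  let ?K = "norm (p - p') + norm (q - q') + norm (r - r') + norm (l - l')"
  have iB: "integrable lborel (indicator (ball 0 1) :: real^3 \<Rightarrow> real)"
    by (intro integrable_real_indicator emeasure_lborel_ball_finite) auto
  have "ball_width p q r l \<le> (\<integral>x. indicator (ball 0 1) x * (max4 p' q' r' l' x / norm x) + ?K * indicator (ball 0 1) x \<partial>lborel)"
    unfolding ball_width_def
  proof (rule integral_mono[OF integrable_max4])
    show "integrable lborel (\<lambda>x. indicator (ball 0 1) x * (max4 p' q' r' l' x / norm x) + ?K * indicator (ball 0 1) x)"
      by (intro Bochner_Integration.integrable_add integrable_max4 integrable_mult_right iB)
    fix x :: "real^3"
    have le: "x \<bullet> y \<le> x \<bullet> y' + norm x * norm (y - y')" for y y'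
      using norm_cauchy_schwarz[of x "y - y'"] by (simp add: inner_diff_right)
    have "max4 p q r l x \<le> max4 p' q' r' l' x + ?K * norm x"
    proof -
      have "x \<bullet> p \<le> max4 p' q' r' l' x + norm x * norm (p - p')" "x \<bullet> q \<le> max4 p' q' r' l' x + norm x * norm (q - q')"
        "x \<bullet> r \<le> max4 p' q' r' l' x + norm x * norm (r - r')" "x \<bullet> l \<le> max4 p' q' r' l' x + norm x * norm (l - l')"
        using le[of p p'] le[of q q'] le[of r r'] le[of l l'] by (auto simp: max4_def)
      moreover have "norm x * norm (p - p') \<le> ?K * norm x" "norm x * norm (q - q') \<le> ?K * norm x"
        "norm x * norm (r - r') \<le> ?K * norm x" "norm x * norm (l - l') \<le> ?K * norm x"
        unfolding mult.commute[of "norm x"] by (auto intro!: mult_right_mono)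
      ultimately show ?thesis unfolding max4_def[of p q r l] by (auto intro: order_trans)
    qed
    then have "max4 p q r l x / norm x \<le> max4 p' q' r' l' x / norm x + ?K" if "x \<noteq> 0"
      using that by (simp add: field_simps)
    then show "indicator (ball 0 1) x * (max4 p q r l x / norm x)
      \<le> indicator (ball 0 1) x * (max4 p' q' r' l' x / norm x) + ?K * indicator (ball 0 1) x"
      by (cases "x = 0") (auto simp: indicator_def)
  qed
  also have "\<dots> = ball_width p' q' r' l' + ?K * ball_volume"
    unfolding ball_width_def ball_volume_def
    by (subst Bochner_Integration.integral_add[OF integrable_max4 integrable_mult_right[OF iB]]) simp
  finally show ?thesis .
qed

text \<open>A degenerate configuration is a limit of nondegenerate ones: perturb the vertices
  linearly in a direction respecting the dependency; the volume is then a
  polynomial of degree 3 in the parameter.\<close>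

lemma ball_width_inscribed_le:
  assumes u: "norm p = 1" "norm q = 1" "norm r = 1" "norm l = 1"
    and c: "0 < a" "0 < b" "0 < c" "0 < e" "a *\<^sub>R p + b *\<^sub>R q + c *\<^sub>R r + e *\<^sub>R l = 0"
  shows "ball_width p q r l \<le> arc_max / 3"
proof -
  define w1 w2 w3 :: "real^3" where "w1 = axis 1 1" "w2 = axis 2 1" "w3 = axis 3 1"
  \<comment> \<open>Chosen so that the perturbed vertices satisfy the dependency with the same
    coefficients \<open>a\<close>, \<open>b\<close>, \<open>c\<close>, \<open>e\<close>.\<close>
  define w4 where "w4 = - ((a / e) *\<^sub>R w1 + (b / e) *\<^sub>R w2 + (c / e) *\<^sub>R w3)"
  define P Q R L where "P = (\<lambda>t::real. p + t *\<^sub>R w1)" "Q = (\<lambda>t::real. q + t *\<^sub>R w2)"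
    "R = (\<lambda>t::real. r + t *\<^sub>R w3)" "L = (\<lambda>t::real. l + t *\<^sub>R w4)"
  have dep: "a *\<^sub>R P t + b *\<^sub>R Q t + c *\<^sub>R R t + e *\<^sub>R L t = 0" for t
  proof -
    have "e *\<^sub>R w4 = - (a *\<^sub>R w1 + b *\<^sub>R w2 + c *\<^sub>R w3)"
      using c(4) by (simp add: w4_def scaleR_diff_right)
    then have z: "a *\<^sub>R w1 + b *\<^sub>R w2 + c *\<^sub>R w3 + e *\<^sub>R w4 = 0" by simp
    have "a *\<^sub>R P t + b *\<^sub>R Q t + c *\<^sub>R R t + e *\<^sub>R L t = (a *\<^sub>R p + b *\<^sub>R q + c *\<^sub>R r + e *\<^sub>R l)
       + t *\<^sub>R (a *\<^sub>R w1 + b *\<^sub>R w2 + c *\<^sub>R w3 + e *\<^sub>R w4)"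
      by (simp add: P_Q_R_L_def algebra_simps)
    then show ?thesis using c(5) z by simp
  qed
  \<comment> \<open>The leading coefficient is \<open>vol3 w1 w2 w3 = 1\<close>, so the polynomial
    is nonzero whatever \<open>p\<close>, \<open>q\<close>, \<open>r\<close> are.\<close>
  define \<pi> where "\<pi> = [: vol3 p q r, vol3 w1 q r + vol3 p w2 r + vol3 p q w3, vol3 w1 w2 r + vol3 w1 q w3 + vol3 p w2 w3, 1 :]"
  have vol: "vol3 (P t) (Q t) (R t) = poly \<pi> t" for t
  proof -
    have "vol3 w1 w2 w3 = 1" by (simp add: w1_w2_w3_def cross3_simps axis_def)
    moreover have "vol3 (P t) (Q t) (R t) = vol3 p q r + t * (vol3 w1 q r + vol3 p w2 r + vol3 p q w3
        + t * (vol3 w1 w2 r + vol3 w1 q w3 + vol3 p w2 w3 + t * vol3 w1 w2 w3))"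
      unfolding P_Q_R_L_def cross_add_left cross_add_right cross_mult_left cross_mult_right
      by (simp add: inner_add_left inner_add_right algebra_simps)
    ultimately show ?thesis by (simp add: \<pi>_def)
  qed
  have "finite {t. poly \<pi> t = 0}" by (rule poly_roots_finite) (simp add: \<pi>_def)
  then have "open (- ({t. poly \<pi> t = 0} - {0}))"
    by (intro open_Compl finite_imp_closed finite_Diff)
  then have "eventually (\<lambda>t. t \<notin> {t. poly \<pi> t = 0} - {0}) (at 0)"
    unfolding eventually_at_topological by blast
  moreover have "eventually (\<lambda>t::real. t \<noteq> 0) (at 0)" by (simp add: eventually_at_filter)
  ultimately have nz: "eventually (\<lambda>t. vol3 (P t) (Q t) (R t) \<noteq> 0) (at 0)"
    by eventually_elim (auto simp: vol)
  have lim: "(P \<longlongrightarrow> p) (at 0)" "(Q \<longlongrightarrow> q) (at 0)" "(R \<longlongrightarrow> r) (at 0)" "(L \<longlongrightarrow> l) (at 0)"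
    unfolding P_Q_R_L_def by (auto intro!: tendsto_eq_intros)
  have u0: "p \<noteq> 0" "q \<noteq> 0" "r \<noteq> 0" "l \<noteq> 0" using u by auto
  have su: "sgn p = p" "sgn q = q" "sgn r = r" "sgn l = l" using u by (auto simp: sgn_div_norm)
  have ev0: "eventually (\<lambda>t. P t \<noteq> 0) (at 0)" "eventually (\<lambda>t. Q t \<noteq> 0) (at 0)"
     "eventually (\<lambda>t. R t \<noteq> 0) (at 0)" "eventually (\<lambda>t. L t \<noteq> 0) (at 0)"
    using lim u0 by (auto intro: tendsto_imp_eventually_ne)
  \<comment> \<open>The perturbed vertices leave the sphere and are normalised. This rescales the
    coefficients of the dependency by positive factors, and \<open>K t\<close> is the total
    displacement entering the Lipschitz bound.\<close>
  define K where "K = (\<lambda>t. norm (p - sgn (P t)) + norm (q - sgn (Q t)) + norm (r - sgn (R t)) + norm (l - sgn (L t)))"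
  have "(K \<longlongrightarrow> norm (p - sgn p) + norm (q - sgn q) + norm (r - sgn r) + norm (l - sgn l)) (at 0)"
    unfolding K_def by (intro tendsto_intros lim u0)
  then have K0: "(K \<longlongrightarrow> 0) (at 0)" by (simp add: su)
  have "((\<lambda>t. arc_max / 3 + K t * ball_volume) \<longlongrightarrow> arc_max / 3 + 0 * ball_volume) (at 0)"
    by (intro tendsto_intros K0)
  moreover have "eventually (\<lambda>t. ball_width p q r l \<le> arc_max / 3 + K t * ball_volume) (at 0)"
    using nz ev0
  proof eventually_elim
    case (elim t)
    have s: "sgn x = (1 / norm x) *\<^sub>R x" for x :: "real^3" by (simp add: sgn_div_norm divide_inverse)
    have sc: "norm x *\<^sub>R sgn x = x" for x :: "real^3"
      by (cases "x = 0") (simp_all add: sgn_div_norm)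
    have "vol3 (sgn (P t)) (sgn (Q t)) (sgn (R t)) \<noteq> 0"
      using elim by (simp add: s cross_mult_left cross_mult_right)
    moreover have "(a * norm (P t)) *\<^sub>R sgn (P t) + (b * norm (Q t)) *\<^sub>R sgn (Q t)
       + (c * norm (R t)) *\<^sub>R sgn (R t) + (e * norm (L t)) *\<^sub>R sgn (L t) = 0"
      using dep[of t] by (simp add: sc flip: scaleR_scaleR)
    ultimately have "ball_width (sgn (P t)) (sgn (Q t)) (sgn (R t)) (sgn (L t)) \<le> arc_max / 3"
      using elim c(1-4)
      by (intro ball_width_inscribed(1)[of _ _ _ _ "a * norm (P t)" "b * norm (Q t)" "c * norm (R t)" "e * norm (L t)"])
        (auto simp: norm_sgn)
    then show ?case
      using ball_width_lipschitz[of p q r l "sgn (P t)" "sgn (Q t)" "sgn (R t)" "sgn (L t)"] by (simp add: K_def)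
  qed
  ultimately show ?thesis
    using tendsto_lowerbound[of _ _ "at (0::real)"] by fastforce
qed

section \<open>The regular simplex\<close>

definition regular_frame :: "real^3 \<Rightarrow> real^3 \<Rightarrow> real^3 \<Rightarrow> real^3 \<Rightarrow> bool" where
  "regular_frame p q r l \<longleftrightarrow> norm p = 1 \<and> norm q = 1 \<and> norm r = 1 \<and> norm l = 1 \<and>
     p \<bullet> q = -1/3 \<and> p \<bullet> r = -1/3 \<and> p \<bullet> l = -1/3 \<and> q \<bullet> r = -1/3 \<and> q \<bullet> l = -1/3 \<and> r \<bullet> l = -1/3"

lemma regular_frame_sum:
  assumes "regular_frame p q r l" shows "p + q + r + l = 0"
proof -
  have "(p + q + r + l) \<bullet> (p + q + r + l) = 0"
    using assms unfolding regular_frame_def norm_eq_1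
    by (simp add: inner_add_left inner_add_right inner_commute)
  then show ?thesis by simp
qed

lemma ball_width_regular:
  assumes "regular_frame p q r l"
  shows "ball_width p q r l = arc_max / 3"
proof -
  have *: "ball_width p q r l = arc_max / 3" if f: "regular_frame p q r l" and d: "vol3 p q r > 0" for p q r l
  proof -
    note f' = f[unfolded regular_frame_def]
    have dep: "1 *\<^sub>R p + 1 *\<^sub>R q + 1 *\<^sub>R r + 1 *\<^sub>R l = 0" using regular_frame_sum[OF f] by simp
    note d' = vol3_dependent[OF zero_less_one zero_less_one zero_less_one zero_less_one dep d]
    show ?thesis
      using ball_width_formula[OF _ _ _ _ zero_less_one zero_less_one zero_less_one zero_less_one dep d]
        arc_sum_regular[OF _ _ _ _ _ _ _ _ _ _ d d'] f' by simp
  qed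
  have "(vol3 p q r)^2 = 16/27"
    using assms vol3_square_unit[of p q r] unfolding regular_frame_def by (simp add: power2_eq_square)
  then have "vol3 p q r \<noteq> 0" by auto
  then consider "vol3 p q r > 0" | "vol3 q p r > 0" using vol3_swap[of p q r] by linarith
  then show ?thesis
  proof cases
    case 1
    then show ?thesis using * assms by blast
  next
    case 2
    moreover have "regular_frame q p r l" using assms by (simp add: regular_frame_def inner_commute)
    ultimately show ?thesis using *[of q p r l] ball_width_swap by simp
  qed
qed

definition reg_vertex :: "real \<Rightarrow> real \<Rightarrow> real \<Rightarrow> real^3" where
  "reg_vertex x y z = (1 / sqrt 3) *\<^sub>R vector [x, y, z]"

lemma reg_tetra_eq:
  "reg_tetra = convex hull {reg_vertex 1 1 1, reg_vertex 1 (-1) (-1), reg_vertex (-1) 1 (-1), reg_vertex (-1) (-1) 1}"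
  by (simp add: reg_tetra_def reg_vertex_def)

lemma regular_frame_reg_vertex:
  "regular_frame (reg_vertex 1 1 1) (reg_vertex 1 (-1) (-1)) (reg_vertex (-1) 1 (-1)) (reg_vertex (-1) (-1) 1)"
proof -
  have *: "reg_vertex x y z \<bullet> reg_vertex x' y' z' = (x * x' + y * y' + z * z') / 3" for x y z x' y' z'
    by (simp add: reg_vertex_def inner_vec_def sum_3 add_divide_distrib)
  show ?thesis unfolding regular_frame_def norm_eq_1 * by simp
qed

text \<open>The vertices of a regular tetrahedron form a tight frame with constant
  \<open>4/3\<close>. As three of them are a basis, it suffices to compare inner products with
  \<open>p\<close>, \<open>q\<close>, \<open>r\<close>.\<close>

lemma regular_frame_decomp:
  assumes f: "regular_frame p q r l"
  shows "x = (3/4) *\<^sub>R ((x \<bullet> p) *\<^sub>R p + (x \<bullet> q) *\<^sub>R q + (x \<bullet> r) *\<^sub>R r + (x \<bullet> l) *\<^sub>R l)"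
proof -
  let ?y = "(3/4) *\<^sub>R ((x \<bullet> p) *\<^sub>R p + (x \<bullet> q) *\<^sub>R q + (x \<bullet> r) *\<^sub>R r + (x \<bullet> l) *\<^sub>R l)"
  have u: "p \<bullet> p = 1" "q \<bullet> q = 1" "r \<bullet> r = 1" "l \<bullet> l = 1"
    using f by (auto simp: regular_frame_def norm_eq_1)
  have g: "p \<bullet> q = -1/3" "p \<bullet> r = -1/3" "p \<bullet> l = -1/3" "q \<bullet> r = -1/3" "q \<bullet> l = -1/3" "r \<bullet> l = -1/3"
    "q \<bullet> p = -1/3" "r \<bullet> p = -1/3" "l \<bullet> p = -1/3" "r \<bullet> q = -1/3" "l \<bullet> q = -1/3" "l \<bullet> r = -1/3"
    using f by (auto simp: regular_frame_def inner_commute)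
  have "x \<bullet> (p + q + r + l) = 0" using regular_frame_sum[OF f] by simp
  then have s: "x \<bullet> l = - (x \<bullet> p + x \<bullet> q + x \<bullet> r)" by (simp add: inner_add_right)
  have "(vol3 p q r)^2 = 16/27"
    using f vol3_square_unit[of p q r] unfolding regular_frame_def by (simp add: power2_eq_square)
  then have "vol3 p q r \<noteq> 0" by auto
  then have "x - ?y = 0"
    by (rule inner_basis_eq_0) (simp_all add: inner_diff_left inner_add_left u g s field_simps)
  then show ?thesis by simp
qed

lemma regular_frame_inner_comb:
  fixes a b c e :: real
  assumes f: "regular_frame p q r l"
  shows "(a *\<^sub>R p + b *\<^sub>R q + c *\<^sub>R r + e *\<^sub>R l) \<bullet> (a *\<^sub>R p + b *\<^sub>R q + c *\<^sub>R r + e *\<^sub>R l) = a^2 + b^2 + c^2 + e^2 - 2/3 * (a * b + a * c + a * e + b * c + b * e + c * e)"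
proof -
  define x where "x = a *\<^sub>R p + b *\<^sub>R q + c *\<^sub>R r + e *\<^sub>R l"
  have "x \<bullet> x = a^2 * (p \<bullet> p) + b^2 * (q \<bullet> q) + c^2 * (r \<bullet> r) + e^2 * (l \<bullet> l) + 2 * (a * b * (p \<bullet> q)
    + a * c * (p \<bullet> r) + a * e * (p \<bullet> l) + b * c * (q \<bullet> r) + b * e * (q \<bullet> l) + c * e * (r \<bullet> l))"
    unfolding x_def by (simp add: inner_add_left inner_add_right inner_commute power2_eq_square algebra_simps)
  also have "\<dots> = a^2 * 1 + b^2 * 1 + c^2 * 1 + e^2 * 1 + 2 * (a * b * (-1/3)
    + a * c * (-1/3) + a * e * (-1/3) + b * c * (-1/3) + b * e * (-1/3) + c * e * (-1/3))"
    using f by (simp only: regular_frame_def norm_eq_1)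
  finally show ?thesis unfolding x_def by (simp add: field_simps)
qed

text \<open>The map keeps the frame coefficients of \<open>x\<close> and exchanges the frame. It
  preserves norms because the norm of a combination depends only on its coefficients and the Gram
  matrix, which the two frames share.\<close>

lemma regular_frame_isometry:
  assumes f: "regular_frame p q r l" and f': "regular_frame p' q' r' l'"
  obtains h :: "real^3 \<Rightarrow> real^3" where "linear h" "\<And>x. norm (h x) = norm x"
    "h p = p'" "h q = q'" "h r = r'" "h l = l'"
proof -
  define h where "h = (\<lambda>x. (3/4) *\<^sub>R ((x \<bullet> p) *\<^sub>R p' + (x \<bullet> q) *\<^sub>R q' + (x \<bullet> r) *\<^sub>R r' + (x \<bullet> l) *\<^sub>R l'))"
  have lin: "linear h"
  proof (rule linearI)
    show "h (x + y) = h x + h y" for x y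
      by (simp only: h_def inner_add_left scaleR_add_left scaleR_add_right add_ac)
    show "h (c *\<^sub>R x) = c *\<^sub>R h x" for c x
      by (simp only: h_def inner_scaleR_left scaleR_scaleR scaleR_add_right mult_ac real_scaleR_def)
  qed
  have g: "p \<bullet> p = 1" "q \<bullet> q = 1" "r \<bullet> r = 1" "l \<bullet> l = 1" 
    "p \<bullet> q = -1/3" "p \<bullet> r = -1/3" "p \<bullet> l = -1/3" "q \<bullet> r = -1/3" "q \<bullet> l = -1/3" "r \<bullet> l = -1/3"
    "q \<bullet> p = -1/3" "r \<bullet> p = -1/3" "l \<bullet> p = -1/3" "r \<bullet> q = -1/3" "l \<bullet> q = -1/3" "l \<bullet> r = -1/3"
    using f by (auto simp: regular_frame_def norm_eq_1 inner_commute)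
  have nrm: "norm (h x) = norm x" for x
  proof -
    define y where "y = (x \<bullet> p) *\<^sub>R p + (x \<bullet> q) *\<^sub>R q + (x \<bullet> r) *\<^sub>R r + (x \<bullet> l) *\<^sub>R l"
    define z where "z = (x \<bullet> p) *\<^sub>R p' + (x \<bullet> q) *\<^sub>R q' + (x \<bullet> r) *\<^sub>R r' + (x \<bullet> l) *\<^sub>R l'"
    have "z \<bullet> z = y \<bullet> y"
      unfolding y_def z_def regular_frame_inner_comb[OF f] regular_frame_inner_comb[OF f'] ..
    then have "norm z = norm y" by (simp add: norm_eq_sqrt_inner)
    moreover have "h x = (3/4) *\<^sub>R z" by (simp add: h_def z_def)
    moreover have "x = (3/4) *\<^sub>R y" unfolding y_def by (rule regular_frame_decomp[OF f])
    ultimately show ?thesis by (metis norm_scaleR)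
  qed
  have sum: "l' = - (p' + q' + r')"
    using regular_frame_sum[OF f'] by (metis add.commute minus_unique)
  have "h p = p'" "h q = q'" "h r = r'" "h l = l'"
    unfolding h_def g sum by (simp_all add: vec_eq_iff field_simps)
  then show ?thesis using that[OF lin nrm] by blast
qed

text \<open>An isometric copy of the regular tetrahedron inside the ball has to be inscribed: the
  squared norm of the sum of the vertices is four times the sum of their squared norms minus
  \<open>16\<close>. As it is nonnegative, each squared norm must attain its maximum
  \<open>1\<close>.\<close>

lemma regular_frame_if_dists:
  assumes n: "norm p \<le> 1" "norm q \<le> 1" "norm r \<le> 1" "norm l \<le> 1"
    and d: "(norm (p - q))^2 = 8/3" "(norm (p - r))^2 = 8/3" "(norm (p - l))^2 = 8/3"
      "(norm (q - r))^2 = 8/3" "(norm (q - l))^2 = 8/3" "(norm (r - l))^2 = 8/3"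
  shows "regular_frame p q r l"
proof -
  have pair: "x \<bullet> x + y \<bullet> y - 2 * (x \<bullet> y) = 8/3" if "(norm (x - y))^2 = 8/3" for x y :: "real^3"
    using that unfolding dot_square_norm[symmetric] by (simp add: inner_diff_left inner_diff_right inner_commute)
  have le: "x \<bullet> x \<le> 1" if "norm x \<le> 1" for x :: "real^3"
    using that by (simp add: dot_square_norm power_le_one)
  have "0 \<le> (p + q + r + l) \<bullet> (p + q + r + l)" by simp
  also have "\<dots> = 4 * (p \<bullet> p + q \<bullet> q + r \<bullet> r + l \<bullet> l) - 16"
    using d[THEN pair] by (simp add: inner_add_left inner_add_right inner_commute)
  finally have "p \<bullet> p + q \<bullet> q + r \<bullet> r + l \<bullet> l \<ge> 4" by simp
  then have "p \<bullet> p = 1" "q \<bullet> q = 1" "r \<bullet> r = 1" "l \<bullet> l = 1" using n[THEN le] by linarith+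
  moreover from this have "p \<bullet> q = -1/3" "p \<bullet> r = -1/3" "p \<bullet> l = -1/3" "q \<bullet> r = -1/3" "q \<bullet> l = -1/3" "r \<bullet> l = -1/3"
    using d[THEN pair] by linarith+
  ultimately show ?thesis by (simp add: regular_frame_def norm_eq_1)
qed

lemma regular_frame_dist:
  assumes "norm x = 1" "norm y = 1" "x \<bullet> y = -1/3"
  shows "(norm (x - y))^2 = 8/3"
  using assms unfolding dot_square_norm[symmetric] norm_eq_1
  by (simp add: inner_diff_left inner_diff_right inner_commute)

lemma mean_width_reg_tetra: "mean_width reg_tetra = 2 / ball_volume * (arc_max / 3)"
  unfolding reg_tetra_eq mean_width_hull4 ball_width_regular[OF regular_frame_reg_vertex] ..

text \<open>In the equality case neither the ascent nor the bound for the new vertices can be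
  strict, so the vertices did not move. The given simplex is then itself inscribed and positively
  dependent, and its nonzero volume admits the equality case of
  \<open>ball_width_inscribed\<close>.\<close>

lemma ball_width_simplex:
  assumes v: "vol3 (p - q) (p - r) (p - l) \<noteq> 0"
    and n: "norm p \<le> 1" "norm q \<le> 1" "norm r \<le> 1" "norm l \<le> 1"
  shows "ball_width p q r l \<le> arc_max / 3"
    and "ball_width p q r l = arc_max / 3 \<Longrightarrow> regular_frame p q r l"
proof -
  obtain p' q' r' l' a b c e where u: "norm p' = 1" "norm q' = 1" "norm r' = 1" "norm l' = 1"
    and c: "0 < a" "0 < b" "0 < c" "0 < e" "a *\<^sub>R p' + b *\<^sub>R q' + c *\<^sub>R r' + e *\<^sub>R l' = 0"
    and le: "ball_width p q r l \<le> ball_width p' q' r' l'"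
    and eq: "ball_width p q r l = ball_width p' q' r' l' \<longrightarrow> p = p' \<and> q = q' \<and> r = r' \<and> l = l'"
    by (rule ball_width_ascent[OF v n])
  have le': "ball_width p' q' r' l' \<le> arc_max / 3" by (rule ball_width_inscribed_le[OF u c])
  show "ball_width p q r l \<le> arc_max / 3" using le le' by simp
  assume "ball_width p q r l = arc_max / 3"
  then have same: "p' = p" "q' = q" "r' = r" "l' = l" using eq le le' by auto
  note c = c[unfolded same] and u = u[unfolded same]
  have "vol3 p q r \<noteq> 0"
  proof
    assume 0: "vol3 p q r = 0"
    \<comment> \<open>Eliminating \<open>l\<close> by the dependency shows that the volume of the
      simplex is a positive multiple of \<open>vol3 p q r\<close>.\<close>
    have "e * vol3 (p - q) (p - r) (p - l) = vol3 (p - q) (p - r) (e *\<^sub>R p - e *\<^sub>R l)"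
      by (simp add: cross_mult_right flip: scaleR_diff_right)
    also have "e *\<^sub>R p - e *\<^sub>R l = (e + a) *\<^sub>R p + b *\<^sub>R q + c *\<^sub>R r"
    proof -
      have "e *\<^sub>R l = - (a *\<^sub>R p + b *\<^sub>R q + c *\<^sub>R r)"
        using c(5) by (metis add.commute eq_neg_iff_add_eq_0)
      then show ?thesis by (simp add: scaleR_add_left)
    qed
    also have "vol3 (p - q) (p - r) \<dots> = (a + b + c + e) * vol3 p q r"
      by (simp add: cross3_simps)
    finally show False using 0 v c(4) by simp
  qed
  from ball_width_inscribed(2)[OF u c this] \<open>ball_width p q r l = arc_max / 3\<close> u
  show "regular_frame p q r l" by (simp add: regular_frame_def)
qed

theorem theorem2p7:
  fixes T :: "(real^3) set"
  assumes "3 simplex T" and "T \<subseteq> cball 0 1"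
  shows "mean_width T \<le> mean_width reg_tetra \<and>
         (mean_width T = mean_width reg_tetra \<longleftrightarrow>
            (\<exists>f :: real^3 \<Rightarrow> real^3. (\<forall>x y. dist (f x) (f y) = dist x y) \<and> f ` reg_tetra = T))"
proof -
  obtain p q r l where T: "T = convex hull {p, q, r, l}" and v: "vol3 (p - q) (p - r) (p - l) \<noteq> 0"
    using simplex3_vertices[OF assms(1)] .
  have n: "norm p \<le> 1" "norm q \<le> 1" "norm r \<le> 1" "norm l \<le> 1"
    using hull_subset[of "{p, q, r, l}" convex] assms(2) unfolding T by auto
  note B = ball_width_simplex[OF v n]
  have V: "0 < 2 / ball_volume" using ball_volume_pos by simp
  have le: "mean_width T \<le> mean_width reg_tetra"
    unfolding T mean_width_hull4 mean_width_reg_tetra using B(1) V by (intro mult_left_mono) auto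
  let ?v1 = "reg_vertex 1 1 1" and ?v2 = "reg_vertex 1 (-1) (-1)"
    and ?v3 = "reg_vertex (-1) 1 (-1)" and ?v4 = "reg_vertex (-1) (-1) 1"
  note f0 = regular_frame_reg_vertex
  have "\<exists>f :: real^3 \<Rightarrow> real^3. (\<forall>x y. dist (f x) (f y) = dist x y) \<and> f ` reg_tetra = T"
    if "mean_width T = mean_width reg_tetra"
  proof -
    have "ball_width p q r l = arc_max / 3"
      using that V unfolding T mean_width_hull4 mean_width_reg_tetra mult_cancel_left by linarith
    then have R: "regular_frame p q r l" by (rule B(2))
    obtain h :: "real^3 \<Rightarrow> real^3" where h: "linear h" "\<And>x. norm (h x) = norm x"
      "h ?v1 = p" "h ?v2 = q" "h ?v3 = r" "h ?v4 = l"
      using regular_frame_isometry[OF f0 R] by metis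
    have "dist (h x) (h y) = dist x y" for x y
      using h(2)[of "x - y"] by (simp add: dist_norm linear_diff[OF h(1)])
    moreover have "h ` reg_tetra = T"
      unfolding reg_tetra_eq T using h by (simp add: convex_hull_linear_image)
    ultimately show ?thesis by blast
  qed
  moreover have "mean_width T = mean_width reg_tetra"
    if f: "\<And>x y. dist (f x) (f y) = dist x y" and fT: "f ` reg_tetra = T" for f :: "real^3 \<Rightarrow> real^3"
  proof -
    \<comment> \<open>The isometry need not fix the origin. After subtracting \<open>f 0\<close> it
      is linear and commutes with convex hulls, and the translation is restored afterwards.\<close>
    define g where "g = (\<lambda>x. f x - f 0)"
    have "linear g"
      by (rule isometry_linear) (auto simp: g_def dist_norm f[unfolded dist_norm])
    then have "g ` reg_tetra = convex hull {g ?v1, g ?v2, g ?v3, g ?v4}"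
      unfolding reg_tetra_eq by (simp add: convex_hull_linear_image)
    moreover have "T = (+) (f 0) ` g ` reg_tetra"
      unfolding fT[symmetric] image_image by (simp add: g_def)
    ultimately have Tf: "T = convex hull {f ?v1, f ?v2, f ?v3, f ?v4}"
      by (simp add: convex_hull_translation[symmetric] g_def)
    have d: "(norm (f x - f y))^2 = (norm (x - y))^2" for x y using f by (simp add: dist_norm)
    have "norm (f ?v1) \<le> 1" "norm (f ?v2) \<le> 1" "norm (f ?v3) \<le> 1" "norm (f ?v4) \<le> 1"
      using hull_subset[of "{f ?v1, f ?v2, f ?v3, f ?v4}" convex] assms(2) unfolding Tf by auto
    then have "regular_frame (f ?v1) (f ?v2) (f ?v3) (f ?v4)"
      by (rule regular_frame_if_dists; use f0 in \<open>(simp only: d regular_frame_def regular_frame_dist)\<close>)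
    then show ?thesis
      unfolding mean_width_reg_tetra by (simp add: Tf mean_width_hull4 ball_width_regular)
  qed
  ultimately show ?thesis using le by blast
qed

end
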